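(* Let $\mathbb F$ be an algebraically closed field of characteristic $0$ and let $n\ge 1$. (a) Let $f(x)=Ax+b$ and $g(x)=Cx+d$ be two affine operators $\mathbb F^n\to\mathbb F^n$, where $A,C\in\mathbb F^{n\times n}$ and $b,d\in\mathbb F^n$. (i) If $f$ and $g$ both have fixed points, then $f$ and $g$ are biregularly conjugate if and only if their matrices $A$ and $C$ are similar. (ii) If neither $f$ nor $g$ has a fixed point, then $f$ and $g$ are biregularly conjugate if and only if the nonsingular parts $A_*$ and $C_*$ have the same eigenvalues with the same multiplicities, and the nilpotent parts $A_\circ$ and $C_\circ$ are similar. (b) Let $f(x)=Ax+b$ be an affine operator $\mathbb F^n\to\mathbb F^n$, where $A\in\mathbb F^{n\times n}$ and $b\in\mathbb F^n$. A canonical form of $f$ under biregular conjugacy is the following. (i) If $f$ has a fixed point, then $f$ is biregularly conjugate to the linear operator $x\mapsto Jx$, in which $J$ is the Jordan canonical form of $A$. The matrix $J$ is uniquely determined by $f$ up to permutation of blocks (i.e., if $f$ is biregularly conjugate to $x\mapsto J'x$ with $J'$ a Jordan matrix, then $J'$ coincides with $J$ up to permutation of Jordan blocks). (ii) If $f$ has no fixed point, then $f$ is biregularly conjugate to the affine operator $$ \begin{bmatrix} x_1\\ x_2\\ \vdots\\ x_n\end{bmatrix}\mapsto \begin{bmatrix} x_1+1\\ \alpha_2x_2\\ \vdots\\ \alpha_kx_k\\ J_\circ\tilde x\end{bmatrix}, \qquad \tilde x:=\begin{bmatrix} x_{k+1}\\ x_{k+2}\\ \vdots\\ x_n\end{bmatrix},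 $$ in which $1,\alpha_2,\dots,\alpha_k\in\mathbb F\setminus\{0\}$ are all the eigenvalues of $A_*$ repeated according to their multiplicities (so $A_*$ is $k\times k$), and $J_\circ$ is the Jordan canonical form of $A_\circ$. This affine operator is uniquely determined by $f$, up to permutation of the eigenvalues $\alpha_2,\dots,\alpha_k$ and permutation of blocks in $J_\circ$ (i.e., any two affine operators of the displayed form, with $1\le k\le n$, $\alpha_2,\dots,\alpha_k\in\mathbb F\setminus\{0\}$ and $J_\circ$ a nilpotent Jordan matrix of size $(n-k)\times(n-k)$, that are both biregularly conjugate to $f$ have the same $k$, the same $\alpha_2,\dots,\alpha_k$ up to permutation, and the same $J_\circ$ up to permutation of Jordan blocks).
   Context: An affine operator on $\mathbb F^n$ is a map $f:\mathbb F^n\to\mathbb F^n$ of the form $f(x)=Ax+b$ with $A\in\mathbb F^{n\times n}$ and $b\in\mathbb F^n$; $A$ is called its matrix. It is not assumed to be bijective. A fixed point of $f$ is an $x$ with $f(x)=x$. A bijection $h:\mathbb F^n\to\mathbb F^n$ is biregular if both $h$ and $h^{-1}$ have the form $(x_1,\dots,x_n)\mapsto(h_1(x_1,\dots,x_n),\dots,h_n(x_1,\dots,x_n))$ with all $h_i$ polynomials over $\mathbb F$. Two maps $f,g:\mathbb F^n\to\mathbb F^n$ are biregularly conjugate if $g=h^{-1}fh$ for some biregular bijection $h:\mathbb F^n\to\mathbb F^n$. Two matrices $A,B\in\mathbb F^{n\times n}$ are similar if $A=S^{-1}BS$ for some nonsingular $S\in\mathbb F^{n\times n}$. Each square matrix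 $A$ is similar to a direct sum (block-diagonal matrix) $A_*\oplus A_\circ$, in which $A_*$ is nonsingular and $A_\circ$ is nilpotent (either summand may be empty, of size $0\times 0$); $A_*$ and $A_\circ$ are determined by $A$ up to similarity. The matrices $C_*$ and $C_\circ$ are defined from $C$ in the same way. "Multiplicity" of an eigenvalue means algebraic multiplicity. *)

theory Defs
  imports
    "HOL-Library.Poly_Mapping"
    "HOL-Computational_Algebra.Computational_Algebra"
    "Jordan_Normal_Form.Jordan_Normal_Form"
begin

text \<open>
  \<open>\<bbbF>\<^sup>n\<close> is \<^term>\<open>carrier_vec n\<close>, with coordinates indexed from 0.
  A map \<open>\<bbbF>\<^sup>n \<rightarrow> \<bbbF>\<^sup>n\<close> is a function on \<^typ>\<open>'a vec\<close> of which only the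
  values on \<^term>\<open>carrier_vec n\<close> matter.
\<close>

definition affine_op :: "'a :: semiring_0 mat \<Rightarrow> 'a vec \<Rightarrow> 'a vec \<Rightarrow> 'a vec" where
  "affine_op A b = (\<lambda>x. A *\<^sub>v x + b)"

definition has_fixed_point :: "nat \<Rightarrow> ('a vec \<Rightarrow> 'a vec) \<Rightarrow> bool" where
  "has_fixed_point n f \<longleftrightarrow> (\<exists>x\<in>carrier_vec n. f x = x)"

text \<open>
  A multivariate polynomial is a finitely supported map from monomials to coefficients;
  a monomial is a finitely supported map from variable indices to exponents.
\<close>

type_synonym 'a mpoly = "(nat \<Rightarrow>\<^sub>0 nat) \<Rightarrow>\<^sub>0 'a"

definition in_n_variables :: "nat \<Rightarrow> 'a :: zero mpoly \<Rightarrow> bool" where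
  "in_n_variables n p \<longleftrightarrow> (\<forall>m\<in>Poly_Mapping.keys p. Poly_Mapping.keys m \<subseteq> {..<n})"

definition eval_mpoly :: "'a :: comm_semiring_1 mpoly \<Rightarrow> 'a vec \<Rightarrow> 'a" where
  "eval_mpoly p x =
     (\<Sum>m\<in>Poly_Mapping.keys p. Poly_Mapping.lookup p m *
        (\<Prod>i\<in>Poly_Mapping.keys m. (x $ i) ^ Poly_Mapping.lookup m i))"

definition polynomial_map :: "nat \<Rightarrow> ('a :: comm_semiring_1 vec \<Rightarrow> 'a vec) \<Rightarrow> bool" where
  "polynomial_map n h \<longleftrightarrow>
     (\<exists>p :: nat \<Rightarrow> 'a mpoly. (\<forall>i<n. in_n_variables n (p i)) \<and>
        (\<forall>x\<in>carrier_vec n. h x = vec n (\<lambda>i. eval_mpoly (p i) x)))"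

definition biregular :: "nat \<Rightarrow> ('a :: comm_semiring_1 vec \<Rightarrow> 'a vec) \<Rightarrow> bool" where
  "biregular n h \<longleftrightarrow>
     bij_betw h (carrier_vec n) (carrier_vec n) \<and>
     polynomial_map n h \<and> polynomial_map n (inv_into (carrier_vec n) h)"

definition biregularly_conjugate ::
    "nat \<Rightarrow> ('a :: comm_semiring_1 vec \<Rightarrow> 'a vec) \<Rightarrow> ('a vec \<Rightarrow> 'a vec) \<Rightarrow> bool" where
  "biregularly_conjugate n f g \<longleftrightarrow>
     (\<exists>h. biregular n h \<and>
        (\<forall>x\<in>carrier_vec n. g x = inv_into (carrier_vec n) h (f (h x))))"

definition nilpotent_mat :: "'a :: semiring_1 mat \<Rightarrow> bool" where
  "nilpotent_mat A \<longleftrightarrow> square_mat A \<and> (\<exists>m. A ^\<^sub>m m = 0\<^sub>m (dim_row A) (dim_row A))"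

text \<open>
  The parts of \<open>A\<close> are determined only up to similarity, so this is a relation between \<open>A\<close>
  and a choice of nonsingular part \<open>As\<close> and nilpotent part \<open>Ao\<close>, either possibly \<open>0 \<times> 0\<close>.
\<close>

definition nonsingular_nilpotent_parts :: "'a :: semiring_1 mat \<Rightarrow> 'a mat \<Rightarrow> 'a mat \<Rightarrow> bool" where
  "nonsingular_nilpotent_parts A As Ao \<longleftrightarrow>
     invertible_mat As \<and> nilpotent_mat Ao \<and> similar_mat A (diag_block_mat [As, Ao])"

definition alg_mult :: "'a :: field mat \<Rightarrow> 'a \<Rightarrow> nat" where
  "alg_mult A a = Polynomial.order a (char_poly A)"

definition same_eigenvalues_with_mult :: "'a :: field mat \<Rightarrow> 'a mat \<Rightarrow> bool" where
  "same_eigenvalues_with_mult A B \<longleftrightarrow>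
     (\<forall>a. eigenvalue A a \<longleftrightarrow> eigenvalue B a) \<and>
     (\<forall>a. eigenvalue A a \<longrightarrow> alg_mult A a = alg_mult B a)"

definition eigenvalue_list :: "'a :: field mat \<Rightarrow> 'a list \<Rightarrow> bool" where
  "eigenvalue_list A es \<longleftrightarrow>
     length es = dim_row A \<and> set es = {a. eigenvalue A a} \<and>
     (\<forall>a. eigenvalue A a \<longrightarrow> count_list es a = alg_mult A a)"

text \<open>
  The argument \<open>\<alpha>s\<close> lists \<open>\<alpha>\<^sub>2, \<dots>, \<alpha>\<^sub>k\<close>, so that \<open>k = Suc (length \<alpha>s)\<close> and
  \<open>\<alpha>s ! (i - 1)\<close> is the factor of the coordinate with 0-based index \<open>i\<close>.
\<close>

definition shift_canonical_op :: "'a :: semiring_1 list \<Rightarrow> 'a mat \<Rightarrow> 'a vec \<Rightarrow> 'a vec" where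
  "shift_canonical_op \<alpha>s J x =
     vec (Suc (length \<alpha>s)) (\<lambda>i. if i = 0 then x $ 0 + 1 else \<alpha>s ! (i - 1) * x $ i)
     @\<^sub>v (J *\<^sub>v vec_last x (dim_col J))"

text \<open>
  A Jordan matrix is \<^term>\<open>jordan_matrix n_as\<close> for a list \<open>n_as\<close> of pairs (size, eigenvalue)
  with positive sizes; two lists describe the same matrix up to permutation of blocks iff they
  have the same \<^term>\<open>mset\<close>.
\<close>

definition is_shift_canonical :: "nat \<Rightarrow> 'a :: semiring_1 list \<Rightarrow> (nat \<times> 'a) list \<Rightarrow> bool" where
  "is_shift_canonical n \<alpha>s n_as \<longleftrightarrow>
     0 \<notin> set \<alpha>s \<and> 0 \<notin> fst ` set n_as \<and> nilpotent_mat (jordan_matrix n_as) \<and>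
     Suc (length \<alpha>s) + dim_row (jordan_matrix n_as) = n"

end

theory Submission
  imports Defs
    "HOL-Combinatorics.List_Permutation"
    "Jordan_Normal_Form.Jordan_Normal_Form_Existence"
    "Jordan_Normal_Form.Jordan_Normal_Form_Uniqueness"
    "Jordan_Normal_Form.DL_Rank"
begin

text \<open>
  If \<open>h \<circ> g = f \<circ> h\<close> for affine \<open>f, g\<close> with matrices \<open>A, C\<close>, then differentiating gives
  \<open>Dh(g x) C = A Dh(x)\<close>; at a fixed point of \<open>g\<close> this is a similarity.

  Without fixed points, bring \<open>A\<close> to Jordan form and translate so that \<open>f = D \<circ> U\<close> with \<open>D\<close>
  linear, semisimple on the nonsingular part, and \<open>U\<close> affine, unipotent and commuting with \<open>D\<close>.
  The powers of \<open>U\<close> extend to a polynomial flow \<open>U\<^sup>s\<close>, and some coordinate \<open>u\<close> satisfies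
  \<open>u (U\<^sup>s x) = u x + s\<close> and \<open>u \<circ> D = u\<close>. The map \<open>x \<mapsto> (u x, U\<^bsup>- u x\<^esup> x)\<close> conjugates \<open>f\<close> to
  the shift \<open>u \<mapsto> u + 1\<close> times \<open>D\<close>.

  For uniqueness, let \<open>M t\<close> be the Jacobian of the conjugacy at \<open>t e\<^sub>0\<close>, a point moved by the
  canonical map to \<open>(t + 1) e\<^sub>0\<close>. It is polynomial in \<open>t\<close>, invertible, and
  \<open>M (t + 1) C = A (M t)\<close>. Hence \<open>C\<^sup>j\<close> and \<open>A\<^sup>j\<close> have equal rank; and if \<open>C v = e v\<close> with
  \<open>e \<noteq> 0\<close>, then comparing leading coefficients shows that \<open>M t v\<close> does not depend on \<open>t\<close>, so
  \<open>M 0\<close> maps the eigenspace of \<open>C\<close> for \<open>e\<close> into that of \<open>A\<close>.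
\<close>

section \<open>Polynomial functions and biregular conjugacy\<close>

text \<open>Two obstacles shape the proof. First, without a fixed point the Jacobian of a conjugacy
  relates derivatives at different points and gives no similarity; indeed Jordan blocks with nonzero
  eigenvalue are not invariants. Such a block is its eigenvalue times a unipotent factor, which a
  polynomial flow can absorb, whereas a nilpotent block has no such factor and keeps its structure.
  Hence the canonical form records a mere multiset of nonzero eigenvalues but all nilpotent blocks.
  Second, the flow must be polynomial in the point and in time together, since time is itself a
  coordinate function. A Newton series with binomial coefficients achieves this, and its factorials
  are one place where characteristic 0 enters. The clock coordinate comes from the translation:
  modulo the image of \<open>J - 1\<close> it lives in the last rows of the blocks with eigenvalue
  1, and a nonzero entry there is exactly what prevents a fixed point. Uniqueness compares two
  canonical operators rather than arbitrary affine ones, because the leading coefficient argument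
  works in rows where \<open>A\<close> is diagonal.\<close>

definition poly_fun :: "nat \<Rightarrow> ('a :: comm_semiring_1 vec \<Rightarrow> 'a) \<Rightarrow> bool" where
  "poly_fun n \<phi> \<longleftrightarrow> (\<exists>p. in_n_variables n p \<and> (\<forall>x\<in>carrier_vec n. \<phi> x = eval_mpoly p x))"

definition monom_val :: "(nat \<Rightarrow>\<^sub>0 nat) \<Rightarrow> 'a :: comm_semiring_1 vec \<Rightarrow> 'a" where
  "monom_val m x = (\<Prod>i\<in>Poly_Mapping.keys m. (x $ i) ^ Poly_Mapping.lookup m i)"

text \<open>Indices outside the support contribute a zeroth power, that is 1. A common index set
  lets the exponents of two monomials be added factor by factor.\<close>

lemma monom_val_superset:
  assumes "finite S" "Poly_Mapping.keys m \<subseteq> S"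
  shows "monom_val m x = (\<Prod>i\<in>S. (x $ i) ^ Poly_Mapping.lookup m i)"
  unfolding monom_val_def
  by (rule prod.mono_neutral_left) (use assms in \<open>auto simp: in_keys_iff\<close>)

lemma monom_val_add: "monom_val (m + m') x = monom_val m x * monom_val m' x"
proof -
  let ?S = "Poly_Mapping.keys m \<union> Poly_Mapping.keys m'"
  have "Poly_Mapping.keys (m + m') \<subseteq> ?S" by (rule Poly_Mapping.keys_add)
  then show ?thesis
    by (simp add: monom_val_superset[of ?S] lookup_add power_add prod.distrib)
qed

lemma eval_mpoly_superset:
  assumes "finite S" "Poly_Mapping.keys p \<subseteq> S"
  shows "eval_mpoly p x = (\<Sum>m\<in>S. Poly_Mapping.lookup p m * monom_val m x)"
  unfolding eval_mpoly_def monom_val_def[symmetric]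
  by (rule sum.mono_neutral_left) (use assms in \<open>auto simp: in_keys_iff\<close>)

lemma poly_fun_cong:
  assumes "poly_fun n \<phi>" "\<And>x. x \<in> carrier_vec n \<Longrightarrow> \<psi> x = \<phi> x"
  shows "poly_fun n \<psi>"
  using assms unfolding poly_fun_def by auto

lemma poly_fun_monom:
  assumes "Poly_Mapping.keys m \<subseteq> {..<n}"
  shows "poly_fun n (\<lambda>x. c * monom_val m x)"
  unfolding poly_fun_def
proof (intro exI conjI ballI)
  show "in_n_variables n (Poly_Mapping.single m c)"
    using assms by (auto simp: in_n_variables_def)
  show "c * monom_val m x = eval_mpoly (Poly_Mapping.single m c) x" for x
    by (subst eval_mpoly_superset[of "{m}"]) auto
qed

lemma poly_fun_add:
  assumes "poly_fun n \<phi>" "poly_fun n \<psi>"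
  shows "poly_fun n (\<lambda>x. \<phi> x + \<psi> x)"
proof -
  obtain p q where p: "in_n_variables n p" "\<forall>x\<in>carrier_vec n. \<phi> x = eval_mpoly p x"
    and q: "in_n_variables n q" "\<forall>x\<in>carrier_vec n. \<psi> x = eval_mpoly q x"
    using assms unfolding poly_fun_def by auto
  let ?S = "Poly_Mapping.keys p \<union> Poly_Mapping.keys q"
  have S: "Poly_Mapping.keys (p + q) \<subseteq> ?S" by (rule Poly_Mapping.keys_add)
  have "eval_mpoly (p + q) x = eval_mpoly p x + eval_mpoly q x" for x
    using S by (simp add: eval_mpoly_superset[of ?S] lookup_add sum.distrib distrib_right)
  moreover have "in_n_variables n (p + q)"
    using S p(1) q(1) unfolding in_n_variables_def by blast
  ultimately show ?thesis
    using p(2) q(2) unfolding poly_fun_def by (intro exI[of _ "p + q"]) auto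
qed

lemma poly_fun_const: "poly_fun n (\<lambda>_. c)"
  using poly_fun_monom[of 0 n c] by (simp add: monom_val_def)

lemma poly_fun_sum:
  assumes "\<And>i. i \<in> I \<Longrightarrow> poly_fun n (\<phi> i)"
  shows "poly_fun n (\<lambda>x. \<Sum>i\<in>I. \<phi> i x)"
proof (cases "finite I")
  case True
  then show ?thesis using assms
    by (induction I) (auto intro: poly_fun_const poly_fun_add)
qed (simp add: poly_fun_const)

lemma poly_fun_coord:
  assumes "i < n"
  shows "poly_fun n (\<lambda>x. x $ i)"
  using poly_fun_monom[of "Poly_Mapping.single i 1" n 1] assms
  by (simp add: monom_val_def)

lemma poly_fun_mult:
  assumes "poly_fun n \<phi>" "poly_fun n \<psi>"
  shows "poly_fun n (\<lambda>x. \<phi> x * \<psi> x)"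
proof -
  obtain p q where p: "in_n_variables n p" "\<forall>x\<in>carrier_vec n. \<phi> x = eval_mpoly p x"
    and q: "in_n_variables n q" "\<forall>x\<in>carrier_vec n. \<psi> x = eval_mpoly q x"
    using assms unfolding poly_fun_def by auto
  \<comment> \<open>A product of two monomials is again a monomial, so the product function is a
    double sum of monomial functions; the product inside the polynomial type is never
    formed.\<close>
  have "poly_fun n (\<lambda>x. \<Sum>a\<in>Poly_Mapping.keys p. \<Sum>b\<in>Poly_Mapping.keys q.
     (Poly_Mapping.lookup p a * Poly_Mapping.lookup q b) * monom_val (a + b) x)"
  proof (intro poly_fun_sum poly_fun_monom)
    fix a b assume "a \<in> Poly_Mapping.keys p" "b \<in> Poly_Mapping.keys q"
    then show "Poly_Mapping.keys (a + b) \<subseteq> {..<n}"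
      using p(1) q(1) Poly_Mapping.keys_add[of a b] unfolding in_n_variables_def by blast
  qed
  then show ?thesis
  proof (rule poly_fun_cong)
    fix x :: "'a vec" assume x: "x \<in> carrier_vec n"
    show "\<phi> x * \<psi> x = (\<Sum>a\<in>Poly_Mapping.keys p. \<Sum>b\<in>Poly_Mapping.keys q.
      (Poly_Mapping.lookup p a * Poly_Mapping.lookup q b) * monom_val (a + b) x)"
      using p(2) q(2) x
      by (simp add: eval_mpoly_def monom_val_def[symmetric] monom_val_add sum_product algebra_simps)
  qed
qed

lemma poly_fun_prod:
  assumes "\<And>i. i \<in> I \<Longrightarrow> poly_fun n (\<phi> i)"
  shows "poly_fun n (\<lambda>x. \<Prod>i\<in>I. \<phi> i x)"
proof (cases "finite I")
  case True
  then show ?thesis using assms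
    by (induction I) (auto intro: poly_fun_const poly_fun_mult)
qed (simp add: poly_fun_const)

text \<open>Hides monomials from everything that follows. The \<open>cong\<close> case is present
  because a polynomial function is prescribed on \<open>carrier_vec n\<close> alone, while the
  predicate sees the whole HOL function.\<close>

lemma poly_fun_induct [consumes 1, case_names const coord add mult cong]:
  fixes \<phi> :: "'a :: comm_semiring_1 vec \<Rightarrow> 'a"
  assumes "poly_fun n \<phi>"
    and const: "\<And>c. P (\<lambda>_. c)"
    and coord: "\<And>i. i < n \<Longrightarrow> P (\<lambda>x :: 'a vec. x $ i)"
    and add: "\<And>\<phi> \<psi>. P \<phi> \<Longrightarrow> P \<psi> \<Longrightarrow> P (\<lambda>x. \<phi> x + \<psi> x)"
    and mult: "\<And>\<phi> \<psi>. P \<phi> \<Longrightarrow> P \<psi> \<Longrightarrow> P (\<lambda>x. \<phi> x * \<psi> x)"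
    and cong: "\<And>\<phi> \<psi>. P \<phi> \<Longrightarrow> (\<And>x. x \<in> carrier_vec n \<Longrightarrow> \<psi> x = \<phi> x) \<Longrightarrow> P \<psi>"
  shows "P \<phi>"
proof -
  obtain p where p: "in_n_variables n p" "\<forall>x\<in>carrier_vec n. \<phi> x = eval_mpoly p x"
    using assms(1) unfolding poly_fun_def by auto
  have pow: "P (\<lambda>x. (x $ i) ^ k)" if "i < n" for i k
  proof (induction k)
    case (Suc k)
    from mult[OF coord[OF that] this] show ?case by simp
  qed (simp add: const)
  have prd: "P (\<lambda>x. \<Prod>i\<in>I. (x $ i) ^ f i)" if "finite I" "I \<subseteq> {..<n}" for I f
    using that by (induction I) (auto intro: const mult pow)
  have sm: "P (\<lambda>x. \<Sum>m\<in>I. g m x)" if "finite I" "\<And>m. m \<in> I \<Longrightarrow> P (g m)"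
    for I :: "(nat \<Rightarrow>\<^sub>0 nat) set" and g
    using that by (induction I) (auto intro: const add)
  have "P (eval_mpoly p)"
    unfolding eval_mpoly_def
  proof (rule sm)
    fix m assume "m \<in> Poly_Mapping.keys p"
    then have "Poly_Mapping.keys m \<subseteq> {..<n}" using p(1) by (auto simp: in_n_variables_def)
    then show "P (\<lambda>x. Poly_Mapping.lookup p m *
        (\<Prod>i\<in>Poly_Mapping.keys m. (x $ i) ^ Poly_Mapping.lookup m i))"
      by (intro mult const prd) auto
  qed simp
  then show ?thesis by (rule cong) (use p(2) in auto)
qed

section \<open>Polynomial maps and conjugation by them\<close>

lemma polynomial_map_iff:
  "polynomial_map n h \<longleftrightarrow>
     (\<forall>x\<in>carrier_vec n. h x \<in> carrier_vec n) \<and> (\<forall>i<n. poly_fun n (\<lambda>x. h x $ i))"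
proof
  assume "polynomial_map n h"
  then obtain p where "\<forall>i<n. in_n_variables n (p i)"
    "\<forall>x\<in>carrier_vec n. h x = vec n (\<lambda>i. eval_mpoly (p i) x)"
    unfolding polynomial_map_def by auto
  then show "(\<forall>x\<in>carrier_vec n. h x \<in> carrier_vec n) \<and> (\<forall>i<n. poly_fun n (\<lambda>x. h x $ i))"
    unfolding poly_fun_def by auto
next
  assume h: "(\<forall>x\<in>carrier_vec n. h x \<in> carrier_vec n) \<and> (\<forall>i<n. poly_fun n (\<lambda>x. h x $ i))"
  then obtain p where p: "\<And>i. i < n \<Longrightarrow> in_n_variables n (p i) \<and>
      (\<forall>x\<in>carrier_vec n. h x $ i = eval_mpoly (p i) x)"
    unfolding poly_fun_def by metis
  show "polynomial_map n h"
    unfolding polynomial_map_def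
  proof (intro exI[of _ p] conjI ballI allI impI)
    fix x :: "'a vec" assume "x \<in> carrier_vec n"
    then show "h x = vec n (\<lambda>i. eval_mpoly (p i) x)"
      using p h by (intro eq_vecI) auto
  qed (use p in auto)
qed

lemma polynomial_map_carrier:
  "polynomial_map n h \<Longrightarrow> x \<in> carrier_vec n \<Longrightarrow> h x \<in> carrier_vec n"
  by (simp add: polynomial_map_iff)

lemma polynomial_map_cong:
  assumes "polynomial_map n h" "\<And>x. x \<in> carrier_vec n \<Longrightarrow> k x = h x"
  shows "polynomial_map n k"
  using assms unfolding polynomial_map_def by auto

lemma poly_fun_compose:
  assumes "poly_fun n \<phi>" "polynomial_map n h"
  shows "poly_fun n (\<lambda>x. \<phi> (h x))"
  using assms(1)
proof (induction rule: poly_fun_induct)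
  case (cong \<phi> \<psi>)
  from cong(1) show ?case
    by (rule poly_fun_cong) (use cong(2) assms(2) in \<open>auto simp: polynomial_map_iff\<close>)
qed (use assms(2) in \<open>auto intro: poly_fun_const poly_fun_add poly_fun_mult simp: polynomial_map_iff\<close>)

lemma polynomial_map_compose:
  assumes "polynomial_map n h" "polynomial_map n k"
  shows "polynomial_map n (\<lambda>x. h (k x))"
  unfolding polynomial_map_iff
proof (intro conjI ballI allI impI)
  fix i assume "i < n"
  then have "poly_fun n (\<lambda>x. h x $ i)" using assms(1) by (simp add: polynomial_map_iff)
  from poly_fun_compose[OF this assms(2)] show "poly_fun n (\<lambda>x. h (k x) $ i)" .
qed (use assms in \<open>auto simp: polynomial_map_iff\<close>)

lemma affine_op_carrier:
  assumes "A \<in> carrier_mat n n" "b \<in> carrier_vec n" "x \<in> carrier_vec n"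
  shows "affine_op A b x \<in> carrier_vec n"
  using assms by (auto simp: affine_op_def)

lemma polynomial_map_affine_op:
  assumes A: "A \<in> carrier_mat n n" and b: "b \<in> carrier_vec n"
  shows "polynomial_map n (affine_op A b)"
  unfolding polynomial_map_iff
proof (intro conjI ballI allI impI)
  fix i assume i: "i < n"
  have "poly_fun n (\<lambda>x. (\<Sum>j\<in>{0..<n}. A $$ (i,j) * x $ j) + b $ i)"
    by (intro poly_fun_add poly_fun_sum poly_fun_mult poly_fun_const poly_fun_coord) auto
  then show "poly_fun n (\<lambda>x. affine_op A b x $ i)"
    by (rule poly_fun_cong) (use A b i in \<open>auto simp: affine_op_def scalar_prod_def\<close>)
qed (use A b in \<open>auto simp: affine_op_carrier\<close>)

text \<open>Trades \<open>inv_into\<close> for an explicit polynomial inverse \<open>k\<close>. The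
  two agree on \<open>carrier_vec n\<close>, which is why \<open>f\<close> has to preserve that
  set.\<close>

lemma biregularly_conjugateI:
  assumes h: "polynomial_map n h" and k: "polynomial_map n k"
    and kh: "\<And>x. x \<in> carrier_vec n \<Longrightarrow> k (h x) = x"
    and hk: "\<And>x. x \<in> carrier_vec n \<Longrightarrow> h (k x) = x"
    and f: "\<And>x. x \<in> carrier_vec n \<Longrightarrow> f x \<in> carrier_vec n"
    and g: "\<And>x. x \<in> carrier_vec n \<Longrightarrow> g x = k (f (h x))"
  shows "biregularly_conjugate n f g"
proof -
  have bij: "bij_betw h (carrier_vec n) (carrier_vec n)"
    by (rule bij_betwI[of _ _ _ k]) (use h k kh hk in \<open>auto simp: polynomial_map_iff\<close>)
  have inv: "inv_into (carrier_vec n) h y = k y" if "y \<in> carrier_vec n" for y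
    using that bij h k hk
    by (intro inv_into_f_eq) (auto simp: bij_betw_def polynomial_map_iff)
  have "polynomial_map n (inv_into (carrier_vec n) h)"
    by (rule polynomial_map_cong[OF k inv])
  with bij h have "biregular n h" by (simp add: biregular_def)
  moreover have "\<forall>x\<in>carrier_vec n. g x = inv_into (carrier_vec n) h (f (h x))"
    using inv f g h by (auto simp: polynomial_map_iff)
  ultimately show ?thesis unfolding biregularly_conjugate_def by blast
qed

lemma biregularly_conjugateE:
  assumes "biregularly_conjugate n f g"
  obtains h k where "polynomial_map n h" "polynomial_map n k"
    "\<And>x. x \<in> carrier_vec n \<Longrightarrow> k (h x) = x"
    "\<And>x. x \<in> carrier_vec n \<Longrightarrow> h (k x) = x"
    "\<And>x. x \<in> carrier_vec n \<Longrightarrow> g x = k (f (h x))"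
proof -
  obtain h where h: "biregular n h" "\<forall>x\<in>carrier_vec n. g x = inv_into (carrier_vec n) h (f (h x))"
    using assms unfolding biregularly_conjugate_def by auto
  show thesis
    by (rule that[of h "inv_into (carrier_vec n) h"])
      (use h in \<open>auto simp: biregular_def bij_betw_inv_into_left bij_betw_inv_into_right\<close>)
qed

lemma biregularly_conjugate_sym:
  assumes "biregularly_conjugate n f g"
    and f: "\<And>x. x \<in> carrier_vec n \<Longrightarrow> f x \<in> carrier_vec n"
  shows "biregularly_conjugate n g f"
proof -
  obtain h k where hk: "polynomial_map n h" "polynomial_map n k"
    "\<And>x. x \<in> carrier_vec n \<Longrightarrow> k (h x) = x"
    "\<And>x. x \<in> carrier_vec n \<Longrightarrow> h (k x) = x"
    "\<And>x. x \<in> carrier_vec n \<Longrightarrow> g x = k (f (h x))"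
    using biregularly_conjugateE[OF assms(1)] by metis
  show ?thesis
    by (rule biregularly_conjugateI[of n k h])
      (use hk f in \<open>auto simp: polynomial_map_iff\<close>)
qed

lemma biregularly_conjugate_trans:
  assumes "biregularly_conjugate n f g" "biregularly_conjugate n g e"
    and f: "\<And>x. x \<in> carrier_vec n \<Longrightarrow> f x \<in> carrier_vec n"
  shows "biregularly_conjugate n f e"
proof -
  obtain h k where hk: "polynomial_map n h" "polynomial_map n k"
    "\<And>x. x \<in> carrier_vec n \<Longrightarrow> k (h x) = x"
    "\<And>x. x \<in> carrier_vec n \<Longrightarrow> h (k x) = x"
    "\<And>x. x \<in> carrier_vec n \<Longrightarrow> g x = k (f (h x))"
    using biregularly_conjugateE[OF assms(1)] by metis
  obtain h' k' where hk': "polynomial_map n h'" "polynomial_map n k'"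
    "\<And>x. x \<in> carrier_vec n \<Longrightarrow> k' (h' x) = x"
    "\<And>x. x \<in> carrier_vec n \<Longrightarrow> h' (k' x) = x"
    "\<And>x. x \<in> carrier_vec n \<Longrightarrow> e x = k' (g (h' x))"
    using biregularly_conjugateE[OF assms(2)] by metis
  show ?thesis
    by (rule biregularly_conjugateI[of n "\<lambda>x. h (h' x)" "\<lambda>x. k' (k x)"])
      (use hk hk' f in \<open>auto intro: polynomial_map_compose simp: polynomial_map_carrier\<close>)
qed

lemma biregularly_conjugate_cong:
  assumes "biregularly_conjugate n f g"
    and "\<And>x. x \<in> carrier_vec n \<Longrightarrow> g' x = g x"
  shows "biregularly_conjugate n f g'"
  using assms unfolding biregularly_conjugate_def by auto

lemma biregularly_conjugate_linear:
  fixes A :: "'a :: comm_ring_1 mat"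
  assumes A: "A \<in> carrier_mat n n" and b: "b \<in> carrier_vec n"
    and P: "P \<in> carrier_mat n n" and Q: "Q \<in> carrier_mat n n"
    and PQ: "P * Q = 1\<^sub>m n" and QP: "Q * P = 1\<^sub>m n"
  shows "biregularly_conjugate n (affine_op A b) (affine_op (Q * A * P) (Q *\<^sub>v b))"
proof -
  have lin: "affine_op M (0\<^sub>v n) x = M *\<^sub>v x" if "M \<in> carrier_mat n n" "x \<in> carrier_vec n" for M x
    using that by (auto simp: affine_op_def)
  have pm: "polynomial_map n ((*\<^sub>v) M)" if "M \<in> carrier_mat n n" for M :: "'a mat"
    by (rule polynomial_map_cong[OF polynomial_map_affine_op[OF that zero_carrier_vec]])
      (use lin[OF that] in auto)
  show ?thesis
  proof (rule biregularly_conjugateI[OF pm[OF P] pm[OF Q]])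
    fix x :: "'a vec" assume x: "x \<in> carrier_vec n"
    show "Q *\<^sub>v (P *\<^sub>v x) = x" using assoc_mult_mat_vec[OF Q P x] QP x by simp
    show "P *\<^sub>v (Q *\<^sub>v x) = x" using assoc_mult_mat_vec[OF P Q x] PQ x by simp
    show "affine_op A b x \<in> carrier_vec n" using A b x by (rule affine_op_carrier)
    have Px: "P *\<^sub>v x \<in> carrier_vec n" using P x by auto
    have "Q *\<^sub>v (A *\<^sub>v (P *\<^sub>v x) + b) = Q *\<^sub>v (A *\<^sub>v (P *\<^sub>v x)) + Q *\<^sub>v b"
      by (rule mult_add_distrib_mat_vec[OF Q]) (use A Px b in auto)
    also have "Q *\<^sub>v (A *\<^sub>v (P *\<^sub>v x)) = (Q * A * P) *\<^sub>v x"
      using assoc_mult_mat_vec[OF Q A Px] assoc_mult_mat_vec[OF mult_carrier_mat[OF Q A] P x] by simp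
    finally show "affine_op (Q * A * P) (Q *\<^sub>v b) x = Q *\<^sub>v affine_op A b (P *\<^sub>v x)"
      by (simp add: affine_op_def)
  qed
qed

text \<open>Moving the origin to \<open>p\<close> replaces the constant term by the displacement of
  \<open>p\<close>. It vanishes if \<open>p\<close> is fixed; in general a good choice of
  \<open>p\<close> normalises it.\<close>

lemma biregularly_conjugate_translate:
  fixes A :: "'a :: comm_ring_1 mat"
  assumes A: "A \<in> carrier_mat n n" and b: "b \<in> carrier_vec n" and p: "p \<in> carrier_vec n"
  shows "biregularly_conjugate n (affine_op A b) (affine_op A (A *\<^sub>v p + b - p))"
proof -
  have pm: "polynomial_map n (affine_op (1\<^sub>m n) q)" if "q \<in> carrier_vec n" for q :: "'a vec"
    by (rule polynomial_map_affine_op) (use that in auto)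
  show ?thesis
  proof (rule biregularly_conjugateI[OF pm[OF p] pm[of "- p"]])
    fix x :: "'a vec" assume x: "x \<in> carrier_vec n"
    show "affine_op (1\<^sub>m n) (- p) (affine_op (1\<^sub>m n) p x) = x"
      "affine_op (1\<^sub>m n) p (affine_op (1\<^sub>m n) (- p) x) = x"
      using p x by (auto simp: affine_op_def intro!: eq_vecI)
    show "affine_op A b x \<in> carrier_vec n" using A b x by (rule affine_op_carrier)
    have "A *\<^sub>v (x + p) = A *\<^sub>v x + A *\<^sub>v p" by (rule mult_add_distrib_mat_vec[OF A x p])
    then show "affine_op A (A *\<^sub>v p + b - p) x = affine_op (1\<^sub>m n) (- p) (affine_op A b (affine_op (1\<^sub>m n) p x))"
      using A b p x by (auto simp: affine_op_def intro!: eq_vecI simp: scalar_prod_def)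
  qed (use p in auto)
qed

section \<open>Jacobians of polynomial maps\<close>

definition curve :: "nat \<Rightarrow> (nat \<Rightarrow> 'a :: comm_semiring_1 poly) \<Rightarrow> 'a \<Rightarrow> 'a vec" where
  "curve n \<gamma> s = vec n (\<lambda>i. poly (\<gamma> i) s)"

lemma curve_carrier [simp]: "curve n \<gamma> s \<in> carrier_vec n"
  by (simp add: curve_def)

lemma dim_curve [simp]: "dim_vec (curve n \<gamma> s) = n"
  by (simp add: curve_def)

lemma curve_index [simp]: "i < n \<Longrightarrow> curve n \<gamma> s $ i = poly (\<gamma> i) s"
  by (simp add: curve_def)

text \<open>
  Derivatives are taken along polynomial curves, as first-order coefficients; the chain rule
  then needs no partial derivatives of the coordinate polynomials.
\<close>

definition has_gradient :: "nat \<Rightarrow> ('a :: comm_ring_1 vec \<Rightarrow> 'a) \<Rightarrow> (nat \<Rightarrow> 'a vec \<Rightarrow> 'a) \<Rightarrow> bool" where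
  "has_gradient n \<phi> G \<longleftrightarrow>
     (\<forall>\<gamma>. \<exists>q. (\<forall>s. \<phi> (curve n \<gamma> s) = poly q s) \<and>
        poly.coeff q 1 = (\<Sum>j<n. G j (curve n \<gamma> 0) * poly.coeff (\<gamma> j) 1))"

lemma poly_fun_gradient_ex:
  fixes \<phi> :: "'a :: comm_ring_1 vec \<Rightarrow> 'a"
  assumes "poly_fun n \<phi>"
  shows "\<exists>G. (\<forall>j<n. poly_fun n (G j)) \<and> has_gradient n \<phi> G"
proof -
  \<comment> \<open>The induction carries polynomiality of the function along, because the product
    rule puts the two factors themselves into the coefficients of the gradient.\<close>
  from assms have "poly_fun n \<phi> \<and> (\<exists>G. (\<forall>j<n. poly_fun n (G j)) \<and> has_gradient n \<phi> G)"
  proof (induction rule: poly_fun_induct)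
    case (const c)
    have "has_gradient n (\<lambda>_. c) (\<lambda>_ _. 0)"
      unfolding has_gradient_def by (intro allI exI[of _ "[:c:]"]) auto
    then show ?case by (auto intro!: poly_fun_const exI[of _ "\<lambda>_ _. 0"])
  next
    case (coord i)
    have "has_gradient n (\<lambda>x :: 'a vec. x $ i) (\<lambda>j _. if j = i then 1 else 0)"
      unfolding has_gradient_def
    proof (intro allI)
      fix \<gamma> :: "nat \<Rightarrow> 'a poly"
      have "(\<Sum>j<n. (if j = i then 1 else 0) * poly.coeff (\<gamma> j) 1) = poly.coeff (\<gamma> i) 1"
        using coord by (subst sum.remove[of _ i]) auto
      then show "\<exists>q. (\<forall>s. curve n \<gamma> s $ i = poly q s) \<and>
        poly.coeff q 1 = (\<Sum>j<n. (if j = i then 1 else 0) * poly.coeff (\<gamma> j) 1)"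
        using coord by (intro exI[of _ "\<gamma> i"]) auto
    qed
    moreover have "\<forall>j<n. poly_fun n (\<lambda>_ :: 'a vec. if j = i then 1 else 0 :: 'a)"
      by (simp add: poly_fun_const)
    ultimately show ?case using poly_fun_coord[OF coord]
      by (intro conjI exI[of _ "\<lambda>j _. if j = i then 1 else 0"])
  next
    case (add \<phi> \<psi>)
    then obtain G H where GH: "\<forall>j<n. poly_fun n (G j)" "has_gradient n \<phi> G"
      "\<forall>j<n. poly_fun n (H j)" "has_gradient n \<psi> H" by auto
    have "has_gradient n (\<lambda>x. \<phi> x + \<psi> x) (\<lambda>j x. G j x + H j x)"
      unfolding has_gradient_def
    proof (intro allI)
      fix \<gamma> :: "nat \<Rightarrow> 'a poly"
      obtain p q where
        "\<forall>s. \<phi> (curve n \<gamma> s) = poly p s" "poly.coeff p 1 = (\<Sum>j<n. G j (curve n \<gamma> 0) * poly.coeff (\<gamma> j) 1)"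
        "\<forall>s. \<psi> (curve n \<gamma> s) = poly q s" "poly.coeff q 1 = (\<Sum>j<n. H j (curve n \<gamma> 0) * poly.coeff (\<gamma> j) 1)"
        using GH(2,4) unfolding has_gradient_def by meson
      then show "\<exists>q. (\<forall>s. \<phi> (curve n \<gamma> s) + \<psi> (curve n \<gamma> s) = poly q s) \<and>
        poly.coeff q 1 = (\<Sum>j<n. (G j (curve n \<gamma> 0) + H j (curve n \<gamma> 0)) * poly.coeff (\<gamma> j) 1)"
        by (intro exI[of _ "p + q"]) (auto simp: distrib_right sum.distrib)
    qed
    with GH add show ?case
      by (auto intro!: poly_fun_add exI[of _ "\<lambda>j x. G j x + H j x"])
  next
    case (mult \<phi> \<psi>)
    then obtain G H where GH: "\<forall>j<n. poly_fun n (G j)" "has_gradient n \<phi> G"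
      "\<forall>j<n. poly_fun n (H j)" "has_gradient n \<psi> H" by auto
    have "has_gradient n (\<lambda>x. \<phi> x * \<psi> x) (\<lambda>j x. \<phi> x * H j x + G j x * \<psi> x)"
      unfolding has_gradient_def
    proof (intro allI)
      fix \<gamma> :: "nat \<Rightarrow> 'a poly"
      obtain p q where pq:
        "\<forall>s. \<phi> (curve n \<gamma> s) = poly p s" "poly.coeff p 1 = (\<Sum>j<n. G j (curve n \<gamma> 0) * poly.coeff (\<gamma> j) 1)"
        "\<forall>s. \<psi> (curve n \<gamma> s) = poly q s" "poly.coeff q 1 = (\<Sum>j<n. H j (curve n \<gamma> 0) * poly.coeff (\<gamma> j) 1)"
        using GH(2,4) unfolding has_gradient_def by meson
      have "poly.coeff (p * q) 1 = poly.coeff p 0 * poly.coeff q 1 + poly.coeff p 1 * poly.coeff q 0"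
        by (simp add: coeff_mult)
      also have "\<dots> = \<phi> (curve n \<gamma> 0) * poly.coeff q 1 + poly.coeff p 1 * \<psi> (curve n \<gamma> 0)"
        using pq(1,3) by (simp add: poly_0_coeff_0)
      also have "\<dots> = (\<Sum>j<n. (\<phi> (curve n \<gamma> 0) * H j (curve n \<gamma> 0) + G j (curve n \<gamma> 0) * \<psi> (curve n \<gamma> 0)) * poly.coeff (\<gamma> j) 1)"
        unfolding pq(2,4) by (simp add: sum_distrib_left sum_distrib_right sum.distrib algebra_simps)
      finally show "\<exists>q. (\<forall>s. \<phi> (curve n \<gamma> s) * \<psi> (curve n \<gamma> s) = poly q s) \<and>
        poly.coeff q 1 = (\<Sum>j<n. (\<phi> (curve n \<gamma> 0) * H j (curve n \<gamma> 0) + G j (curve n \<gamma> 0) * \<psi> (curve n \<gamma> 0)) * poly.coeff (\<gamma> j) 1)"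
        using pq(1,3) by (intro exI[of _ "p * q"]) auto
    qed
    with GH mult show ?case
      by (auto intro!: poly_fun_add poly_fun_mult exI[of _ "\<lambda>j x. \<phi> x * H j x + G j x * \<psi> x"])
  next
    case (cong \<phi> \<psi>)
    then obtain G where "\<forall>j<n. poly_fun n (G j)" "has_gradient n \<phi> G" by auto
    moreover from this have "has_gradient n \<psi> G"
      using cong(2) unfolding has_gradient_def by simp
    ultimately show ?case using cong by (auto intro: poly_fun_cong)
  qed
  then show ?thesis by simp
qed

definition gradient :: "nat \<Rightarrow> ('a :: comm_ring_1 vec \<Rightarrow> 'a) \<Rightarrow> nat \<Rightarrow> 'a vec \<Rightarrow> 'a" where
  "gradient n \<phi> = (SOME G. (\<forall>j<n. poly_fun n (G j)) \<and> has_gradient n \<phi> G)"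

lemma gradient:
  fixes \<phi> :: "'a :: comm_ring_1 vec \<Rightarrow> 'a"
  assumes "poly_fun n \<phi>"
  shows "j < n \<Longrightarrow> poly_fun n (gradient n \<phi> j)" "has_gradient n \<phi> (gradient n \<phi>)"
  using someI_ex[OF poly_fun_gradient_ex[OF assms]] unfolding gradient_def by auto

definition jacobian :: "nat \<Rightarrow> ('a :: comm_ring_1 vec \<Rightarrow> 'a vec) \<Rightarrow> 'a vec \<Rightarrow> 'a mat" where
  "jacobian n h x = mat n n (\<lambda>(i,j). gradient n (\<lambda>x. h x $ i) j x)"

lemma jacobian_carrier [simp]: "jacobian n h x \<in> carrier_mat n n"
  by (simp add: jacobian_def)

definition velocity :: "nat \<Rightarrow> (nat \<Rightarrow> 'a :: comm_semiring_1 poly) \<Rightarrow> 'a vec" where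
  "velocity n \<gamma> = vec n (\<lambda>i. poly.coeff (\<gamma> i) 1)"

lemma velocity_carrier [simp]: "velocity n \<gamma> \<in> carrier_vec n"
  by (simp add: velocity_def)

text \<open>The characteristic property of \<open>jacobian\<close>: a polynomial curve is pushed
  forward to a polynomial curve whose velocity is multiplied by the Jacobian.\<close>

lemma polynomial_map_curve:
  fixes h :: "'a :: comm_ring_1 vec \<Rightarrow> 'a vec"
  assumes "polynomial_map n h"
  obtains \<delta> where "\<And>s. h (curve n \<gamma> s) = curve n \<delta> s"
    "velocity n \<delta> = jacobian n h (curve n \<gamma> 0) *\<^sub>v velocity n \<gamma>"
proof -
  let ?P = "\<lambda>i q. (\<forall>s. h (curve n \<gamma> s) $ i = poly q s) \<and>
        poly.coeff q 1 = (\<Sum>j<n. gradient n (\<lambda>x. h x $ i) j (curve n \<gamma> 0) * poly.coeff (\<gamma> j) 1)"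
  have ex: "\<exists>q. ?P i q" if "i < n" for i
  proof -
    have "poly_fun n (\<lambda>x. h x $ i)" using that assms by (simp add: polynomial_map_iff)
    from gradient(2)[OF this] show ?thesis unfolding has_gradient_def by (rule spec)
  qed
  define \<delta> where "\<delta> i = (SOME q. ?P i q)" for i
  have \<delta>: "?P i (\<delta> i)" if "i < n" for i
    unfolding \<delta>_def by (rule someI_ex) (rule ex[OF that])
  show thesis
  proof (rule that[of \<delta>])
    show "h (curve n \<gamma> s) = curve n \<delta> s" for s
    proof (rule eq_vecI)
      show "dim_vec (h (curve n \<gamma> s)) = dim_vec (curve n \<delta> s)"
        using polynomial_map_carrier[OF assms curve_carrier[of n \<gamma> s]] by simp
    next
      fix i assume "i < dim_vec (curve n \<delta> s)"
      then have i: "i < n" by simp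
      with \<delta>[OF i] show "h (curve n \<gamma> s) $ i = curve n \<delta> s $ i" by simp
    qed
    show "velocity n \<delta> = jacobian n h (curve n \<gamma> 0) *\<^sub>v velocity n \<gamma>"
    proof (rule eq_vecI)
      fix i assume "i < dim_vec (jacobian n h (curve n \<gamma> 0) *\<^sub>v velocity n \<gamma>)"
      then have i: "i < n" by (simp add: jacobian_def)
      with conjunct2[OF \<delta>[OF i]]
      show "velocity n \<delta> $ i = (jacobian n h (curve n \<gamma> 0) *\<^sub>v velocity n \<gamma>) $ i"
        by (simp add: velocity_def jacobian_def scalar_prod_def lessThan_atLeast0)
    qed (simp add: velocity_def jacobian_def)
  qed
qed

text \<open>Over an infinite domain a polynomial is determined by its values, so the curve as a
  function determines its first-order coefficients. Characteristic 0 supplies the infinitely many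
  points.\<close>

lemma velocity_unique:
  fixes \<gamma> \<delta> :: "nat \<Rightarrow> 'a :: {idom, ring_char_0} poly"
  assumes "\<And>s. curve n \<gamma> s = curve n \<delta> s"
  shows "velocity n \<gamma> = velocity n \<delta>"
proof -
  have "\<gamma> i = \<delta> i" if "i < n" for i
  proof -
    have "poly (\<gamma> i) s = poly (\<delta> i) s" for s
      using arg_cong[OF assms[of s], of "\<lambda>v :: 'a vec. v $ i"] that by simp
    then show ?thesis by (simp add: poly_eq_poly_eq_iff[symmetric] fun_eq_iff)
  qed
  then show ?thesis by (auto simp: velocity_def)
qed

lemma tangent_curve:
  fixes x :: "'a :: comm_ring_1 vec"
  assumes "x \<in> carrier_vec n" "v \<in> carrier_vec n"
  obtains \<gamma> where "curve n \<gamma> 0 = x" "velocity n \<gamma> = v"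
  by (rule that[of "\<lambda>i. [:x $ i, v $ i:]"])
    (use assms in \<open>auto simp: curve_def velocity_def\<close>)

text \<open>Pushing a curve through \<open>k\<close> and then \<open>h\<close>, or through the
  composition at once, yields the same curve; \<open>velocity_unique\<close> equates the two
  velocities.\<close>

lemma jacobian_compose:
  fixes h :: "'a :: {idom, ring_char_0} vec \<Rightarrow> 'a vec"
  assumes h: "polynomial_map n h" and k: "polynomial_map n k" and x: "x \<in> carrier_vec n"
    and v: "v \<in> carrier_vec n"
  shows "jacobian n (\<lambda>x. h (k x)) x *\<^sub>v v = jacobian n h (k x) *\<^sub>v (jacobian n k x *\<^sub>v v)"
proof -
  obtain \<gamma> where \<gamma>: "curve n \<gamma> 0 = x" "velocity n \<gamma> = v" using tangent_curve[OF x v] .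
  obtain \<delta> where \<delta>: "\<And>s. k (curve n \<gamma> s) = curve n \<delta> s"
    "velocity n \<delta> = jacobian n k (curve n \<gamma> 0) *\<^sub>v velocity n \<gamma>"
    using polynomial_map_curve[OF k] by metis
  obtain \<epsilon> where \<epsilon>: "\<And>s. h (curve n \<delta> s) = curve n \<epsilon> s"
    "velocity n \<epsilon> = jacobian n h (curve n \<delta> 0) *\<^sub>v velocity n \<delta>"
    using polynomial_map_curve[OF h] by metis
  obtain \<zeta> where \<zeta>: "\<And>s. h (k (curve n \<gamma> s)) = curve n \<zeta> s"
    "velocity n \<zeta> = jacobian n (\<lambda>x. h (k x)) (curve n \<gamma> 0) *\<^sub>v velocity n \<gamma>"
    using polynomial_map_curve[OF polynomial_map_compose[OF h k]] by metis
  have "velocity n \<zeta> = velocity n \<epsilon>"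
    by (rule velocity_unique) (simp add: \<zeta>(1)[symmetric] \<epsilon>(1)[symmetric] \<delta>(1)[symmetric])
  then show ?thesis using \<gamma> \<delta> \<epsilon> \<zeta> by metis
qed

lemma jacobian_unique:
  fixes h :: "'a :: {idom, ring_char_0} vec \<Rightarrow> 'a vec"
  assumes h: "polynomial_map n h" and eq: "\<And>x. x \<in> carrier_vec n \<Longrightarrow> k x = h x"
    and x: "x \<in> carrier_vec n" and v: "v \<in> carrier_vec n"
  shows "jacobian n k x *\<^sub>v v = jacobian n h x *\<^sub>v v"
proof -
  have k: "polynomial_map n k" by (rule polynomial_map_cong[OF h eq])
  obtain \<gamma> where \<gamma>: "curve n \<gamma> 0 = x" "velocity n \<gamma> = v" using tangent_curve[OF x v] .
  obtain \<delta> where \<delta>: "\<And>s. k (curve n \<gamma> s) = curve n \<delta> s"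
    "velocity n \<delta> = jacobian n k (curve n \<gamma> 0) *\<^sub>v velocity n \<gamma>"
    using polynomial_map_curve[OF k] by metis
  obtain \<epsilon> where \<epsilon>: "\<And>s. h (curve n \<gamma> s) = curve n \<epsilon> s"
    "velocity n \<epsilon> = jacobian n h (curve n \<gamma> 0) *\<^sub>v velocity n \<gamma>"
    using polynomial_map_curve[OF h] by metis
  have "velocity n \<delta> = velocity n \<epsilon>"
    by (rule velocity_unique) (simp add: \<delta>(1)[symmetric] \<epsilon>(1)[symmetric] eq)
  then show ?thesis using \<gamma> \<delta> \<epsilon> by metis
qed

lemma jacobian_affine_op:
  fixes A :: "'a :: {idom, ring_char_0} mat"
  assumes A: "A \<in> carrier_mat n n" and b: "b \<in> carrier_vec n"
    and x: "x \<in> carrier_vec n" and v: "v \<in> carrier_vec n"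
  shows "jacobian n (affine_op A b) x *\<^sub>v v = A *\<^sub>v v"
proof -
  obtain \<gamma> where \<gamma>: "curve n \<gamma> 0 = x" "velocity n \<gamma> = v" using tangent_curve[OF x v] .
  obtain \<delta> where \<delta>: "\<And>s. affine_op A b (curve n \<gamma> s) = curve n \<delta> s"
    "velocity n \<delta> = jacobian n (affine_op A b) (curve n \<gamma> 0) *\<^sub>v velocity n \<gamma>"
    using polynomial_map_curve[OF polynomial_map_affine_op[OF A b]] by metis
  \<comment> \<open>The image curve written out: the constant \<open>b\<close> affects only the
    coefficient of degree 0 and so drops out of the velocity.\<close>
  define \<epsilon> where "\<epsilon> = (\<lambda>i. (\<Sum>j<n. Polynomial.smult (A $$ (i,j)) (\<gamma> j)) + [:b $ i:])"
  have "affine_op A b (curve n \<gamma> s) = curve n \<epsilon> s" for s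
    using A b by (intro eq_vecI)
      (auto simp: affine_op_def curve_def \<epsilon>_def scalar_prod_def poly_sum lessThan_atLeast0)
  then have "velocity n \<delta> = velocity n \<epsilon>"
    by (intro velocity_unique) (simp add: \<delta>(1)[symmetric])
  also have "velocity n \<epsilon> = A *\<^sub>v velocity n \<gamma>"
    using A by (intro eq_vecI)
      (auto simp: velocity_def \<epsilon>_def scalar_prod_def coeff_sum lessThan_atLeast0)
  finally show ?thesis using \<delta> \<gamma> by simp
qed

lemma eq_mat_by_vec:
  fixes A :: "'a :: comm_ring_1 mat"
  assumes A: "A \<in> carrier_mat n n" and B: "B \<in> carrier_mat n n"
    and eq: "\<And>v. v \<in> carrier_vec n \<Longrightarrow> A *\<^sub>v v = B *\<^sub>v v"
  shows "A = B"
proof (rule eq_matI)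
  fix i j assume ij: "i < dim_row B" "j < dim_col B"
  have "(A *\<^sub>v unit_vec n j) $ i = (B *\<^sub>v unit_vec n j) $ i" using eq by simp
  then show "A $$ (i,j) = B $$ (i,j)" using A B ij by auto
qed (use A B in auto)

lemma affine_conjugate_jacobian:
  fixes A :: "'a :: {idom, ring_char_0} mat"
  assumes A: "A \<in> carrier_mat n n" and b: "b \<in> carrier_vec n"
    and C: "C \<in> carrier_mat n n" and d: "d \<in> carrier_vec n"
    and h: "polynomial_map n h"
    and eq: "\<And>x. x \<in> carrier_vec n \<Longrightarrow> h (affine_op C d x) = affine_op A b (h x)"
    and x: "x \<in> carrier_vec n"
  shows "jacobian n h (affine_op C d x) * C = A * jacobian n h x"
proof (rule eq_mat_by_vec)
  fix v :: "'a vec" assume v: "v \<in> carrier_vec n"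
  note pA = polynomial_map_affine_op[OF A b] and pC = polynomial_map_affine_op[OF C d]
  have "jacobian n h (affine_op C d x) *\<^sub>v (C *\<^sub>v v) = jacobian n (\<lambda>x. h (affine_op C d x)) x *\<^sub>v v"
    using jacobian_compose[OF h pC x v] jacobian_affine_op[OF C d x v] by simp
  also have "\<dots> = jacobian n (\<lambda>x. affine_op A b (h x)) x *\<^sub>v v"
    by (rule jacobian_unique[OF polynomial_map_compose[OF pA h] eq x v])
  also have "\<dots> = A *\<^sub>v (jacobian n h x *\<^sub>v v)"
    using jacobian_compose[OF pA h x v]
      jacobian_affine_op[OF A b polynomial_map_carrier[OF h x] mult_mat_vec_carrier[OF jacobian_carrier v]]
    by simp
  finally show "(jacobian n h (affine_op C d x) * C) *\<^sub>v v = (A * jacobian n h x) *\<^sub>v v"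
    using assoc_mult_mat_vec[OF jacobian_carrier C v] assoc_mult_mat_vec[OF A jacobian_carrier v]
    by simp
qed (rule mult_carrier_mat[OF jacobian_carrier C], rule mult_carrier_mat[OF A jacobian_carrier])

lemma jacobian_inverse:
  fixes h :: "'a :: {idom, ring_char_0} vec \<Rightarrow> 'a vec"
  assumes h: "polynomial_map n h" and k: "polynomial_map n k"
    and kh: "\<And>x. x \<in> carrier_vec n \<Longrightarrow> k (h x) = x"
    and x: "x \<in> carrier_vec n"
  shows "jacobian n k (h x) * jacobian n h x = 1\<^sub>m n"
proof (rule eq_mat_by_vec)
  fix v :: "'a vec" assume v: "v \<in> carrier_vec n"
  have I: "affine_op (1\<^sub>m n) (0\<^sub>v n) x = x" if "x \<in> carrier_vec n" for x :: "'a vec"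
    using that by (auto simp: affine_op_def)
  have "jacobian n k (h x) *\<^sub>v (jacobian n h x *\<^sub>v v) = jacobian n (\<lambda>x. k (h x)) x *\<^sub>v v"
    using jacobian_compose[OF k h x v] by simp
  also have "\<dots> = jacobian n (affine_op (1\<^sub>m n) (0\<^sub>v n)) x *\<^sub>v v"
    by (rule jacobian_unique[OF polynomial_map_affine_op _ x v]) (auto simp: I kh)
  also have "\<dots> = 1\<^sub>m n *\<^sub>v v"
    by (rule jacobian_affine_op) (use x v in auto)
  finally show "(jacobian n k (h x) * jacobian n h x) *\<^sub>v v = 1\<^sub>m n *\<^sub>v v"
    using assoc_mult_mat_vec[OF jacobian_carrier jacobian_carrier v] by simp
qed (rule mult_carrier_mat[OF jacobian_carrier jacobian_carrier], rule one_carrier_mat)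

section \<open>Similarity of matrices and the case of fixed points\<close>

lemma similar_if_biregularly_conjugate:
  fixes A :: "'a :: {idom, ring_char_0} mat"
  assumes A: "A \<in> carrier_mat n n" and b: "b \<in> carrier_vec n"
    and C: "C \<in> carrier_mat n n" and d: "d \<in> carrier_vec n"
    and conj: "biregularly_conjugate n (affine_op A b) (affine_op C d)"
    and fp: "has_fixed_point n (affine_op C d)"
  shows "similar_mat A C"
proof -
  obtain h k where h: "polynomial_map n h" and k: "polynomial_map n k"
    and kh: "\<And>x. x \<in> carrier_vec n \<Longrightarrow> k (h x) = x"
    and hk: "\<And>x. x \<in> carrier_vec n \<Longrightarrow> h (k x) = x"
    and g: "\<And>x. x \<in> carrier_vec n \<Longrightarrow> affine_op C d x = k (affine_op A b (h x))"
    using biregularly_conjugateE[OF conj] by metis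
  obtain x where x: "x \<in> carrier_vec n" "affine_op C d x = x"
    using fp by (auto simp: has_fixed_point_def)
  let ?M = "jacobian n h x" and ?N = "jacobian n k (h x)"
  have hx: "h x \<in> carrier_vec n" using h x by (simp add: polynomial_map_carrier)
  have "h (affine_op C d y) = affine_op A b (h y)" if "y \<in> carrier_vec n" for y
    using g hk that affine_op_carrier[OF A b polynomial_map_carrier[OF h]] by simp
  from affine_conjugate_jacobian[OF A b C d h this x(1)]
  have MC: "?M * C = A * ?M" using x by simp
  have NM: "?N * ?M = 1\<^sub>m n" by (rule jacobian_inverse[OF h k kh x(1)])
  have MN: "?M * ?N = 1\<^sub>m n" using jacobian_inverse[OF k h hk hx] kh x by simp
  show ?thesis
  proof (rule similar_matI)
    show "{A, C, ?M, ?N} \<subseteq> carrier_mat n n" using A C by auto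
    have "?M * C * ?N = A * (?M * ?N)"
      unfolding MC by (rule assoc_mult_mat[OF A jacobian_carrier jacobian_carrier])
    then show "A = ?M * C * ?N" using MN A by simp
  qed (use MN NM in auto)
qed

text \<open>The new constant term can stay unspecified: later arguments ask only whether the new
  operator has a fixed point, and conjugacy preserves the answer.\<close>

lemma biregularly_conjugate_similar:
  fixes A :: "'a :: comm_ring_1 mat"
  assumes A: "A \<in> carrier_mat n n" and b: "b \<in> carrier_vec n" and sim: "similar_mat A C"
  obtains d where "d \<in> carrier_vec n" "biregularly_conjugate n (affine_op A b) (affine_op C d)"
proof -
  obtain P Q where "similar_mat_wit A C P Q" using sim by (auto simp: similar_mat_def)
  note wit = similar_mat_witD2[OF A this]
  have "A * P = P * C * (Q * P)"
    unfolding wit(3) by (rule assoc_mult_mat[OF mult_carrier_mat[OF wit(6,5)] wit(7,6)])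
  then have "A * P = P * C" using wit by simp
  then have "Q * A * P = Q * P * C"
    using assoc_mult_mat[OF wit(7) A wit(6)] assoc_mult_mat[OF wit(7,6,5)] by simp
  then have "Q * A * P = C" using wit by simp
  with biregularly_conjugate_linear[OF A b, of P Q] wit
  have "biregularly_conjugate n (affine_op A b) (affine_op C (Q *\<^sub>v b))" by simp
  then show thesis using wit b by (intro that[of "Q *\<^sub>v b"]) auto
qed

lemma biregularly_conjugate_zero_translation:
  fixes A :: "'a :: comm_ring_1 mat"
  assumes A: "A \<in> carrier_mat n n" and b: "b \<in> carrier_vec n"
    and fp: "has_fixed_point n (affine_op A b)"
  shows "biregularly_conjugate n (affine_op A b) (affine_op A (0\<^sub>v n))"
proof -
  obtain p where p: "p \<in> carrier_vec n" "A *\<^sub>v p + b = p"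
    using fp by (auto simp: has_fixed_point_def affine_op_def)
  have "p - p = 0\<^sub>v n" using p by auto
  with biregularly_conjugate_translate[OF A b p(1)] p show ?thesis by simp
qed

lemma has_fixed_point_conjugate:
  assumes "biregularly_conjugate n f g" "has_fixed_point n g"
    and "\<And>x. x \<in> carrier_vec n \<Longrightarrow> f x \<in> carrier_vec n"
  shows "has_fixed_point n f"
proof -
  obtain h k where hk: "polynomial_map n h" "polynomial_map n k"
    "\<And>x. x \<in> carrier_vec n \<Longrightarrow> k (h x) = x"
    "\<And>x. x \<in> carrier_vec n \<Longrightarrow> h (k x) = x"
    "\<And>x. x \<in> carrier_vec n \<Longrightarrow> g x = k (f (h x))"
    using biregularly_conjugateE[OF assms(1)] by metis
  obtain x where x: "x \<in> carrier_vec n" "g x = x" using assms(2) by (auto simp: has_fixed_point_def)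
  have "f (h x) = h x" using hk x assms(3) by (metis polynomial_map_carrier)
  then show ?thesis using x hk by (auto simp: has_fixed_point_def polynomial_map_carrier)
qed

lemma biregularly_conjugate_iff_similar:
  fixes A :: "'a :: {idom, ring_char_0} mat"
  assumes A: "A \<in> carrier_mat n n" and b: "b \<in> carrier_vec n"
    and C: "C \<in> carrier_mat n n" and d: "d \<in> carrier_vec n"
    and fA: "has_fixed_point n (affine_op A b)" and fC: "has_fixed_point n (affine_op C d)"
  shows "biregularly_conjugate n (affine_op A b) (affine_op C d) \<longleftrightarrow> similar_mat A C"
proof
  show "biregularly_conjugate n (affine_op A b) (affine_op C d) \<Longrightarrow> similar_mat A C"
    using similar_if_biregularly_conjugate[OF A b C d _ fC] by simp
next
  assume "similar_mat A C"
  then obtain e where e: "e \<in> carrier_vec n" "biregularly_conjugate n (affine_op A b) (affine_op C e)"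
    using biregularly_conjugate_similar[OF A b] by metis
  \<comment> \<open>The unknown operator with matrix \<open>C\<close> inherits a fixed point, so it
    and \<open>affine_op C d\<close> are both conjugate to the same linear operator.\<close>
  have "biregularly_conjugate n (affine_op C e) (affine_op A b)"
    by (rule biregularly_conjugate_sym[OF e(2)]) (rule affine_op_carrier[OF A b])
  from has_fixed_point_conjugate[OF this fA] have "has_fixed_point n (affine_op C e)"
    using affine_op_carrier[OF C e(1)] by simp
  from biregularly_conjugate_zero_translation[OF C e(1) this]
  have 1: "biregularly_conjugate n (affine_op A b) (affine_op C (0\<^sub>v n))"
    using biregularly_conjugate_trans[OF e(2)] affine_op_carrier[OF A b] by blast
  have "biregularly_conjugate n (affine_op C (0\<^sub>v n)) (affine_op C d)"
    by (rule biregularly_conjugate_sym[OF biregularly_conjugate_zero_translation[OF C d fC]])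
      (rule affine_op_carrier[OF C d])
  with 1 show "biregularly_conjugate n (affine_op A b) (affine_op C d)"
    using biregularly_conjugate_trans affine_op_carrier[OF A b] by blast
qed

section \<open>Flows of unipotent affine maps\<close>

lemma gbinomial_poly:
  fixes k :: nat
  shows "\<exists>q :: 'a :: field_char_0 poly. \<forall>a. a gchoose k = poly q a"
proof (intro exI allI)
  fix a :: 'a
  show "a gchoose k = poly (Polynomial.smult (inverse (fact k)) (\<Prod>i = 0..<k. [:- of_nat i, 1:])) a"
    by (simp add: gbinomial_prod_rev poly_prod divide_inverse)
qed

lemma poly_fun_gbinomial:
  fixes \<phi> :: "'a :: field_char_0 vec \<Rightarrow> 'a"
  assumes "poly_fun n \<phi>"
  shows "poly_fun n (\<lambda>x. \<phi> x gchoose k)"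
proof -
  have "poly_fun n (\<lambda>x. inverse (fact k) * (\<Prod>i = 0..<k. \<phi> x + - of_nat i))"
    by (intro poly_fun_mult poly_fun_prod poly_fun_add poly_fun_const assms)
  then show ?thesis
    by (rule poly_fun_cong) (simp add: gbinomial_prod_rev divide_inverse)
qed

text \<open>Extends identities checked for the iterates of a map to all values of the flow
  parameter.\<close>

lemma poly_eq_if_eq_on_nat:
  fixes p q :: "'a :: {idom, ring_char_0} poly"
  assumes "\<And>m. poly p (of_nat m) = poly q (of_nat m)"
  shows "p = q"
proof (rule ccontr)
  assume "p \<noteq> q"
  then have "finite {x. poly (p - q) x = 0}" by (intro poly_roots_finite) simp
  moreover have "range of_nat \<subseteq> {x. poly (p - q) x = 0}" using assms by auto
  ultimately have "finite (range (of_nat :: nat \<Rightarrow> 'a))" by (rule rev_finite_subset)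
  moreover have "inj (of_nat :: nat \<Rightarrow> 'a)" by (simp add: inj_on_def)
  ultimately show False using infinite_UNIV_nat finite_imageD by blast
qed

text \<open>
  The iterates of the unipotent affine map \<open>U x = x + N x + b\<close> extend to a polynomial
  one-parameter family \<open>E\<close> with \<open>E s x = (\<Sum>j. (s gchoose j) W\<^sub>j x)\<close>, where
  \<open>W\<^sub>j x\<close> is the \<open>j\<close>-th forward difference at \<open>0\<close> of the orbit of \<open>x\<close>.
\<close>

locale unipotent_flow =
  fixes n :: nat and D N :: "'a :: field_char_0 mat" and b :: "'a vec" and l :: nat
  assumes D: "D \<in> carrier_mat n n" and N: "N \<in> carrier_mat n n" and b: "b \<in> carrier_vec n"
    and DN: "D * N = N * D"
    and N_strict: "\<And>i j. i < n \<Longrightarrow> j < n \<Longrightarrow> N $$ (i,j) \<noteq> 0 \<Longrightarrow> i < j"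
    and Db: "D *\<^sub>v b = b"
    and l: "l < n"
    and N_row: "\<And>j. j < n \<Longrightarrow> N $$ (l,j) = 0"
    and D_row: "\<And>j. j < n \<Longrightarrow> D $$ (l,j) = (if j = l then 1 else 0)"
    and D_col: "\<And>i. i < n \<Longrightarrow> D $$ (i,l) = (if i = l then 1 else 0)"
    and bl: "b $ l \<noteq> 0"
begin

text \<open>One step of the orbit adds \<open>N\<close> times the current point plus
  \<open>b\<close>. Differencing again cancels the constant, so \<open>b\<close> enters at the first
  difference and only \<open>N\<close> acts afterwards.\<close>

fun W :: "nat \<Rightarrow> 'a vec \<Rightarrow> 'a vec" where
  "W 0 x = x"
| "W (Suc j) x = N *\<^sub>v W j x + (if j = 0 then b else 0\<^sub>v n)"

definition U :: "'a vec \<Rightarrow> 'a vec" where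
  "U x = x + N *\<^sub>v x + b"

text \<open>The Newton series of the orbit, cut off where the differences vanish. The cutoff is
  \<open>n\<close> and not \<open>n - 1\<close>, because the affine term delays vanishing by one
  step: \<open>W n\<close> may still be nonzero in coordinate 0.\<close>

definition E :: "'a \<Rightarrow> 'a vec \<Rightarrow> 'a vec" where
  "E s x = vec n (\<lambda>i. \<Sum>j\<le>n. (s gchoose j) * W j x $ i)"

lemma W_polynomial_map: "polynomial_map n (W j)"
proof (induction j)
  case 0
  have "polynomial_map n (affine_op (1\<^sub>m n) (0\<^sub>v n) :: 'a vec \<Rightarrow> 'a vec)"
    by (rule polynomial_map_affine_op) auto
  then show ?case by (rule polynomial_map_cong) (auto simp: affine_op_def)
next
  case (Suc j)
  have "polynomial_map n (affine_op N (if j = 0 then b else 0\<^sub>v n))"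
    using N b by (intro polynomial_map_affine_op) auto
  from polynomial_map_compose[OF this Suc] show ?case
    by (rule polynomial_map_cong) (simp add: affine_op_def)
qed

lemma W_carrier [simp]: "x \<in> carrier_vec n \<Longrightarrow> W j x \<in> carrier_vec n"
  by (rule polynomial_map_carrier[OF W_polynomial_map])

lemma E_carrier [simp]: "E s x \<in> carrier_vec n"
  by (simp add: E_def)

lemma U_carrier [simp]: "x \<in> carrier_vec n \<Longrightarrow> U x \<in> carrier_vec n"
  using N b by (simp add: U_def)

lemma D_mult_carrier [simp]: "x \<in> carrier_vec n \<Longrightarrow> D *\<^sub>v x \<in> carrier_vec n"
  using D by simp

text \<open>\<open>N\<close> is strictly upper triangular, so each difference after the first clears
  one more coordinate, starting from the bottom.\<close>

lemma W_vanish: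
  assumes x: "x \<in> carrier_vec n"
  shows "j > 0 \<Longrightarrow> i < n \<Longrightarrow> i + j > n \<Longrightarrow> W j x $ i = 0"
proof (induction j arbitrary: i)
  case (Suc j)
  \<comment> \<open>For the first difference the hypothesis \<open>i + 1 > n\<close> contradicts
    \<open>i < n\<close>, so the constant \<open>b\<close> never has to be considered.\<close>
  then have j: "j > 0" by (cases j) auto
  have "N $$ (i,m) * W j x $ m = 0" if "m < n" for m
  proof (cases "N $$ (i,m) = 0")
    case False
    then have "i < m" using N_strict Suc that by auto
    then have "m + j > n" using Suc.prems by linarith
    then show ?thesis using Suc.IH[OF j that] by simp
  qed simp
  then have "(\<Sum>m = 0..<n. N $$ (i,m) * W j x $ m) = 0"
    by (intro sum.neutral) auto
  moreover have "dim_vec (W j x) = n" using W_carrier[OF x, of j] by (rule carrier_vecD)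
  ultimately show ?case using Suc.prems j N
    by (simp add: scalar_prod_def)
qed simp

text \<open>Replacing \<open>x\<close> by \<open>U x\<close> moves the base point of the differences
  from 0 to 1, and a difference at 1 is the one at 0 plus the next higher one.\<close>

lemma W_U:
  assumes x: "x \<in> carrier_vec n"
  shows "W j (U x) = W j x + W (Suc j) x"
proof (induction j)
  case 0
  then show ?case using x N b by (auto simp: U_def intro!: eq_vecI)
next
  case (Suc j)
  have "N *\<^sub>v (W j x + W (Suc j) x) = N *\<^sub>v W j x + N *\<^sub>v W (Suc j) x"
    by (rule mult_add_distrib_mat_vec[OF N W_carrier[OF x] W_carrier[OF x]])
  then show ?case
    using Suc N b x W_carrier[OF x, of j] W_carrier[OF x, of "Suc j"]
    by (auto intro!: eq_vecI)
qed

text \<open>\<open>D\<close> commutes with \<open>N\<close> and fixes \<open>b\<close>, so it maps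
  orbits of \<open>U\<close> to orbits of \<open>U\<close>; being linear, it also respects their
  differences.\<close>

lemma W_D:
  assumes x: "x \<in> carrier_vec n"
  shows "W j (D *\<^sub>v x) = D *\<^sub>v W j x"
proof (induction j)
  case (Suc j)
  let ?c = "if j = 0 then b else 0\<^sub>v n"
  have "D *\<^sub>v ?c = ?c" using Db D by auto
  moreover have "N *\<^sub>v (D *\<^sub>v W j x) = D *\<^sub>v (N *\<^sub>v W j x)"
    using assoc_mult_mat_vec[OF N D W_carrier[OF x, of j]]
      assoc_mult_mat_vec[OF D N W_carrier[OF x, of j]] DN by simp
  moreover have "D *\<^sub>v (N *\<^sub>v W j x + ?c) = D *\<^sub>v (N *\<^sub>v W j x) + D *\<^sub>v ?c"
    by (rule mult_add_distrib_mat_vec[OF D]) (use N b x in auto)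
  ultimately show ?case using Suc by simp
qed simp

text \<open>Pascal's rule for the binomial coefficients. The upper ends of the sums match because
  \<open>W (Suc n)\<close> is zero. Both composition laws of \<open>E\<close> with \<open>U\<close>
  reduce to this expression.\<close>

lemma E_Suc:
  assumes x: "x \<in> carrier_vec n" and i: "i < n"
  shows "E (s + 1) x $ i = (\<Sum>j\<le>n. (s gchoose j) * (W j x $ i + W (Suc j) x $ i))"
proof -
  have "W (Suc n) x $ i = 0" by (rule W_vanish[OF x]) (use i in auto)
  then have "(\<Sum>j\<le>n. (s gchoose j) * W (Suc j) x $ i) = (\<Sum>j<n. (s gchoose j) * W (Suc j) x $ i)"
    by (simp add: lessThan_Suc_atMost[symmetric] del: W.simps)
  moreover have "(\<Sum>j\<le>n. ((s + 1) gchoose j) * W j x $ i) =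
      W 0 x $ i + (\<Sum>j<n. ((s + 1) gchoose Suc j) * W (Suc j) x $ i)"
    by (simp add: lessThan_Suc_atMost[symmetric] sum.lessThan_Suc_shift del: W.simps sum.lessThan_Suc)
  moreover have "(\<Sum>j\<le>n. (s gchoose j) * W j x $ i) =
      W 0 x $ i + (\<Sum>j<n. (s gchoose Suc j) * W (Suc j) x $ i)"
    by (simp add: lessThan_Suc_atMost[symmetric] sum.lessThan_Suc_shift del: W.simps sum.lessThan_Suc)
  ultimately show ?thesis
    using i by (simp add: E_def gbinomial_Suc_Suc distrib_left distrib_right sum.distrib del: W.simps)
qed

lemma E_U:
  assumes x: "x \<in> carrier_vec n"
  shows "E s (U x) = E (s + 1) x"
proof (rule eq_vecI)
  fix i assume "i < dim_vec (E (s + 1) x)"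
  then have i: "i < n" by (simp add: E_def)
  have "W j (U x) $ i = W j x $ i + W (Suc j) x $ i" for j
    unfolding W_U[OF x] using W_carrier[OF x, of "Suc j"] i by (simp del: W.simps)
  then show "E s (U x) $ i = E (s + 1) x $ i"
    unfolding E_Suc[OF x i] using i by (simp add: E_def del: W.simps)
qed (simp add: E_def)

lemma E_expand_mult:
  assumes x: "x \<in> carrier_vec n" and M: "M \<in> carrier_mat n n" and i: "i < n"
  shows "(M *\<^sub>v E s x) $ i = (\<Sum>j\<le>n. (s gchoose j) * (M *\<^sub>v W j x) $ i)"
proof -
  have "(M *\<^sub>v E s x) $ i = (\<Sum>m = 0..<n. \<Sum>j\<le>n. (s gchoose j) * (M $$ (i,m) * W j x $ m))"
    using M i by (simp add: E_def scalar_prod_def sum_distrib_left algebra_simps del: W.simps)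
  also have "\<dots> = (\<Sum>j\<le>n. \<Sum>m = 0..<n. (s gchoose j) * (M $$ (i,m) * W j x $ m))"
    by (rule sum.swap)
  also have "\<dots> = (\<Sum>j\<le>n. (s gchoose j) * (M *\<^sub>v W j x) $ i)"
  proof (rule sum.cong[OF refl])
    fix j
    show "(\<Sum>m = 0..<n. (s gchoose j) * (M $$ (i,m) * W j x $ m)) = (s gchoose j) * (M *\<^sub>v W j x) $ i"
      using M i W_carrier[OF x, of j]
      by (simp add: scalar_prod_def sum_distrib_left del: W.simps)
  qed
  finally show ?thesis .
qed

lemma U_E:
  assumes x: "x \<in> carrier_vec n"
  shows "U (E s x) = E (s + 1) x"
proof (rule eq_vecI)
  fix i assume "i < dim_vec (E (s + 1) x)"
  then have i: "i < n" by (simp add: E_def)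
  have "b $ i = (\<Sum>j\<le>n. (s gchoose j) * (if j = 0 then b $ i else 0))"
    by (subst sum.remove[of _ 0]) auto
  moreover have "W (Suc j) x $ i = (N *\<^sub>v W j x) $ i + (if j = 0 then b $ i else 0)" for j
    using N b i W_carrier[OF x, of j] by auto
  ultimately show "U (E s x) $ i = E (s + 1) x $ i"
    unfolding E_Suc[OF x i]
    using i N b E_expand_mult[OF x N i]
    by (simp add: U_def distrib_left sum.distrib E_def del: W.simps index_mult_mat_vec)
qed (use N b in \<open>simp add: U_def E_def\<close>)

lemma E_0:
  assumes x: "x \<in> carrier_vec n"
  shows "E 0 x = x"
proof (rule eq_vecI)
  fix i assume "i < dim_vec x"
  then have "i < n" using x by simp
  moreover have "(\<Sum>j\<le>n. ((0::'a) gchoose j) * W j x $ i) = W 0 x $ i"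
  proof (subst sum.remove[of _ 0])
    show "(0 gchoose 0) * W 0 x $ i + (\<Sum>j\<in>{..n} - {0}. (0 gchoose j) * W j x $ i) = W 0 x $ i"
      by (auto intro!: sum.neutral simp: gbinomial_0_left)
  qed auto
  ultimately show "E 0 x $ i = x $ i" by (simp add: E_def del: W.simps(2))
qed (use x in \<open>simp add: E_def\<close>)

lemma E_D:
  assumes x: "x \<in> carrier_vec n"
  shows "E s (D *\<^sub>v x) = D *\<^sub>v E s x"
proof (rule eq_vecI)
  fix i assume "i < dim_vec (D *\<^sub>v E s x)"
  then have i: "i < n" using D by simp
  show "E s (D *\<^sub>v x) $ i = (D *\<^sub>v E s x) $ i"
    unfolding E_expand_mult[OF x D i] using i by (simp add: E_def W_D[OF x] del: W.simps)
qed (use D in \<open>simp add: E_def\<close>)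

text \<open>Row \<open>l\<close> of \<open>N\<close> is zero, so only the first difference reaches
  this coordinate. Thus \<open>x $ l / b $ l\<close> grows at unit speed along the flow: it is the
  clock.\<close>

lemma E_l:
  assumes x: "x \<in> carrier_vec n"
  shows "E s x $ l = x $ l + s * b $ l"
proof -
  have "W (Suc j) x $ l = (if j = 0 then b $ l else 0)" for j
    using N b l N_row W_carrier[OF x, of j] by (auto simp: scalar_prod_def)
  then have "(\<Sum>j<n. (s gchoose Suc j) * W (Suc j) x $ l) = (\<Sum>j<n. if j = 0 then s * b $ l else 0)"
    by (intro sum.cong) auto
  also have "\<dots> = s * b $ l" using l by simp
  finally show ?thesis using l
    by (simp add: E_def lessThan_Suc_atMost[symmetric] sum.lessThan_Suc_shift del: W.simps(2) sum.lessThan_Suc)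
qed

text \<open>One factor \<open>U\<close> is split off the inner flow by \<open>U_E\<close> and
  absorbed by the outer one through \<open>E_U\<close>, which lowers both parameters by one in
  absolute value.\<close>

lemma E_inverse_nat:
  "x \<in> carrier_vec n \<Longrightarrow> E (- of_nat m) (E (of_nat m) x) = x"
proof (induction m arbitrary: x)
  case (Suc m)
  have "E (- of_nat (Suc m)) (E (of_nat (Suc m)) x) = E (- of_nat (Suc m)) (U (E (of_nat m) x))"
    using U_E[OF Suc.prems, of "of_nat m"] by (simp add: add.commute)
  also have "\<dots> = E (- of_nat (Suc m) + 1) (E (of_nat m) x)"
    by (rule E_U) simp
  also have "- of_nat (Suc m) + 1 = (- of_nat m :: 'a)" by simp
  finally show ?case using Suc by simp
qed (simp add: E_0)

text \<open>For fixed \<open>x\<close> every coordinate of the left side is a polynomial in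
  \<open>s\<close>, and on the natural numbers it is the constant given by
  \<open>E_inverse_nat\<close>.\<close>

lemma E_inverse:
  assumes x: "x \<in> carrier_vec n"
  shows "E (- s) (E s x) = x"
proof -
  define B where "B j = (SOME q :: 'a poly. \<forall>a. a gchoose j = poly q a)" for j
  have B: "a gchoose j = poly (B j) a" for a j
    unfolding B_def using someI_ex[OF gbinomial_poly[of j]] by blast
  define \<gamma> where "\<gamma> i = (\<Sum>j\<le>n. Polynomial.smult (W j x $ i) (B j))" for i
  have \<gamma>: "E a x = curve n \<gamma> a" for a
    by (intro eq_vecI) (auto simp: E_def curve_def \<gamma>_def poly_sum B algebra_simps simp del: W.simps)
  have "\<exists>\<delta>. \<forall>a. W j (curve n \<gamma> a) = curve n \<delta> a" for j
    using polynomial_map_curve[OF W_polynomial_map] by metis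
  then obtain \<delta> where \<delta>: "\<And>j a. W j (curve n \<gamma> a) = curve n (\<delta> j) a" by metis
  \<comment> \<open>Composition with \<open>[:0, -1:]\<close> evaluates the binomial polynomial of
    the outer flow at the negated time; the factor \<open>\<delta> j i\<close> follows the
    difference along the inner flow.\<close>
  define q where "q i = (\<Sum>j\<le>n. pcompose (B j) [:0, -1:] * \<delta> j i)" for i
  have q: "E (- a) (E a x) $ i = poly (q i) a" if "i < n" for a i
    using that unfolding \<gamma> by (simp add: E_def \<delta> B q_def poly_sum poly_pcompose del: W.simps)
  have "q i = [:x $ i:]" if "i < n" for i
  proof (rule poly_eq_if_eq_on_nat)
    show "poly (q i) (of_nat m) = poly [:x $ i:] (of_nat m)" for m
      using q[OF that, of "of_nat m"] E_inverse_nat[OF x, of m] by simp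
  qed
  then show ?thesis using q x by (intro eq_vecI) (auto simp: E_def)
qed

section \<open>Straightening the flow\<close>

definition zero_l :: "'a vec \<Rightarrow> 'a vec" where
  "zero_l x = vec n (\<lambda>i. if i = l then 0 else x $ i)"

lemma zero_l_carrier [simp]: "zero_l x \<in> carrier_vec n"
  by (simp add: zero_l_def)

text \<open>Flows \<open>x\<close> back to the slice where coordinate \<open>l\<close> is 0. That
  slot carries no information there, so it stores the old \<open>x $ l\<close>, which is the elapsed
  time multiplied by \<open>b $ l\<close>.\<close>

definition H :: "'a vec \<Rightarrow> 'a vec" where
  "H x = vec n (\<lambda>i. if i = l then x $ l else E (- (x $ l / b $ l)) x $ i)"

text \<open>The inverse of \<open>H\<close>: read the time off slot \<open>l\<close>, clear the slot
  to land on the slice, and flow forward.\<close>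

definition G :: "'a vec \<Rightarrow> 'a vec" where
  "G y = E (y $ l / b $ l) (zero_l y)"

lemma zero_l_polynomial_map: "polynomial_map n zero_l"
  unfolding polynomial_map_iff
proof (intro conjI ballI allI impI)
  fix i assume "i < n"
  then have "poly_fun n (\<lambda>x. zero_l x $ i) \<longleftrightarrow> poly_fun n (\<lambda>x :: 'a vec. if i = l then 0 else x $ i)"
    by (simp add: zero_l_def)
  also have "\<dots>" using \<open>i < n\<close> by (cases "i = l") (auto intro: poly_fun_const poly_fun_coord)
  finally show "poly_fun n (\<lambda>x. zero_l x $ i)" .
qed simp

lemma poly_fun_E:
  assumes \<phi>: "poly_fun n \<phi>" and h: "polynomial_map n h" and i: "i < n"
  shows "poly_fun n (\<lambda>x. E (\<phi> x) (h x) $ i)"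
proof -
  have "poly_fun n (\<lambda>x. W j (h x) $ i)" for j
    using polynomial_map_compose[OF W_polynomial_map h, of j] i by (simp add: polynomial_map_iff del: W.simps)
  then have "poly_fun n (\<lambda>x. \<Sum>j\<le>n. (\<phi> x gchoose j) * W j (h x) $ i)"
    by (intro poly_fun_sum poly_fun_mult poly_fun_gbinomial \<phi>)
  then show ?thesis using i by (simp add: E_def del: W.simps)
qed

lemma coord_l_poly_fun: "poly_fun n (\<lambda>x. c * x $ l :: 'a)"
  by (intro poly_fun_mult poly_fun_const poly_fun_coord l)

lemma H_polynomial_map: "polynomial_map n H"
  unfolding polynomial_map_iff
proof (intro conjI ballI allI impI)
  fix i assume i: "i < n"
  have "poly_fun n (\<lambda>x. E (- inverse (b $ l) * x $ l) (W 0 x) $ i)"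
    by (rule poly_fun_E[OF coord_l_poly_fun W_polynomial_map i])
  then have "poly_fun n (\<lambda>x. E (- (x $ l / b $ l)) x $ i)"
    by (simp add: divide_inverse mult.commute)
  then have "poly_fun n (\<lambda>x. if i = l then x $ l else E (- (x $ l / b $ l)) x $ i)"
    using l by (cases "i = l") (auto intro: poly_fun_coord)
  then show "poly_fun n (\<lambda>x. H x $ i)" using i by (simp add: H_def)
qed (simp add: H_def)

lemma G_polynomial_map: "polynomial_map n G"
  unfolding polynomial_map_iff
proof (intro conjI ballI allI impI)
  fix i assume i: "i < n"
  have "poly_fun n (\<lambda>x. E (inverse (b $ l) * x $ l) (zero_l x) $ i)"
    by (rule poly_fun_E[OF coord_l_poly_fun zero_l_polynomial_map i])
  then show "poly_fun n (\<lambda>x. G x $ i)"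
    by (simp add: G_def divide_inverse mult.commute)
qed (simp add: G_def)

lemma zero_l_H:
  assumes "x \<in> carrier_vec n"
  shows "zero_l (H x) = E (- (x $ l / b $ l)) x"
  using E_l[OF assms, of "- (x $ l / b $ l)"] bl l
  by (intro eq_vecI) (auto simp: zero_l_def H_def E_def)

lemma G_H:
  assumes "x \<in> carrier_vec n"
  shows "G (H x) = x"
  using E_inverse[OF assms, of "- (x $ l / b $ l)"] zero_l_H[OF assms] l
  by (simp add: G_def) (simp add: H_def)

text \<open>Time \<open>s\<close> and slice point \<open>z\<close> are independent coordinates of
  \<open>E s z\<close>. Describing \<open>H\<close> in them makes the conjugation below a
  substitution.\<close>

lemma H_E:
  fixes z :: "'a vec"
  assumes z: "z \<in> carrier_vec n" and zl: "z $ l = 0"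
  shows "H (E s z) = vec n (\<lambda>i. if i = l then s * b $ l else z $ i)"
proof -
  have "E s z $ l / b $ l = s" using E_l[OF z] zl bl by simp
  then show ?thesis using E_inverse[OF z, of s] E_l[OF z, of s] zl l
    by (auto simp: H_def)
qed

lemma H_G:
  assumes y: "y \<in> carrier_vec n"
  shows "H (G y) = y"
  unfolding G_def
  by (subst H_E) (use y l bl in \<open>auto simp: zero_l_def\<close>)

text \<open>In time and slice coordinates \<open>U\<close> advances the time by 1, while
  \<open>D\<close> commutes with the flow and preserves the slice. The map becomes
  \<open>(s, z)\<close> to \<open>(s + 1, D z)\<close>. The constant is \<open>b $ l\<close> because
  slot \<open>l\<close> stores \<open>s * b $ l\<close>.\<close>

lemma conjugate_to_semisimple:
  "biregularly_conjugate n (\<lambda>x. D *\<^sub>v U x) (affine_op D (b $ l \<cdot>\<^sub>v unit_vec n l))"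
proof (rule biregularly_conjugateI[OF G_polynomial_map H_polynomial_map H_G G_H])
  fix y :: "'a vec" assume y: "y \<in> carrier_vec n"
  show "D *\<^sub>v U y \<in> carrier_vec n" using y by simp
  define s where "s = y $ l / b $ l"
  have Dl: "(D *\<^sub>v z) $ l = z $ l" if "z \<in> carrier_vec n" for z
  proof -
    have "(D *\<^sub>v z) $ l = (\<Sum>j = 0..<n. D $$ (l,j) * z $ j)"
      using that D l by (simp add: scalar_prod_def)
    also have "\<dots> = (\<Sum>j = 0..<n. if j = l then z $ l else 0)"
      by (rule sum.cong) (auto simp: D_row)
    finally show ?thesis using l by simp
  qed
  have "D *\<^sub>v U (G y) = E (s + 1) (D *\<^sub>v zero_l y)"
    by (simp add: G_def s_def[symmetric] U_E E_D)
  moreover have "(D *\<^sub>v zero_l y) $ l = 0" using Dl[of "zero_l y"] l by (simp add: zero_l_def)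
  ultimately have "H (D *\<^sub>v U (G y)) = vec n (\<lambda>i. if i = l then (s + 1) * b $ l else (D *\<^sub>v zero_l y) $ i)"
    using H_E by simp
  also have "\<dots> = affine_op D (b $ l \<cdot>\<^sub>v unit_vec n l) y"
  proof (rule eq_vecI)
    fix i assume "i < dim_vec (affine_op D (b $ l \<cdot>\<^sub>v unit_vec n l) y)"
    then have i: "i < n" by (simp add: affine_op_def)
    show "vec n (\<lambda>i. if i = l then (s + 1) * b $ l else (D *\<^sub>v zero_l y) $ i) $ i =
        affine_op D (b $ l \<cdot>\<^sub>v unit_vec n l) y $ i"
    proof (cases "i = l")
      case True
      then show ?thesis using i bl D Dl[OF y]
        by (simp add: affine_op_def s_def distrib_right del: index_mult_mat_vec)
    next
      case False
      \<comment> \<open>Column \<open>l\<close> of \<open>D\<close> is zero outside row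
        \<open>l\<close>, so clearing coordinate \<open>l\<close> is invisible in the other
        rows.\<close>
      then have "(D *\<^sub>v zero_l y) $ i = (D *\<^sub>v y) $ i"
        using i D y D_col[OF i] by (auto simp: scalar_prod_def zero_l_def intro!: sum.cong)
      then show ?thesis using i False D l
        by (simp add: affine_op_def del: index_mult_mat_vec)
    qed
  qed (simp add: affine_op_def)
  finally show "affine_op D (b $ l \<cdot>\<^sub>v unit_vec n l) y = H (D *\<^sub>v U (G y))" ..
qed

end

section \<open>Jordan matrices\<close>

lemma similar_mat_carrier:
  assumes "similar_mat A B" "A \<in> carrier_mat n n"
  shows "B \<in> carrier_mat n n"
proof -
  obtain P Q where "similar_mat_wit A B P Q" using assms(1) by (auto simp: similar_mat_def)
  from similar_mat_witD2(5)[OF assms(2) this] show ?thesis .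
qed

section \<open>Existence and uniqueness of the Jordan form\<close>

lemma eigenvalue_exists:
  fixes A :: "'a :: alg_closed_field mat"
  assumes A: "A \<in> carrier_mat n n" and n: "n > 0"
  shows "\<exists>e. eigenvalue A e"
proof -
  have "degree (char_poly A) > 0" using degree_monic_char_poly[OF A] n by simp
  from alg_closed_imp_poly_has_root[OF this] show ?thesis
    by (simp add: eigenvalue_root_char_poly[OF A])
qed

lemma invertible_completion:
  fixes v :: "'a :: field vec"
  assumes v: "v \<in> carrier_vec n" and v0: "v \<noteq> 0\<^sub>v n"
  obtains P Q where "P \<in> carrier_mat n n" "Q \<in> carrier_mat n n"
    "P * Q = 1\<^sub>m n" "Q * P = 1\<^sub>m n" "P *\<^sub>v unit_vec n 0 = v"
proof -
  interpret vec_space "TYPE('a)" n .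
  define bs where "bs = basis_completion v"
  note bc = basis_completion[OF v v0, folded bs_def]
  define P where "P = mat_of_cols n bs"
  have P: "P \<in> carrier_mat n n"
    using mat_of_cols_carrier(1)[of n bs] bc(6) by (simp add: P_def)
  have cols: "cols P = bs"
    unfolding P_def by (rule cols_mat_of_cols) (use bc(2) in auto)
  have "n > 0" using v0 v by (cases n) auto
  have "rank P = n"
    by (rule lin_indpt_full_rank[OF P]) (use bc cols in auto)
  then have "det P \<noteq> 0" using det_rank_iff[OF P] by simp
  from det_non_zero_imp_unit[OF P this, unfolded Units_def, of "()"]
  obtain Q where Q: "Q \<in> carrier_mat n n" "Q * P = 1\<^sub>m n" "P * Q = 1\<^sub>m n"
    by (auto simp: ring_mat_def)
  have "P *\<^sub>v unit_vec n 0 = col P 0"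
    using P \<open>n > 0\<close> by (intro eq_vecI) auto
  also have "\<dots> = bs ! 0"
    using cols P \<open>n > 0\<close> by (metis cols_nth carrier_matD(2))
  also have "\<dots> = v" using bc(6,7) \<open>n > 0\<close> by (cases bs) auto
  finally show thesis using that P Q by blast
qed

text \<open>Deflation: with an eigenvector as first basis vector, the first column vanishes below
  the corner and the induction hypothesis applies to the lower right block. The upper right block
  changes under that similarity, hence the new \<open>B0\<close>.\<close>

lemma similar_upper_triangular:
  fixes A :: "'a :: alg_closed_field mat"
  assumes "A \<in> carrier_mat n n"
  shows "\<exists>B. similar_mat A B \<and> upper_triangular B"
  using assms
proof (induction n arbitrary: A)
  case 0
  then show ?case by (intro exI[of _ A]) (auto intro: similar_mat_refl)
next
  case (Suc n)
  let ?n = "Suc n"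
  note A = Suc.prems
  obtain e where "eigenvalue A e" using eigenvalue_exists[OF A] by auto
  then obtain v where v: "v \<in> carrier_vec ?n" "v \<noteq> 0\<^sub>v ?n" "A *\<^sub>v v = e \<cdot>\<^sub>v v"
    using A unfolding eigenvalue_def eigenvector_def by auto
  obtain P Q where PQ: "P \<in> carrier_mat ?n ?n" "Q \<in> carrier_mat ?n ?n"
    "P * Q = 1\<^sub>m ?n" "Q * P = 1\<^sub>m ?n" "P *\<^sub>v unit_vec ?n 0 = v"
    using invertible_completion[OF v(1,2)] .
  define A' where "A' = Q * A * P"
  have A': "A' \<in> carrier_mat ?n ?n" using A PQ by (simp add: A'_def)
  have "similar_mat_wit A' A Q P"
    by (rule similar_mat_witI[of _ _ ?n]) (use A A' PQ in \<open>auto simp: A'_def\<close>)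
  then have sim: "similar_mat A A'"
    using similar_mat_sym unfolding similar_mat_def by blast
  have "Q *\<^sub>v v = unit_vec ?n 0"
    using assoc_mult_mat_vec[OF PQ(2,1) unit_vec_carrier[of ?n 0]] PQ(4,5) by simp
  moreover have "A' *\<^sub>v unit_vec ?n 0 = Q *\<^sub>v (A *\<^sub>v v)"
    using assoc_mult_mat_vec[OF mult_carrier_mat[OF PQ(2) A] PQ(1) unit_vec_carrier[of ?n 0]]
      assoc_mult_mat_vec[OF PQ(2) A v(1)] PQ(5) by (simp add: A'_def)
  ultimately have col: "A' *\<^sub>v unit_vec ?n 0 = e \<cdot>\<^sub>v unit_vec ?n 0"
    using v mult_mat_vec[OF PQ(2) v(1)] by simp
  have A'0: "A' $$ (Suc i, 0) = 0" if "i < n" for i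
    using arg_cong[OF col, of "\<lambda>w :: 'a vec. w $ Suc i"] A' that by auto
  obtain A1 A2 A0 A3 where split: "split_block A' 1 1 = (A1,A2,A0,A3)"
    by (cases "split_block A' 1 1") auto
  from A' have "dim_row A' = 1 + n" "dim_col A' = 1 + n" by auto
  note sb = split_block[OF split this]
  have A0: "A0 = 0\<^sub>m n 1"
    using split A'0 A' by (auto simp: split_block_def Let_def)
  obtain B3 where B3: "similar_mat A3 B3" "upper_triangular B3"
    using Suc.IH[OF sb(4)] by auto
  obtain B0 where B0: "B0 \<in> carrier_mat 1 n"
    "similar_mat (four_block_mat A1 A2 (0\<^sub>m n 1) A3) (four_block_mat A1 B0 (0\<^sub>m n 1) B3)"
    using similar_mat_four_block_0_ex[OF similar_mat_refl[OF sb(1)] B3(1) sb(2,1,4)] by auto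
  have B3c: "B3 \<in> carrier_mat n n"
    by (rule similar_mat_carrier[OF B3(1) sb(4)])
  have "upper_triangular (four_block_mat A1 B0 (0\<^sub>m n 1) B3)"
    by (rule upper_triangular_four_block[OF sb(1) B3c _ B3(2)]) (use sb(1) in auto)
  moreover have "similar_mat A (four_block_mat A1 B0 (0\<^sub>m n 1) B3)"
    using similar_mat_trans[OF sim] B0(2) sb(5) A0 by simp
  ultimately show ?case by blast
qed

lemma jordan_nf_exists_alg_closed:
  fixes A :: "'a :: alg_closed_field mat"
  assumes A: "A \<in> carrier_mat n n"
  shows "\<exists>n_as. jordan_nf A n_as"
proof -
  obtain B where B: "similar_mat A B" "upper_triangular B"
    using similar_upper_triangular[OF A] by auto
  then have "B \<in> carrier_mat n n"
    by (intro similar_mat_carrier[OF B(1) A])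
  from triangular_to_jnf_vector[OF this B(2)] show ?thesis
    using similar_mat_trans[OF B(1)] unfolding jordan_nf_def by auto
qed

text \<open>The dimensions of the generalised eigenspaces determine how many blocks of each size
  occur. Two different matrices are allowed because the final uniqueness argument delivers equal
  dimensions and no similarity.\<close>

lemma jordan_nf_mset_eq:
  fixes A :: "'a :: field mat"
  assumes A: "jordan_nf A n_as" and B: "jordan_nf B m_bs"
    and eq: "\<And>e k. dim_gen_eigenspace A e k = dim_gen_eigenspace B e k"
  shows "mset n_as = mset m_bs"
proof (rule multiset_eqI)
  fix ke :: "nat \<times> 'a"
  obtain k e where ke: "ke = (k, e)" by force
  show "count (mset n_as) ke = count (mset m_bs) ke"
  \<comment> \<open>The block counting formula holds for positive sizes, and a Jordan normal form
    contains no block of size 0.\<close>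
  proof (cases "k = 0")
    case True
    then have "ke \<notin> set n_as" "ke \<notin> set m_bs"
      using A B ke by (auto simp: jordan_nf_def image_iff)
    then show ?thesis by (metis count_mset_0_iff)
  next
    case False
    have "compute_nr_of_jordan_blocks A e k = compute_nr_of_jordan_blocks B e k"
      by (simp add: compute_nr_of_jordan_blocks_def eq)
    then show ?thesis
      using compute_nr_of_jordan_blocks[OF A False] compute_nr_of_jordan_blocks[OF B False]
      by (simp add: ke count_mset count_list_eq_length_filter)
  qed
qed

lemma jordan_nf_unique_mset:
  fixes A :: "'a :: field mat"
  assumes "jordan_nf A n_as" "jordan_nf A m_bs"
  shows "mset n_as = mset m_bs"
  using jordan_nf_mset_eq[OF assms] by simp

section \<open>Rearranging Jordan blocks\<close>

lemma similar_mat_swap_blocks: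
  fixes A B :: "'a :: comm_ring_1 mat"
  assumes A: "A \<in> carrier_mat n n" and B: "B \<in> carrier_mat m m"
  shows "similar_mat (four_block_mat A (0\<^sub>m n m) (0\<^sub>m m n) B) (four_block_mat B (0\<^sub>m m n) (0\<^sub>m n m) A)"
    (is "similar_mat ?X ?Y")
proof -
  let ?P = "four_block_mat (0\<^sub>m n m) (1\<^sub>m n) (1\<^sub>m m) (0\<^sub>m m n) :: 'a mat"
  let ?Q = "four_block_mat (0\<^sub>m m n) (1\<^sub>m m) (1\<^sub>m n) (0\<^sub>m n m) :: 'a mat"
  note z = zero_carrier_mat and o = one_carrier_mat
  have "?P * ?Q = 1\<^sub>m (n + m)"
    by (subst mult_four_block_mat[OF z o o z z o o z]) (auto intro!: eq_matI)
  moreover have "?Q * ?P = 1\<^sub>m (n + m)"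
    by (subst mult_four_block_mat[OF z o o z z o o z]) (auto intro!: eq_matI)
  moreover have "?P * ?Y * ?Q = ?X"
    by (subst mult_four_block_mat[OF z o o z B z z A], insert A B,
        subst mult_four_block_mat[of _ n m _ n _ m _ _ n _ m])
      (auto intro!: eq_matI)
  ultimately show ?thesis
    by (intro similar_matI[of _ _ ?P ?Q "n + m"]) (use A B in auto)
qed

lemma jordan_matrix_append:
  "jordan_matrix (xs @ ys) = diag_block_mat [jordan_matrix xs, jordan_matrix ys]"
  using jordan_matrix_concat_diag_block_mat[of "[xs, ys]"] by simp

lemma diag_block_mat_two:
  assumes "A \<in> carrier_mat n n" "B \<in> carrier_mat m m"
  shows "diag_block_mat [A, B] = four_block_mat A (0\<^sub>m n m) (0\<^sub>m m n) B"
proof -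
  have "four_block_mat B (0\<^sub>m m 0) (0\<^sub>m 0 m) (0\<^sub>m 0 0) = B"
    using assms by (intro eq_matI) auto
  then show ?thesis using assms by (simp add: Let_def)
qed

lemma jordan_matrix_append_four_block:
  "jordan_matrix (xs @ ys) = four_block_mat (jordan_matrix xs)
     (0\<^sub>m (sum_list (map fst xs)) (sum_list (map fst ys)))
     (0\<^sub>m (sum_list (map fst ys)) (sum_list (map fst xs))) (jordan_matrix ys)"
  unfolding jordan_matrix_append by (rule diag_block_mat_two) auto

lemma similar_diag_block_mat_two:
  assumes "similar_mat A A'" "similar_mat B B'"
  shows "similar_mat (diag_block_mat [A, B]) (diag_block_mat [A', B'])"
  using similar_diag_mat_block_mat[of "[(A, A'), (B, B')]"] assms by auto

text \<open>The tail is rearranged behind the leading block by the induction hypothesis; then the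
  leading block is swapped, as a single block, with everything that has to precede it.\<close>

lemma similar_jordan_matrix_mset:
  fixes xs ys :: "(nat \<times> 'a :: comm_ring_1) list"
  assumes "mset xs = mset ys"
  shows "similar_mat (jordan_matrix xs) (jordan_matrix ys)"
  using assms
proof (induction xs arbitrary: ys)
  case Nil
  then show ?case using similar_mat_refl[OF jordan_matrix_carrier[of "[]"]] by simp
next
  case (Cons x xs)
  then have "x \<in> set ys" by (metis list.set_intros(1) mset_eq_setD)
  then obtain us vs where ys: "ys = us @ x # vs" by (meson split_list)
  have refl: "similar_mat (jordan_matrix zs) (jordan_matrix zs)" for zs :: "(nat \<times> 'a) list"
    by (rule similar_mat_refl) (rule jordan_matrix_carrier)
  have "similar_mat (jordan_matrix ([x] @ xs)) (jordan_matrix ([x] @ (us @ vs)))"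
    unfolding jordan_matrix_append[of "[x]"]
    by (rule similar_diag_block_mat_two[OF refl Cons.IH]) (use Cons.prems ys in simp)
  moreover have "similar_mat (jordan_matrix (([x] @ us) @ vs)) (jordan_matrix ((us @ [x]) @ vs))"
    unfolding jordan_matrix_append[of _ vs]
  proof (rule similar_diag_block_mat_two[OF _ refl])
    show "similar_mat (jordan_matrix ([x] @ us)) (jordan_matrix (us @ [x]))"
      unfolding jordan_matrix_append_four_block by (rule similar_mat_swap_blocks) auto
  qed
  ultimately show ?case using similar_mat_trans by (simp add: ys) blast
qed

text \<open>The diagonal of the Jordan matrix, hence the eigenvalues listed with algebraic
  multiplicity.\<close>

definition block_eigenvalues :: "(nat \<times> 'a) list \<Rightarrow> 'a list" where
  "block_eigenvalues n_as = concat (map (\<lambda>(n, a). replicate n a) n_as)"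

lemma length_block_eigenvalues: "length (block_eigenvalues n_as) = sum_list (map fst n_as)"
  by (induction n_as) (auto simp: block_eigenvalues_def)

lemma count_block_eigenvalues:
  "count_list (block_eigenvalues n_as) a = sum_list (map fst (filter (\<lambda>na. snd na = a) n_as))"
proof -
  have "count_list (replicate n b) a = (if b = a then n else 0)" for n b
    by (induction n) auto
  then show ?thesis by (induction n_as) (auto simp: block_eigenvalues_def)
qed

section \<open>Eigenvalues and multiplicities from the block list\<close>

lemma eigenvalue_iff_alg_mult:
  fixes A :: "'a :: field mat"
  assumes A: "A \<in> carrier_mat n n"
  shows "eigenvalue A a \<longleftrightarrow> alg_mult A a \<noteq> 0"
proof -
  have "char_poly A \<noteq> 0" using degree_monic_char_poly[OF A] by auto
  then show ?thesis
    unfolding alg_mult_def eigenvalue_root_char_poly[OF A] by (simp add: order_root)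
qed

lemma jordan_nf_alg_mult:
  fixes A :: "'a :: field mat"
  assumes "jordan_nf A n_as"
  shows "alg_mult A a = count_list (block_eigenvalues n_as) a"
  using jordan_nf_order[OF assms] by (simp add: alg_mult_def count_block_eigenvalues)

lemma jordan_nf_carrier:
  assumes "jordan_nf A n_as"
  shows "A \<in> carrier_mat (sum_list (map fst n_as)) (sum_list (map fst n_as))"
proof -
  have "similar_mat A (jordan_matrix n_as)" using assms by (simp add: jordan_nf_def)
  from similar_mat_carrier[OF similar_mat_sym[OF this] jordan_matrix_carrier] show ?thesis .
qed

text \<open>Algebraic multiplicity is the count in the block diagonal, and it is 0 off the spectrum.
  Statements about eigenvalues with multiplicity thus become equalities of multisets, the form in
  which they are permuted and compared below.\<close>

lemma eigenvalue_list_iff: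
  fixes A :: "'a :: field mat"
  assumes jnf: "jordan_nf A n_as"
  shows "eigenvalue_list A es \<longleftrightarrow> mset es = mset (block_eigenvalues n_as)"
proof
  note A = jordan_nf_carrier[OF jnf]
  assume es: "eigenvalue_list A es"
  show "mset es = mset (block_eigenvalues n_as)"
  proof (rule multiset_eqI)
    fix a
    have "count_list es a = alg_mult A a"
    proof (cases "eigenvalue A a")
      case False
      then have "a \<notin> set es" using es by (auto simp: eigenvalue_list_def)
      then show ?thesis using False eigenvalue_iff_alg_mult[OF A] by (simp add: count_list_0_iff)
    qed (use es in \<open>auto simp: eigenvalue_list_def\<close>)
    then show "count (mset es) a = count (mset (block_eigenvalues n_as)) a"
      by (simp add: jordan_nf_alg_mult[OF jnf] count_mset)
  qed
next
  note A = jordan_nf_carrier[OF jnf]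
  assume es: "mset es = mset (block_eigenvalues n_as)"
  have cnt: "count_list es a = alg_mult A a" for a
    using arg_cong[OF es, of "\<lambda>M. count M a"] by (simp add: jordan_nf_alg_mult[OF jnf] count_mset)
  have "length es = dim_row A"
    using mset_eq_length[OF es] A by (simp add: length_block_eigenvalues)
  moreover have "a \<in> set es \<longleftrightarrow> eigenvalue A a" for a
    using cnt[of a] eigenvalue_iff_alg_mult[OF A, of a] by (metis count_list_0_iff)
  ultimately show "eigenvalue_list A es"
    using cnt by (auto simp: eigenvalue_list_def)
qed

lemma jordan_matrix_nf: "0 \<notin> fst ` set n_as \<Longrightarrow> jordan_nf (jordan_matrix n_as) n_as"
  by (simp add: jordan_nf_def similar_mat_refl[OF jordan_matrix_carrier])

section \<open>Nilpotent and invertible matrices in terms of their blocks\<close>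

lemma nilpotent_similar:
  fixes A :: "'a :: comm_ring_1 mat"
  assumes sim: "similar_mat A B" and nil: "nilpotent_mat A"
  shows "nilpotent_mat B"
proof -
  obtain n where AB: "A \<in> carrier_mat n n" "B \<in> carrier_mat n n" using similar_matD[OF sim] by auto
  obtain m where m: "A ^\<^sub>m m = 0\<^sub>m n n" using nil AB by (auto simp: nilpotent_mat_def)
  obtain P Q where "similar_mat_wit B A P Q"
    using similar_mat_sym[OF sim] by (auto simp: similar_mat_def)
  note wit = similar_mat_witD2[OF AB(2) this] and pow = similar_mat_wit_pow_id[OF this, of m]
  have "B ^\<^sub>m m = 0\<^sub>m n n" unfolding pow m using wit by simp
  then show ?thesis using AB by (auto simp: nilpotent_mat_def)
qed

text \<open>A vanishing power applied to an eigenvector forces the eigenvalue to be 0; conversely,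
  blocks with eigenvalue 0 are killed by any exponent that is at least their size.\<close>

lemma nilpotent_jordan_matrix_iff:
  fixes n_as :: "(nat \<times> 'a :: field) list"
  assumes "0 \<notin> fst ` set n_as"
  shows "nilpotent_mat (jordan_matrix n_as) \<longleftrightarrow> (\<forall>na\<in>set n_as. snd na = 0)"
proof
  let ?n = "sum_list (map fst n_as)" and ?J = "jordan_matrix n_as"
  assume "nilpotent_mat ?J"
  then obtain m where m: "?J ^\<^sub>m m = 0\<^sub>m ?n ?n" by (auto simp: nilpotent_mat_def)
  show "\<forall>na\<in>set n_as. snd na = 0"
  proof
    fix na assume na: "na \<in> set n_as"
    define a where "a = snd na"
    have "fst na > 0" using na assms by (metis gr0I image_eqI)
    then have "a \<in> set (block_eigenvalues n_as)"
      using na by (cases na) (force simp: block_eigenvalues_def a_def)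
    then have "alg_mult ?J a \<noteq> 0"
      using jordan_nf_alg_mult[OF jordan_matrix_nf[OF assms]] by (simp add: count_list_0_iff)
    then have "eigenvalue ?J a" using eigenvalue_iff_alg_mult[OF jordan_matrix_carrier] by blast
    then obtain v where v: "eigenvector ?J v a" by (auto simp: eigenvalue_def)
    from eigenvector_pow[OF jordan_matrix_carrier this, of m]
    have "0\<^sub>m ?n ?n *\<^sub>v v = a ^ m \<cdot>\<^sub>v v" using m by simp
    moreover have vc: "v \<in> carrier_vec ?n" "v \<noteq> 0\<^sub>v ?n" using v by (auto simp: eigenvector_def)
    moreover have "0\<^sub>m ?n ?n *\<^sub>v v = 0\<^sub>v ?n" using vc by (intro eq_vecI) auto
    ultimately have "a ^ m = 0" by (auto simp: vec_eq_iff)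
    then show "snd na = 0" by (simp add: a_def)
  qed
next
  assume z: "\<forall>na\<in>set n_as. snd na = 0"
  show "nilpotent_mat (jordan_matrix n_as)"
  proof -
    let ?r = "sum_list (map fst n_as)"
    have zero: "diag_block_mat (map (\<lambda>(n, a). 0\<^sub>m n n) m_as) =
        (0\<^sub>m (sum_list (map fst m_as)) (sum_list (map fst m_as)) :: 'a mat)" for m_as :: "(nat \<times> 'a) list"
      by (induction m_as) (auto simp: Let_def intro!: eq_matI)
    have "jordan_block n a ^\<^sub>m ?r = 0\<^sub>m n n" if "(n, a) \<in> set n_as" for n a
    proof -
      \<comment> \<open>The total size bounds every block size, so a single exponent serves all
        blocks.\<close>
      have "n \<le> ?r" using that member_le_sum_list[of n "map fst n_as"] by force
      moreover have "a = 0" using z that by force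
      ultimately show ?thesis by (auto simp: jordan_block_zero_pow intro!: eq_matI)
    qed
    then have m: "map (\<lambda>(n, a). jordan_block n a ^\<^sub>m ?r) n_as = map (\<lambda>(n, a). 0\<^sub>m n n) n_as"
      by (intro map_cong) auto
    have "jordan_matrix n_as ^\<^sub>m ?r = 0\<^sub>m ?r ?r"
      by (simp only: jordan_matrix_pow m zero)
    then show ?thesis by (auto simp: nilpotent_mat_def)
  qed
qed

lemma eigenvalue_zero_iff_det:
  fixes A :: "'a :: field mat"
  assumes A: "A \<in> carrier_mat n n"
  shows "eigenvalue A 0 \<longleftrightarrow> det A = 0"
proof -
  have "0 \<cdot>\<^sub>v v = 0\<^sub>v n" if "v \<in> carrier_vec n" for v :: "'a vec"
    using that by auto
  then show ?thesis
    unfolding det_0_iff_vec_prod_zero_field[OF A] eigenvalue_def eigenvector_def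
    using A by auto
qed

lemma invertible_mat_iff_eigenvalue:
  fixes A :: "'a :: field mat"
  assumes A: "A \<in> carrier_mat n n"
  shows "invertible_mat A \<longleftrightarrow> \<not> eigenvalue A 0"
proof
  assume "invertible_mat A"
  then obtain B where B: "A * B = 1\<^sub>m (dim_row A)" "B * A = 1\<^sub>m (dim_row B)"
    unfolding invertible_mat_def inverts_mat_def by auto
  have "dim_col B = n" using arg_cong[OF B(1), of dim_col] A by simp
  moreover have "dim_row B = n" using arg_cong[OF B(2), of dim_col] A by simp
  ultimately have "B \<in> carrier_mat n n" by (intro carrier_matI)
  then have "det A * det B = 1" using det_mult[OF A] B A by (metis carrier_matD(1) det_one)
  then show "\<not> eigenvalue A 0" unfolding eigenvalue_zero_iff_det[OF A] by auto
next
  assume "\<not> eigenvalue A 0"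
  then have "det A \<noteq> 0" unfolding eigenvalue_zero_iff_det[OF A] .
  from det_non_zero_imp_unit[OF A this, unfolded Units_def, of "()"]
  obtain Q where "Q \<in> carrier_mat n n" "Q * A = 1\<^sub>m n" "A * Q = 1\<^sub>m n"
    by (auto simp: ring_mat_def)
  then show "invertible_mat A"
    using A unfolding invertible_mat_def inverts_mat_def by auto
qed

lemma jordan_nf_eigenvalue_iff:
  fixes A :: "'a :: field mat"
  assumes jnf: "jordan_nf A n_as"
  shows "eigenvalue A a \<longleftrightarrow> a \<in> snd ` set n_as"
proof -
  have "eigenvalue A a \<longleftrightarrow> a \<in> set (block_eigenvalues n_as)"
    unfolding eigenvalue_iff_alg_mult[OF jordan_nf_carrier[OF jnf]] jordan_nf_alg_mult[OF jnf]
    by (simp add: count_list_0_iff)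
  also have "\<dots> \<longleftrightarrow> a \<in> snd ` set n_as"
  proof -
    have "set (block_eigenvalues n_as) = (\<Union>na\<in>set n_as. set (replicate (fst na) (snd na)))"
      by (simp add: block_eigenvalues_def case_prod_beta)
    also have "\<dots> = (\<Union>na\<in>set n_as. {snd na})"
    proof (rule SUP_cong[OF refl])
      fix na assume "na \<in> set n_as"
      then have "fst na \<noteq> 0" using jnf by (metis jordan_nf_def image_eqI)
      then show "set (replicate (fst na) (snd na)) = {snd na}" by simp
    qed
    finally show ?thesis by auto
  qed
  finally show ?thesis .
qed

lemma jordan_nf_invertible_iff:
  fixes A :: "'a :: field mat"
  assumes "jordan_nf A n_as"
  shows "invertible_mat A \<longleftrightarrow> 0 \<notin> snd ` set n_as"
  using invertible_mat_iff_eigenvalue[OF jordan_nf_carrier[OF assms]]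
    jordan_nf_eigenvalue_iff[OF assms] by simp

lemma jordan_nf_nilpotent_iff:
  fixes A :: "'a :: field mat"
  assumes "jordan_nf A n_as"
  shows "nilpotent_mat A \<longleftrightarrow> (\<forall>na\<in>set n_as. snd na = 0)"
  using assms nilpotent_similar similar_mat_sym nilpotent_jordan_matrix_iff
  unfolding jordan_nf_def by metis

section \<open>Nonsingular and nilpotent parts\<close>

lemma nonsingular_nilpotent_parts_jordan:
  fixes A :: "'a :: field mat"
  assumes "nonsingular_nilpotent_parts A As Ao" "jordan_nf As m_as" "jordan_nf Ao n_as"
  shows "jordan_nf A (m_as @ n_as)" "0 \<notin> snd ` set m_as" "\<forall>na\<in>set n_as. snd na = 0"
proof -
  have "similar_mat A (diag_block_mat [As, Ao])"
    using assms(1) by (simp add: nonsingular_nilpotent_parts_def)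
  moreover have "similar_mat (diag_block_mat [As, Ao]) (jordan_matrix (m_as @ n_as))"
    unfolding jordan_matrix_append
    by (rule similar_diag_block_mat_two) (use assms(2,3) in \<open>auto simp: jordan_nf_def\<close>)
  ultimately have "similar_mat A (jordan_matrix (m_as @ n_as))"
    by (rule similar_mat_trans)
  then show "jordan_nf A (m_as @ n_as)" using assms(2,3) by (auto simp: jordan_nf_def)
  show "0 \<notin> snd ` set m_as" "\<forall>na\<in>set n_as. snd na = 0"
    using assms jordan_nf_invertible_iff[OF assms(2)] jordan_nf_nilpotent_iff[OF assms(3)]
    by (auto simp: nonsingular_nilpotent_parts_def)
qed

text \<open>Sorting the blocks by whether the eigenvalue is 0 only permutes them, so the sorted
  Jordan matrix is still similar to \<open>A\<close>.\<close>

lemma nonsingular_nilpotent_parts_exist: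
  fixes A :: "'a :: field mat"
  assumes "jordan_nf A n_as"
  defines "m_as \<equiv> filter (\<lambda>na. snd na \<noteq> 0) n_as" and "o_as \<equiv> filter (\<lambda>na. snd na = 0) n_as"
  shows "nonsingular_nilpotent_parts A (jordan_matrix m_as) (jordan_matrix o_as)"
    "jordan_nf (jordan_matrix m_as) m_as" "jordan_nf (jordan_matrix o_as) o_as"
proof -
  show m: "jordan_nf (jordan_matrix m_as) m_as" and o: "jordan_nf (jordan_matrix o_as) o_as"
    using assms(1) unfolding m_as_def o_as_def
    by (auto intro!: jordan_matrix_nf simp: jordan_nf_def[of A])
  have "mset (m_as @ o_as) = mset n_as"
    by (simp add: m_as_def o_as_def)
  from similar_jordan_matrix_mset[OF this[symmetric]]
  have "similar_mat A (diag_block_mat [jordan_matrix m_as, jordan_matrix o_as])"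
    using assms(1) similar_mat_trans unfolding jordan_nf_def jordan_matrix_append by metis
  then show "nonsingular_nilpotent_parts A (jordan_matrix m_as) (jordan_matrix o_as)"
    using jordan_nf_invertible_iff[OF m] jordan_nf_nilpotent_iff[OF o]
    by (auto simp: nonsingular_nilpotent_parts_def m_as_def o_as_def)
qed

section \<open>Entries of a Jordan matrix and normalisation of the translation\<close>

lemma jordan_matrix_diag:
  "i < sum_list (map fst n_as) \<Longrightarrow> jordan_matrix n_as $$ (i,i) = block_eigenvalues n_as ! i"
proof (induction n_as arbitrary: i)
  case (Cons na n_as)
  obtain n a where na: "na = (n, a)" by force
  have "block_eigenvalues (na # n_as) = replicate n a @ block_eigenvalues n_as"
    by (simp add: block_eigenvalues_def na)
  with Cons show ?case
    by (auto simp: na jordan_matrix_Cons nth_append)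
qed simp

text \<open>A nonzero entry lies inside one block, on or above its diagonal. This is what later
  makes the diagonal and the off-diagonal part commute.\<close>

lemma jordan_matrix_offdiag:
  assumes "i < sum_list (map fst n_as)" "j < sum_list (map fst n_as)" "jordan_matrix n_as $$ (i,j) \<noteq> 0"
  shows "i \<le> j" "block_eigenvalues n_as ! i = block_eigenvalues n_as ! j"
proof -
  show "i \<le> j" using jordan_matrix_upper_triangular assms by (metis not_le)
  show "block_eigenvalues n_as ! i = block_eigenvalues n_as ! j"
    using assms
  proof (induction n_as arbitrary: i j)
    case (Cons na n_as)
    obtain n a where na: "na = (n, a)" by force
    have "block_eigenvalues (na # n_as) = replicate n a @ block_eigenvalues n_as"
      by (simp add: block_eigenvalues_def na)
    with Cons show ?case
      by (auto simp: na jordan_matrix_Cons nth_append split: if_splits)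
  qed simp
qed

text \<open>The rows equal to rows of the identity are the last rows of the blocks with eigenvalue 1.\<close>

lemma jordan_block_translate:
  fixes a :: "'a :: field"
  assumes "b \<in> carrier_vec n"
  shows "\<exists>p\<in>carrier_vec n. \<forall>i<n. (jordan_block n a *\<^sub>v p + b - p) $ i = 0 \<or>
      row (jordan_block n a) i = unit_vec n i"
proof -
  have mult: "(jordan_block n a *\<^sub>v p) $ i = a * p $ i + (if Suc i < n then p $ Suc i else 0)"
    if "p \<in> carrier_vec n" "i < n" for p i
  proof -
    have "jordan_block n a $$ (i,j) * p $ j =
        (if i = j then a * p $ i else 0) + (if Suc i = j then p $ Suc i else 0)" if "j < n" for j
      using that \<open>i < n\<close> by auto
    then have "(\<Sum>j = 0..<n. jordan_block n a $$ (i,j) * p $ j) =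
        (\<Sum>j = 0..<n. (if i = j then a * p $ i else 0) + (if Suc i = j then p $ Suc i else 0))"
      by (intro sum.cong) auto
    moreover have "(jordan_block n a *\<^sub>v p) $ i = (\<Sum>j = 0..<n. jordan_block n a $$ (i,j) * p $ j)"
      using that by (simp add: scalar_prod_def)
    ultimately show ?thesis using that by (simp add: sum.distrib)
  qed
  show ?thesis
  proof (cases "a = 1")
    case True
    \<comment> \<open>For eigenvalue 1 row \<open>i\<close> of the displacement is
      \<open>p $ Suc i + b $ i\<close>, except in the last row, where no next entry is available.
      Each entry of \<open>b\<close> dictates the next entry of \<open>p\<close>, and
      \<open>p $ 0\<close> is free.\<close>
    define p where "p = vec n (\<lambda>i. if i = 0 then 0 else - b $ (i - 1))"
    have p: "p \<in> carrier_vec n" by (simp add: p_def)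
    have "(jordan_block n a *\<^sub>v p + b - p) $ i = 0 \<or> row (jordan_block n a) i = unit_vec n i"
      if "i < n" for i
    proof (cases "Suc i < n")
      case True
      then show ?thesis using \<open>a = 1\<close> that p assms mult[OF p that]
        by (simp add: p_def)
    next
      case False
      then show ?thesis using \<open>a = 1\<close> that
        by (intro disjI2 eq_vecI) auto
    qed
    with p show ?thesis by blast
  next
    case False
    \<comment> \<open>Back substitution, dividing by \<open>a - 1\<close>. The sentinel
      \<open>q m = 0\<close> stands for the missing entry beyond the last row, so all rows obey one
      recursion; the induction adds rows at the front.\<close>
    have "\<exists>q. q m = 0 \<and> (\<forall>i<m. (a - 1) * q i + q (Suc i) + c i = 0)" for m and c :: "nat \<Rightarrow> 'a"
    proof (induction m arbitrary: c)
      case (Suc m)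
      from Suc[of "\<lambda>i. c (Suc i)"] obtain q
        where q: "q m = 0" "\<forall>i<m. (a - 1) * q i + q (Suc i) + c (Suc i) = 0" by auto
      define r where "r i = (case i of 0 \<Rightarrow> - (q 0 + c 0) / (a - 1) | Suc i \<Rightarrow> q i)" for i
      have "(a - 1) * r i + r (Suc i) + c i = 0" if "i < Suc m" for i
        using q that False by (cases i) (auto simp: r_def)
      with q show ?case by (intro exI[of _ r]) (auto simp: r_def)
    qed auto
    then obtain q where q: "q n = 0" "\<forall>i<n. (a - 1) * q i + q (Suc i) + b $ i = 0" by blast
    define p where "p = vec n q"
    have p: "p \<in> carrier_vec n" by (simp add: p_def)
    have "(jordan_block n a *\<^sub>v p + b - p) $ i = 0" if "i < n" for i
    proof -
      have "(if Suc i < n then p $ Suc i else 0) = q (Suc i)"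
        using q that by (cases "Suc i = n") (auto simp: p_def)
      then show ?thesis using that p assms mult[OF p that] q(2)
        by (auto simp: p_def algebra_simps)
    qed
    with p show ?thesis by blast
  qed
qed

lemma jordan_matrix_translate:
  fixes n_as :: "(nat \<times> 'a :: field) list"
  assumes "b \<in> carrier_vec (sum_list (map fst n_as))"
  shows "\<exists>p\<in>carrier_vec (sum_list (map fst n_as)). \<forall>i<sum_list (map fst n_as).
      (jordan_matrix n_as *\<^sub>v p + b - p) $ i = 0 \<or>
      row (jordan_matrix n_as) i = unit_vec (sum_list (map fst n_as)) i"
  using assms
proof (induction n_as arbitrary: b)
  case Nil
  then show ?case by (intro bexI[of _ "0\<^sub>v 0"]) auto
next
  case (Cons na n_as)
  obtain n a where na: "na = (n, a)" by force
  let ?m = "sum_list (map fst n_as)" and ?B = "jordan_block n a" and ?J = "jordan_matrix n_as"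
  have J: "?J \<in> carrier_mat ?m ?m" by simp
  have b: "b \<in> carrier_vec (n + ?m)" using Cons.prems by (simp add: na)
  define c d where "c = vec_first b n" and "d = vec_last b ?m"
  have c: "c \<in> carrier_vec n" and d: "d \<in> carrier_vec ?m" by (auto simp: c_def d_def)
  have bcd: "b = c @\<^sub>v d" unfolding c_def d_def using b by (rule vec_first_last_append[symmetric])
  obtain p where p: "p \<in> carrier_vec n" "\<And>i. i < n \<Longrightarrow> (?B *\<^sub>v p + c - p) $ i = 0 \<or>
      row ?B i = unit_vec n i"
    using jordan_block_translate[OF c] by blast
  obtain q where q: "q \<in> carrier_vec ?m" "\<And>i. i < ?m \<Longrightarrow> (?J *\<^sub>v q + d - q) $ i = 0 \<or>
      row ?J i = unit_vec ?m i"
    using Cons.IH[OF d] by blast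
  have mult: "jordan_matrix (na # n_as) *\<^sub>v (p @\<^sub>v q) = ?B *\<^sub>v p @\<^sub>v ?J *\<^sub>v q"
    unfolding na jordan_matrix_Cons by (rule mult_mat_vec_split) (use p q in auto)
  have "(jordan_matrix (na # n_as) *\<^sub>v (p @\<^sub>v q) + b - (p @\<^sub>v q)) $ i = 0 \<or>
      row (jordan_matrix (na # n_as)) i = unit_vec (n + ?m) i" if i: "i < n + ?m" for i
  proof (cases "i < n")
    case True
    from p(2)[OF True] show ?thesis
    proof
      assume "(?B *\<^sub>v p + c - p) $ i = 0"
      then have "(jordan_matrix (na # n_as) *\<^sub>v (p @\<^sub>v q) + b - (p @\<^sub>v q)) $ i = 0"
        unfolding mult bcd using True p q c d i by simp
      then show ?thesis ..
    next
      assume r: "row ?B i = unit_vec n i"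
      have "jordan_matrix (na # n_as) $$ (i, j) = unit_vec (n + ?m) i $ j" if "j < n + ?m" for j
        using arg_cong[OF r, of "\<lambda>v :: 'a vec. v $ j"] True that
        by (cases "j < n") (auto simp: na jordan_matrix_Cons)
      then have "row (jordan_matrix (na # n_as)) i = unit_vec (n + ?m) i"
        using i by (intro eq_vecI) (auto simp: na)
      then show ?thesis ..
    qed
  next
    case False
    then have "i - n < ?m" using i by simp
    from q(2)[OF this] show ?thesis
    proof
      assume "(?J *\<^sub>v q + d - q) $ (i - n) = 0"
      then have "(jordan_matrix (na # n_as) *\<^sub>v (p @\<^sub>v q) + b - (p @\<^sub>v q)) $ i = 0"
        unfolding mult bcd using False p q c d i by simp
      then show ?thesis ..
    next
      assume r: "row ?J (i - n) = unit_vec ?m (i - n)"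
      have "jordan_matrix (na # n_as) $$ (i, j) = unit_vec (n + ?m) i $ j" if "j < n + ?m" for j
        using arg_cong[OF r, of "\<lambda>v :: 'a vec. v $ (j - n)"] False that i
        by (cases "j < n") (auto simp: na jordan_matrix_Cons)
      then have "row (jordan_matrix (na # n_as)) i = unit_vec (n + ?m) i"
        using i by (intro eq_vecI) (auto simp: na)
      then show ?thesis ..
    qed
  qed
  moreover have "p @\<^sub>v q \<in> carrier_vec (n + ?m)" using p q by simp
  ultimately show ?case by (intro bexI[of _ "p @\<^sub>v q"]) (auto simp: na)
qed

section \<open>Comparing kernel dimensions\<close>

lemma kernel_dim_mono:
  fixes X Y :: "'a :: field mat"
  assumes X: "X \<in> carrier_mat n n" and Y: "Y \<in> carrier_mat n n"
    and sub: "mat_kernel X \<subseteq> mat_kernel Y"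
  shows "kernel_dim X \<le> kernel_dim Y"
proof -
  interpret X: kernel n n X by (unfold_locales, rule X)
  interpret Y: kernel n n Y by (unfold_locales, rule Y)
  obtain B where B: "finite B" "X.basis B" using kernel_basis_exists[OF X] by auto
  then have BX: "B \<subseteq> mat_kernel X" and li: "\<not> X.lin_dep B"
    by (auto simp: X.Ker.basis_def)
  then have "\<not> Y.lin_dep B"
    using sub X.lindep_same[OF BX] Y.lindep_same[of B] by auto
  moreover obtain C where "finite C" "Y.basis C" using kernel_basis_exists[OF Y] by auto
  then have "Y.Ker.fin_dim"
    unfolding Y.Ker.basis_def Y.Ker.fin_dim_def by blast
  ultimately have "card B \<le> Y.dim"
    using Y.Ker.li_le_dim(2)[of B] sub BX by auto
  then show ?thesis using X.Ker.dim_basis[OF B] by simp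
qed

text \<open>\<open>M\<close> carries the kernel of \<open>X\<close> into that of \<open>Y\<close>,
  so the former lies in the kernel of \<open>Y * M\<close>, whose dimension is that of the kernel of
  \<open>Y\<close> because \<open>M\<close> is invertible.\<close>

lemma kernel_dim_le:
  fixes X Y M :: "'a :: field mat"
  assumes X: "X \<in> carrier_mat n n" and Y: "Y \<in> carrier_mat n n"
    and M: "M \<in> carrier_mat n n" "M' \<in> carrier_mat n n" "M * M' = 1\<^sub>m n"
    and sub: "\<And>v. v \<in> carrier_vec n \<Longrightarrow> X *\<^sub>v v = 0\<^sub>v n \<Longrightarrow> Y *\<^sub>v (M *\<^sub>v v) = 0\<^sub>v n"
  shows "kernel_dim X \<le> kernel_dim Y"
proof -
  have YM: "Y * M \<in> carrier_mat n n" using Y M by simp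
  have "mat_kernel X \<subseteq> mat_kernel (Y * M)"
    unfolding mat_kernel[OF X] mat_kernel[OF YM] using sub Y M by auto
  from kernel_dim_mono[OF X YM this] show ?thesis
    using mat_kernel_dim_mult_eq_right[OF Y M(1,2,3)] X Y M(1)
    by (simp add: kernel_dim_def)
qed

section \<open>Existence of the canonical form\<close>

lemma shift_canonical_op_index:
  assumes "x \<in> carrier_vec (Suc (length \<alpha>s) + m)" "J \<in> carrier_mat m m" "i < Suc (length \<alpha>s) + m"
  shows "shift_canonical_op \<alpha>s J x $ i =
    (if i < Suc (length \<alpha>s) then (if i = 0 then x $ 0 + 1 else \<alpha>s ! (i - 1) * x $ i)
     else (\<Sum>j = 0..<m. J $$ (i - Suc (length \<alpha>s), j) * x $ (Suc (length \<alpha>s) + j)))"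
  using assms by (auto simp: shift_canonical_op_def vec_last_def scalar_prod_def)

lemma shift_canonical_op_carrier:
  assumes "J \<in> carrier_mat m m" "n = Suc (length \<alpha>s) + m"
  shows "shift_canonical_op \<alpha>s J x \<in> carrier_vec n"
  using assms by (intro carrier_vecI) (simp add: shift_canonical_op_def)

text \<open>Conjugation by a monomial matrix: permute coordinates by \<open>\<sigma>\<close> and
  rescale by \<open>c\<close>. It is stated coordinatewise for arbitrary maps so that
  \<open>shift_canonical_op\<close> can be the target directly.\<close>

lemma biregularly_conjugate_monomial:
  fixes c :: "nat \<Rightarrow> 'a :: field" and f g :: "'a vec \<Rightarrow> 'a vec"
  assumes \<sigma>: "bij_betw \<sigma> {..<n} {..<n}" and c: "\<And>i. i < n \<Longrightarrow> c i \<noteq> 0"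
    and f: "\<And>x. x \<in> carrier_vec n \<Longrightarrow> f x \<in> carrier_vec n"
    and g: "\<And>x. x \<in> carrier_vec n \<Longrightarrow> g x \<in> carrier_vec n"
    and eq: "\<And>(x :: 'a vec) i. x \<in> carrier_vec n \<Longrightarrow> i < n \<Longrightarrow>
        g (vec n (\<lambda>i. c i * x $ \<sigma> i)) $ i = c i * f x $ \<sigma> i"
  shows "biregularly_conjugate n f g"
proof -
  define k where "k x = vec n (\<lambda>i. c i * x $ \<sigma> i)" for x :: "'a vec"
  define \<tau> where "\<tau> = inv_into {..<n} \<sigma>"
  define h where "h y = vec n (\<lambda>i. inverse (c (\<tau> i)) * y $ \<tau> i)" for y :: "'a vec"
  have \<sigma>n: "\<sigma> i < n" if "i < n" for i using \<sigma> that by (auto simp: bij_betw_def)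
  have \<tau>n: "\<tau> i < n" if "i < n" for i
    using bij_betw_inv_into[OF \<sigma>] that by (auto simp: bij_betw_def \<tau>_def)
  have \<sigma>\<tau>: "\<sigma> (\<tau> i) = i" if "i < n" for i
    using bij_betw_inv_into_right[OF \<sigma>] that by (simp add: \<tau>_def)
  have \<tau>\<sigma>: "\<tau> (\<sigma> i) = i" if "i < n" for i
    using bij_betw_inv_into_left[OF \<sigma>] that by (simp add: \<tau>_def)
  have k: "polynomial_map n k"
    unfolding polynomial_map_iff
  proof (intro conjI ballI allI impI)
    fix i assume "i < n"
    then show "poly_fun n (\<lambda>x. k x $ i)"
      using \<sigma>n by (simp add: k_def poly_fun_mult poly_fun_const poly_fun_coord)
  qed (simp add: k_def)
  have h: "polynomial_map n h"
    unfolding polynomial_map_iff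
  proof (intro conjI ballI allI impI)
    fix i assume "i < n"
    then show "poly_fun n (\<lambda>x. h x $ i)"
      using \<tau>n by (simp add: h_def poly_fun_mult poly_fun_const poly_fun_coord)
  qed (simp add: h_def)
  have kh: "k (h x) = x" if "x \<in> carrier_vec n" for x
    using that c \<sigma>n \<tau>\<sigma> by (intro eq_vecI) (auto simp: k_def h_def)
  have hk: "h (k x) = x" if "x \<in> carrier_vec n" for x
    using that c \<tau>n \<sigma>\<tau> by (intro eq_vecI) (auto simp: k_def h_def)
  show ?thesis
  proof (rule biregularly_conjugateI[OF h k kh hk f])
    fix x :: "'a vec" assume x: "x \<in> carrier_vec n"
    have hx: "h x \<in> carrier_vec n" by (rule polynomial_map_carrier[OF h x])
    show "g x = k (f (h x))"
    proof (rule eq_vecI)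
      fix i assume "i < dim_vec (k (f (h x)))"
      then have i: "i < n" by (simp add: k_def)
      have "g (k (h x)) $ i = c i * f (h x) $ \<sigma> i" using eq[OF hx i] by (simp add: k_def)
      then show "g x $ i = k (f (h x)) $ i" using i kh[OF x] by (simp add: k_def)
    qed (use g[OF x] in \<open>simp add: k_def\<close>)
  qed
qed

text \<open>The eigenvalue 1 may occur several times, but the clock coordinate \<open>l\<close>
  itself must become coordinate 0. An arbitrary matching is corrected by exchanging 0 with the
  preimage \<open>m\<close> of \<open>l\<close>; this is harmless because positions 0 and
  \<open>m\<close> both hold \<open>a\<close>.\<close>

lemma permutation_fixing_head:
  assumes "mset (a # xs) = mset ys" "l < length ys" "ys ! l = a"
  obtains \<sigma> where "bij_betw \<sigma> {..<length ys} {..<length ys}" "\<sigma> 0 = l"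
    "\<And>i. i < length ys \<Longrightarrow> (a # xs) ! i = ys ! \<sigma> i"
proof -
  let ?n = "length ys"
  have len: "length (a # xs) = ?n" using mset_eq_length[OF assms(1)] .
  obtain f where f: "bij_betw f {..<length (a # xs)} {..<?n}" "\<forall>i<length (a # xs). (a # xs) ! i = ys ! f i"
    using permutation_Ex_bij[OF assms(1)] by blast
  define m where "m = inv_into {..<?n} f l"
  have f': "bij_betw f {..<?n} {..<?n}" using f(1) len by simp
  have m: "m < ?n" "f m = l"
    using bij_betw_inv_into[OF f'] bij_betw_inv_into_right[OF f'] assms(2)
    by (auto simp: m_def bij_betw_def)
  let ?t = "Transposition.transpose 0 m"
  have n0: "0 < ?n" using assms(2) by linarith
  have "bij_betw ?t {..<?n} {..<?n}"
    using n0 m(1) by (intro bij_betw_byWitness[of _ ?t]) (auto simp: Transposition.transpose_def)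
  from bij_betw_trans[OF this f'] have 1: "bij_betw (f \<circ> ?t) {..<?n} {..<?n}" .
  have 2: "(f \<circ> ?t) 0 = l" using m by simp
  have "(a # xs) ! i = ys ! (f \<circ> ?t) i" if "i < ?n" for i
  proof -
    have "?t i < ?n" using that m n0 by (auto simp: Transposition.transpose_def)
    then have "ys ! (f \<circ> ?t) i = (a # xs) ! ?t i" using f(2) len by simp
    moreover have "(a # xs) ! m = a" using f(2) len m assms(3) by simp
    ultimately show ?thesis by (auto simp: Transposition.transpose_def)
  qed
  with 1 2 show thesis by (rule that)
qed

lemma conjugate_to_shift_canonical:
  fixes n_as m_as :: "(nat \<times> 'a :: field_char_0) list"
  defines "J \<equiv> jordan_matrix (m_as @ n_as)" and "n \<equiv> sum_list (map fst (m_as @ n_as))"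
  assumes nz: "0 \<notin> snd ` set m_as" and z: "\<forall>na\<in>set n_as. snd na = 0"
    and b: "b \<in> carrier_vec n" and nofp: "\<not> has_fixed_point n (affine_op J b)"
    and ms: "mset (1 # \<alpha>s) = mset (block_eigenvalues m_as)"
  shows "biregularly_conjugate n (affine_op J b) (shift_canonical_op \<alpha>s (jordan_matrix n_as))"
proof -
  let ?k = "sum_list (map fst m_as)" and ?m = "sum_list (map fst n_as)"
  let ?d = "block_eigenvalues (m_as @ n_as)"
  have n: "n = ?k + ?m" by (simp add: n_def)
  have J: "J \<in> carrier_mat n n" unfolding J_def n_def by (rule jordan_matrix_carrier)
  have d_app: "?d = block_eigenvalues m_as @ block_eigenvalues n_as"
    by (simp add: block_eigenvalues_def)
  have d_nz: "?d ! i \<noteq> 0" if "i < ?k" for i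
  proof -
    have "?d ! i \<in> set (block_eigenvalues m_as)"
      using that by (simp add: d_app nth_append length_block_eigenvalues)
    also have "\<dots> \<subseteq> snd ` set m_as" by (force simp: block_eigenvalues_def)
    finally show ?thesis using nz by metis
  qed
  have d_z: "?d ! i = 0" if "i < n" "\<not> i < ?k" for i
  proof -
    have "?d ! i \<in> set (block_eigenvalues n_as)"
      using that by (simp add: d_app nth_append length_block_eigenvalues n)
    also have "\<dots> \<subseteq> snd ` set n_as" by (force simp: block_eigenvalues_def)
    finally show ?thesis using z by auto
  qed
  have J_diag: "J $$ (i,i) = ?d ! i" if "i < n" for i
    unfolding J_def by (rule jordan_matrix_diag) (use that n_def in simp)
  have J_off: "i \<le> j" "?d ! i = ?d ! j" if "i < n" "j < n" "J $$ (i,j) \<noteq> 0" for i j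
    using jordan_matrix_offdiag[of i "m_as @ n_as" j] that by (auto simp: J_def n_def)
  \<comment> \<open>Nonzero entries join equal diagonal values, and being nonzero is what separates
    the first \<open>?k\<close> diagonal values from the rest. So \<open>J\<close> does not mix the
    two index ranges.\<close>
  have J_same: "i < ?k \<longleftrightarrow> j < ?k" if "i < n" "j < n" "J $$ (i,j) \<noteq> 0" for i j
    using J_off(2)[OF that] d_nz d_z that by metis

  obtain p where p: "p \<in> carrier_vec n"
    "\<And>i. i < n \<Longrightarrow> (J *\<^sub>v p + b - p) $ i = 0 \<or> row J i = unit_vec n i"
    using jordan_matrix_translate[of b "m_as @ n_as"] b unfolding J_def n_def by auto
  define c where "c = J *\<^sub>v p + b - p"
  have c: "c \<in> carrier_vec n" using J b p by (simp add: c_def)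
  have c_row: "J $$ (i,j) = (if j = i then 1 else 0)" if "i < n" "c $ i \<noteq> 0" "j < n" for i j
  proof -
    have "row J i = unit_vec n i" using p(2)[OF that(1)] that(2) by (simp add: c_def)
    from arg_cong[OF this, of "\<lambda>v :: 'a vec. v $ j"] show ?thesis using that J by simp
  qed
  have c_d: "?d ! i = 1" if "i < n" "c $ i \<noteq> 0" for i
    using c_row[OF that that(1)] J_diag[OF that(1)] by simp
  have c_k: "i < ?k" if "i < n" "c $ i \<noteq> 0" for i
    using c_d[OF that] d_z[OF that(1)] by force
  \<comment> \<open>Zero displacement would make \<open>p\<close> a fixed point. Any nonzero entry
    may then serve as the clock; the other entries of \<open>c\<close> are absorbed by the
    flow.\<close>
  have "c \<noteq> 0\<^sub>v n"
  proof
    assume "c = 0\<^sub>v n"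
    have "affine_op J b p = p"
    proof (rule eq_vecI)
      fix i assume "i < dim_vec p"
      then have "i < n" using p by simp
      with \<open>c = 0\<^sub>v n\<close> have "c $ i = 0" by simp
      with \<open>i < n\<close> J b p show "affine_op J b p $ i = p $ i" by (simp add: c_def affine_op_def)
    qed (use J b p in \<open>simp add: affine_op_def\<close>)
    then show False using nofp p(1) by (auto simp: has_fixed_point_def)
  qed
  moreover have "c = 0\<^sub>v n" if "\<And>l. l < n \<Longrightarrow> c $ l = 0"
    using that c by (intro eq_vecI) auto
  ultimately obtain l where l: "l < n" "c $ l \<noteq> 0" by metis
  have lk: "l < ?k" by (rule c_k[OF l])

  \<comment> \<open>The factorisation is \<open>J = D * (1 + N)\<close>. On the nonsingular rows
    \<open>D\<close> is the diagonal and \<open>N\<close> is the rest divided by it; the nilpotent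
    rows stay entirely in \<open>D\<close>.\<close>
  define D where "D = mat n n (\<lambda>(i,j). if i < ?k then (if i = j then ?d ! i else 0) else J $$ (i,j))"
  define N where "N = mat n n (\<lambda>(i,j). if i < ?k \<and> i \<noteq> j then J $$ (i,j) / ?d ! i else 0)"
  have D: "D \<in> carrier_mat n n" and N: "N \<in> carrier_mat n n" by (auto simp: D_def N_def)
  have DN_index: "(D * N) $$ (i,j) = (if i < ?k \<and> i \<noteq> j then J $$ (i,j) else 0)"
    if "i < n" "j < n" for i j
  proof -
    have "D $$ (i,m) * N $$ (m,j) = (if m = i then (if i < ?k \<and> i \<noteq> j then J $$ (i,j) else 0) else 0)"
      if "m < n" for m
      using that \<open>i < n\<close> \<open>j < n\<close> d_nz[of i] J_same[of i m] by (auto simp: D_def N_def)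
    then have "(\<Sum>m = 0..<n. D $$ (i,m) * N $$ (m,j)) =
        (\<Sum>m = 0..<n. if m = i then (if i < ?k \<and> i \<noteq> j then J $$ (i,j) else 0) else 0)"
      by (intro sum.cong) auto
    then show ?thesis using that D N by (simp add: scalar_prod_def)
  qed
  \<comment> \<open>Multiplying on the right uses the diagonal entry of the column instead of that
    of the row. They coincide wherever \<open>J\<close> is nonzero, so the product is the same as
    for \<open>D * N\<close>.\<close>
  have ND_index: "(N * D) $$ (i,j) = (if i < ?k \<and> i \<noteq> j then J $$ (i,j) else 0)"
    if "i < n" "j < n" for i j
  proof -
    have "N $$ (i,m) * D $$ (m,j) = (if m = j then (if i < ?k \<and> i \<noteq> j then J $$ (i,j) else 0) else 0)"
      if "m < n" for m
    proof (cases "i < ?k \<and> i \<noteq> m \<and> J $$ (i,m) \<noteq> 0")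
      case True
      then have "m < ?k" "?d ! i = ?d ! m" using J_same J_off(2) that \<open>i < n\<close> by blast+
      then show ?thesis using True that \<open>i < n\<close> \<open>j < n\<close> d_nz[of m] by (auto simp: D_def N_def)
    next
      case False
      then show ?thesis using that \<open>i < n\<close> \<open>j < n\<close> by (auto simp: D_def N_def)
    qed
    then have "(\<Sum>m = 0..<n. N $$ (i,m) * D $$ (m,j)) =
        (\<Sum>m = 0..<n. if m = j then (if i < ?k \<and> i \<noteq> j then J $$ (i,j) else 0) else 0)"
      by (intro sum.cong) auto
    then show ?thesis using that D N by (simp add: scalar_prod_def)
  qed
  have DN: "D * N = N * D"
    using D N DN_index ND_index by (intro eq_matI) (auto simp del: index_mult_mat(1))
  \<comment> \<open>\<open>c\<close> is supported on indices whose diagonal value is 1, and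
    \<open>D\<close> is diagonal there.\<close>
  have Dc: "D *\<^sub>v c = c"
  proof (rule eq_vecI)
    fix i assume "i < dim_vec c"
    then have i: "i < n" using c by simp
    have "D $$ (i,j) * c $ j = (if j = i then c $ i else 0)" if j: "j < n" for j
    proof (cases "c $ j = 0")
      case False
      then have "j < ?k" "?d ! j = 1" using c_k c_d j by auto
      then show ?thesis using i j J_same[OF i j] by (auto simp: D_def)
    qed auto
    then have "(\<Sum>j = 0..<n. D $$ (i,j) * c $ j) = (\<Sum>j = 0..<n. if j = i then c $ i else 0)"
      by (intro sum.cong) auto
    then show "(D *\<^sub>v c) $ i = c $ i" using i D c by (simp add: scalar_prod_def)
  qed (use D c in simp)

  interpret F: unipotent_flow n D N c l
  proof
    show "D \<in> carrier_mat n n" "N \<in> carrier_mat n n" "c \<in> carrier_vec n" "D * N = N * D" "D *\<^sub>v c = c"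
      "l < n" "c $ l \<noteq> 0" by fact+
    show "i < j" if "i < n" "j < n" "N $$ (i,j) \<noteq> 0" for i j
    proof -
      have "J $$ (i,j) \<noteq> 0" "i \<noteq> j" using that by (auto simp: N_def split: if_splits)
      then show ?thesis using J_off(1)[OF that(1,2)] by simp
    qed
    show "N $$ (l,j) = 0" if "j < n" for j
      using that l c_row[OF l that] by (auto simp: N_def)
    show "D $$ (l,j) = (if j = l then 1 else 0)" if "j < n" for j
      using that l lk c_d[OF l] by (auto simp: D_def)
    show "D $$ (i,l) = (if i = l then 1 else 0)" if "i < n" for i
      using that l lk c_d[OF l] J_same[OF that l(1)] by (auto simp: D_def)
  qed

  \<comment> \<open>Because \<open>D\<close> fixes \<open>c\<close>, the translation can be moved
    inside \<open>D\<close>, next to the unipotent factor.\<close>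
  have c_decomp: "affine_op J c x = D *\<^sub>v F.U x" if x: "x \<in> carrier_vec n" for x
  proof -
    have "D *\<^sub>v F.U x = D *\<^sub>v (x + N *\<^sub>v x) + D *\<^sub>v c"
      unfolding F.U_def by (rule mult_add_distrib_mat_vec[OF D]) (use x N c in auto)
    also have "D *\<^sub>v (x + N *\<^sub>v x) = D *\<^sub>v x + D *\<^sub>v (N *\<^sub>v x)"
      by (rule mult_add_distrib_mat_vec[OF D]) (use x N in auto)
    also have "D *\<^sub>v (N *\<^sub>v x) = (D * N) *\<^sub>v x"
      by (rule assoc_mult_mat_vec[OF D N x, symmetric])
    also have "D *\<^sub>v x + (D * N) *\<^sub>v x = (D + D * N) *\<^sub>v x"
      by (rule add_mult_distrib_mat_vec[symmetric]) (use D N x in auto)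
    also have "D + D * N = J"
    proof (rule eq_matI)
      fix i j assume "i < dim_row J" "j < dim_col J"
      then have ij: "i < n" "j < n" using J by auto
      then have "(D + D * N) $$ (i,j) = D $$ (i,j) + (D * N) $$ (i,j)" using D N by simp
      then show "(D + D * N) $$ (i,j) = J $$ (i,j)"
        unfolding DN_index[OF ij] using ij J_diag[of i] by (auto simp: D_def)
    qed (use D N J in auto)
    finally show ?thesis by (simp add: Dc affine_op_def)
  qed
  have 1: "biregularly_conjugate n (affine_op J b) (affine_op J c)"
    unfolding c_def by (rule biregularly_conjugate_translate[OF J b p(1)])
  have 2: "biregularly_conjugate n (affine_op J b) (\<lambda>x. D *\<^sub>v F.U x)"
    by (rule biregularly_conjugate_cong[OF 1]) (simp add: c_decomp)
  let ?w = "c $ l \<cdot>\<^sub>v unit_vec n l"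
  have 3: "biregularly_conjugate n (affine_op J b) (affine_op D ?w)"
    by (rule biregularly_conjugate_trans[OF 2 F.conjugate_to_semisimple]) (rule affine_op_carrier[OF J b])

  have len: "Suc (length \<alpha>s) = ?k"
    using mset_eq_length[OF ms] by (simp add: length_block_eigenvalues)
  have "block_eigenvalues m_as ! l = 1"
    using c_d[OF l] lk by (simp add: d_app nth_append length_block_eigenvalues)
  then obtain \<sigma>0 where \<sigma>0: "bij_betw \<sigma>0 {..<?k} {..<?k}" "\<sigma>0 0 = l"
    "\<And>i. i < ?k \<Longrightarrow> (1 # \<alpha>s) ! i = block_eigenvalues m_as ! \<sigma>0 i"
    using permutation_fixing_head[OF ms, of l] lk by (auto simp: length_block_eigenvalues)
  \<comment> \<open>Only the nonsingular coordinates are permuted, bringing the clock to the front;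
    the scalar in slot 0 rescales its step from \<open>c $ l\<close> to 1.\<close>
  define \<sigma> where "\<sigma> i = (if i < ?k then \<sigma>0 i else i)" for i
  define s where "s i = (if i = 0 then inverse (c $ l) else 1)" for i :: nat
  have \<sigma>0k: "\<sigma>0 i < ?k" if "i < ?k" for i using \<sigma>0(1) that by (auto simp: bij_betw_def)
  have bij: "bij_betw \<sigma> {..<n} {..<n}"
  proof -
    have "bij_betw \<sigma> {..<?k} {..<?k}"
      using \<sigma>0(1) by (rule bij_betw_cong[THEN iffD1, rotated]) (auto simp: \<sigma>_def)
    moreover have "bij_betw \<sigma> {?k..<n} {?k..<n}"
      by (rule bij_betw_cong[THEN iffD1, of _ id]) (auto simp: \<sigma>_def)
    ultimately have "bij_betw \<sigma> ({..<?k} \<union> {?k..<n}) ({..<?k} \<union> {?k..<n})"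
      by (rule bij_betw_combine) auto
    moreover have "{..<?k} \<union> {?k..<n} = {..<n}" using n by auto
    ultimately show ?thesis by simp
  qed
  have Jo: "jordan_matrix n_as \<in> carrier_mat ?m ?m" by simp
  have nk: "n = Suc (length \<alpha>s) + ?m" using n len by simp
  have 4: "biregularly_conjugate n (affine_op D ?w) (shift_canonical_op \<alpha>s (jordan_matrix n_as))"
  proof (rule biregularly_conjugate_monomial[OF bij, of s])
    show "s i \<noteq> 0" for i using l by (simp add: s_def)
    show "affine_op D ?w x \<in> carrier_vec n" if "x \<in> carrier_vec n" for x
      by (rule affine_op_carrier[OF D _ that]) simp
    show "shift_canonical_op \<alpha>s (jordan_matrix n_as) x \<in> carrier_vec n" for x
      by (rule shift_canonical_op_carrier[OF Jo nk])
    fix x :: "'a vec" and i assume x: "x \<in> carrier_vec n" and i: "i < n"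
    let ?y = "vec n (\<lambda>i. s i * x $ \<sigma> i)"
    have y: "?y \<in> carrier_vec (Suc (length \<alpha>s) + ?m)" unfolding nk[symmetric] by simp
    have Dx: "affine_op D ?w x $ j = (\<Sum>m = 0..<n. D $$ (j,m) * x $ m) + (if j = l then c $ l else 0)"
      if "j < n" for j
      using that D x l by (auto simp: affine_op_def scalar_prod_def)
    show "shift_canonical_op \<alpha>s (jordan_matrix n_as) ?y $ i = s i * affine_op D ?w x $ \<sigma> i"
    proof (cases "i < ?k")
      case True
      have \<sigma>i: "\<sigma> i = \<sigma>0 i" "\<sigma>0 i < ?k" "\<sigma>0 i < n"
        using True \<sigma>0k[OF True] n by (auto simp: \<sigma>_def)
      have "(\<Sum>m = 0..<n. D $$ (\<sigma>0 i,m) * x $ m) = (\<Sum>m = 0..<n. if m = \<sigma>0 i then ?d ! \<sigma>0 i * x $ \<sigma>0 i else 0)"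
        using \<sigma>i by (intro sum.cong) (auto simp: D_def)
      also have "\<dots> = (1 # \<alpha>s) ! i * x $ \<sigma>0 i"
        using \<sigma>i \<sigma>0(3)[OF True] by (simp add: d_app nth_append length_block_eigenvalues)
      finally have "affine_op D ?w x $ \<sigma> i = (1 # \<alpha>s) ! i * x $ \<sigma>0 i + (if \<sigma>0 i = l then c $ l else 0)"
        using Dx[of "\<sigma> i"] \<sigma>i by simp
      moreover have "\<sigma>0 i = l \<longleftrightarrow> i = 0"
      proof -
        have "0 < ?k" using True by simp
        then show ?thesis using bij_betw_imp_inj_on[OF \<sigma>0(1)] \<sigma>0(2) True
          by (auto dest: inj_onD)
      qed
      ultimately show ?thesis
        using shift_canonical_op_index[OF y Jo, of i] i True l \<sigma>i nk len
        by (cases i) (auto simp: s_def distrib_left)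
    next
      case False
      have \<sigma>i: "\<sigma> i = i" using False by (simp add: \<sigma>_def)
      have s1: "s j = 1" if "\<not> j < ?k" for j using that lk by (auto simp: s_def)
      have "(\<Sum>m = 0..<n. D $$ (i,m) * x $ m) = (\<Sum>m = ?k..<?k + ?m. D $$ (i,m) * x $ m)"
      proof (rule sum.mono_neutral_right)
        show "\<forall>m\<in>{0..<n} - {?k..<?k + ?m}. D $$ (i,m) * x $ m = 0"
        proof
          fix m assume "m \<in> {0..<n} - {?k..<?k + ?m}"
          then have "m < ?k" "m < n" using n by auto
          then have "J $$ (i,m) = 0" using J_same[OF i, of m] False by blast
          then show "D $$ (i,m) * x $ m = 0" using False i \<open>m < n\<close> by (simp add: D_def)
        qed
      qed (use n in auto)
      also have "\<dots> = (\<Sum>m = 0..<?m. D $$ (i, ?k + m) * x $ (?k + m))"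
        using sum.shift_bounds_nat_ivl[of "\<lambda>m. D $$ (i,m) * x $ m" 0 ?k ?m] by (simp add: add.commute)
      also have "\<dots> = (\<Sum>m = 0..<?m. jordan_matrix n_as $$ (i - ?k, m) * x $ (?k + m))"
      proof (rule sum.cong[OF refl])
        fix m assume "m \<in> {0..<?m}"
        then have "D $$ (i, ?k + m) = jordan_matrix n_as $$ (i - ?k, m)"
          using False i n by (auto simp: D_def J_def jordan_matrix_append_four_block)
        then show "D $$ (i, ?k + m) * x $ (?k + m) = jordan_matrix n_as $$ (i - ?k, m) * x $ (?k + m)"
          by simp
      qed
      also have "\<dots> = (\<Sum>m = 0..<?m. jordan_matrix n_as $$ (i - ?k, m) * ?y $ (?k + m))"
        by (rule sum.cong) (auto simp: n \<sigma>_def s1)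
      finally show ?thesis
        using shift_canonical_op_index[OF y Jo, of i] Dx[OF i] i False lk nk len s1[OF False] \<sigma>i
        by (auto simp del: index_vec)
    qed
  qed
  show ?thesis
    by (rule biregularly_conjugate_trans[OF 3 4]) (rule affine_op_carrier[OF J b])
qed

section \<open>Uniqueness of the canonical form\<close>

lemma poly_fun_curve:
  fixes \<phi> :: "'a :: comm_ring_1 vec \<Rightarrow> 'a"
  assumes "poly_fun n \<phi>"
  shows "\<exists>q. \<forall>t. \<phi> (curve n \<gamma> t) = poly q t"
  using gradient(2)[OF assms] unfolding has_gradient_def by blast

text \<open>The substitution of \<open>t + 1\<close> preserves the leading coefficient, so a nonzero
  \<open>q\<close> forces \<open>e = a\<close>, and the common nonzero factor cancels.\<close>

lemma poly_shift_eigen: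
  fixes q :: "'a :: field_char_0 poly"
  assumes "\<And>t. e * poly q (t + 1) = a * poly q t" "e \<noteq> 0"
  shows "poly q (t + 1) = poly q t"
proof (cases "q = 0")
  case False
  have "Polynomial.smult e (pcompose q [:1, 1:]) = Polynomial.smult a q"
    using assms(1) by (simp add: poly_eq_poly_eq_iff[symmetric] fun_eq_iff poly_pcompose add.commute)
  from arg_cong[OF this, of lead_coeff]
  have "e * lead_coeff (pcompose q [:1, 1:]) = a * lead_coeff q"
    unfolding lead_coeff_smult .
  moreover have "lead_coeff (pcompose q [:1, 1:]) = lead_coeff q"
    by (subst lead_coeff_comp) auto
  ultimately have "e * lead_coeff q = a * lead_coeff q" by simp
  with False have "e = a" by simp
  then show ?thesis using assms by simp
qed simp

lemma mult_mat_vec_sum: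
  assumes "A \<in> carrier_mat n n" "x \<in> carrier_vec n" "i < n"
  shows "(A *\<^sub>v x) $ i = (\<Sum>j = 0..<n. A $$ (i,j) * x $ j)"
  using assms by (simp add: scalar_prod_def)

lemma char_matrix_zero:
  assumes "C \<in> carrier_mat n n"
  shows "char_matrix C 0 = (C :: 'a :: field mat)"
  using assms by (auto simp: char_matrix_def intro!: eq_matI)

lemma char_matrix_kernel:
  fixes C :: "'a :: field mat"
  assumes C: "C \<in> carrier_mat n n" and v: "v \<in> carrier_vec n"
  shows "char_matrix C e *\<^sub>v v = 0\<^sub>v n \<longleftrightarrow> C *\<^sub>v v = e \<cdot>\<^sub>v v"
proof -
  have "char_matrix C e *\<^sub>v v = C *\<^sub>v v - e \<cdot>\<^sub>v v"
  proof (rule eq_vecI)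
    fix i assume "i < dim_vec (C *\<^sub>v v - e \<cdot>\<^sub>v v)"
    then have i: "i < n" using v by simp
    have "(\<Sum>j = 0..<n. char_matrix C e $$ (i,j) * v $ j) =
        (\<Sum>j = 0..<n. C $$ (i,j) * v $ j - (if j = i then e * v $ i else 0))"
      using i C by (intro sum.cong) (auto simp: char_matrix_def algebra_simps)
    then show "(char_matrix C e *\<^sub>v v) $ i = (C *\<^sub>v v - e \<cdot>\<^sub>v v) $ i"
      using i C v mult_mat_vec_sum[OF char_matrix_closed[OF C] v i] mult_mat_vec_sum[OF C v i]
      by (simp add: sum_subtractf del: index_mult_mat_vec)
  qed (use C v in \<open>auto simp: char_matrix_def\<close>)
  then show ?thesis using C v by (auto simp: vec_eq_iff)
qed

text \<open>Condenses the conjugacy into a polynomial family of invertible matrices with a shifted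
  intertwining relation; from here on the comparison is linear algebra. \<open>M'\<close> is the
  Jacobian of the inverse map.\<close>

lemma jacobian_along_orbit:
  fixes A C :: "'a :: field_char_0 mat"
  assumes A: "A \<in> carrier_mat n n" and b: "b \<in> carrier_vec n"
    and C: "C \<in> carrier_mat n n" and n: "0 < n"
    and Ce: "C *\<^sub>v unit_vec n 0 = unit_vec n 0"
    and conj: "biregularly_conjugate n (affine_op A b) (affine_op C (unit_vec n 0))"
  obtains M M' :: "'a \<Rightarrow> 'a mat" where
    "\<And>t. M t \<in> carrier_mat n n" "\<And>t. M' t \<in> carrier_mat n n" "\<And>t. M t * M' t = 1\<^sub>m n"
    "\<And>t. M (t + 1) * C = A * M t"
    "\<And>i j. i < n \<Longrightarrow> j < n \<Longrightarrow> \<exists>q. \<forall>t. M t $$ (i,j) = poly q t"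
proof -
  obtain h k where h: "polynomial_map n h" and k: "polynomial_map n k"
    and kh: "\<And>x. x \<in> carrier_vec n \<Longrightarrow> k (h x) = x"
    and hk: "\<And>x. x \<in> carrier_vec n \<Longrightarrow> h (k x) = x"
    and g: "\<And>x. x \<in> carrier_vec n \<Longrightarrow> affine_op C (unit_vec n 0) x = k (affine_op A b (h x))"
    using biregularly_conjugateE[OF conj] by metis
  have eq: "h (affine_op C (unit_vec n 0) y) = affine_op A b (h y)" if "y \<in> carrier_vec n" for y
    using g[OF that] hk[OF affine_op_carrier[OF A b polynomial_map_carrier[OF h that]]] by simp
  define \<gamma> :: "nat \<Rightarrow> 'a poly" where "\<gamma> i = (if i = 0 then [:0, 1:] else 0)" for i
  have \<gamma>: "curve n \<gamma> t = t \<cdot>\<^sub>v unit_vec n 0" for t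
    by (intro eq_vecI) (auto simp: \<gamma>_def n)
  have step: "affine_op C (unit_vec n 0) (curve n \<gamma> t) = curve n \<gamma> (t + 1)" for t
  proof -
    have "C *\<^sub>v (t \<cdot>\<^sub>v unit_vec n 0) = t \<cdot>\<^sub>v (C *\<^sub>v unit_vec n 0)"
      by (rule mult_mat_vec[OF C]) simp
    then show ?thesis unfolding \<gamma> affine_op_def Ce
      by (intro eq_vecI) (auto simp: distrib_right)
  qed
  define M where "M t = jacobian n h (curve n \<gamma> t)" for t
  define M' where "M' t = jacobian n k (h (curve n \<gamma> t))" for t
  show thesis
  proof (rule that[of M M'])
    show "M t \<in> carrier_mat n n" "M' t \<in> carrier_mat n n" for t by (simp_all add: M_def M'_def)
    show "M t * M' t = 1\<^sub>m n" for t
      using jacobian_inverse[OF k h hk polynomial_map_carrier[OF h curve_carrier[of n \<gamma> t]]] kh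
      by (simp add: M_def M'_def)
    show "M (t + 1) * C = A * M t" for t
      using affine_conjugate_jacobian[OF A b C _ h eq curve_carrier[of n \<gamma> t]]
      by (simp add: M_def step)
    show "\<exists>q. \<forall>t. M t $$ (i,j) = poly q t" if "i < n" "j < n" for i j
    proof -
      have "poly_fun n (\<lambda>x. h x $ i)" using h that by (simp add: polynomial_map_iff)
      from poly_fun_curve[OF gradient(1)[OF this that(2)], of \<gamma>]
      show ?thesis using that by (simp add: M_def jacobian_def)
    qed
  qed
qed

text \<open>The intertwining relation telescopes to \<open>M (t + j) * C^j = A^j * M t\<close>, so
  \<open>M 0\<close> maps the kernel of a power of \<open>C\<close> into the kernel of the same
  power of \<open>A\<close>. For eigenvalue 0 the dependence of \<open>M\<close> on \<open>t\<close>
  is therefore harmless.\<close>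

lemma kernel_dim_pow_le:
  fixes A C :: "'a :: field mat"
  assumes A: "A \<in> carrier_mat n n" and C: "C \<in> carrier_mat n n"
    and M: "\<And>t. M t \<in> carrier_mat n n" "\<And>t. M' t \<in> carrier_mat n n" "\<And>t. M t * M' t = 1\<^sub>m n"
    and eq: "\<And>t :: 'a. M (t + 1) * C = A * M t"
  shows "kernel_dim (C ^\<^sub>m j) \<le> kernel_dim (A ^\<^sub>m j)"
proof -
  have Cj: "C ^\<^sub>m j \<in> carrier_mat n n" and Aj: "A ^\<^sub>m j \<in> carrier_mat n n" for j
    using A C by simp_all
  have pow: "M (t + of_nat j) * C ^\<^sub>m j = A ^\<^sub>m j * M t" for t j
  proof (induction j arbitrary: t)
    case 0
    then show ?case using A C M(1)[of t] by simp
  next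
    case (Suc j)
    have "M (t + of_nat (Suc j)) * C ^\<^sub>m Suc j = M ((t + 1) + of_nat j) * C ^\<^sub>m j * C"
      using assoc_mult_mat[OF M(1) Cj C] by (simp add: add_ac)
    also have "\<dots> = A ^\<^sub>m j * (M (t + 1) * C)"
      unfolding Suc by (rule assoc_mult_mat[OF Aj M(1) C])
    also have "\<dots> = A ^\<^sub>m Suc j * M t"
      unfolding eq using assoc_mult_mat[OF Aj A M(1)] by simp
    finally show ?case .
  qed
  show ?thesis
  proof (rule kernel_dim_le[OF Cj Aj M(1)[of 0] M(2)[of 0] M(3)])
    fix v :: "'a vec" assume v: "v \<in> carrier_vec n" "C ^\<^sub>m j *\<^sub>v v = 0\<^sub>v n"
    have "A ^\<^sub>m j *\<^sub>v (M 0 *\<^sub>v v) = M (0 + of_nat j) *\<^sub>v (C ^\<^sub>m j *\<^sub>v v)"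
      using assoc_mult_mat_vec[OF Aj M(1) v(1), of j 0]
        assoc_mult_mat_vec[OF M(1) Cj v(1), of "0 + of_nat j" j] pow[of 0 j] by simp
    also have "\<dots> = 0\<^sub>v n"
      unfolding v(2) by (rule eq_vecI) (use M(1)[of "0 + of_nat j"] in \<open>auto simp: scalar_prod_def\<close>)
    finally show "A ^\<^sub>m j *\<^sub>v (M 0 *\<^sub>v v) = 0\<^sub>v n" .
  qed
qed

text \<open>Diagonal rows of \<open>A\<close> give scalar recursions for the coordinates of
  \<open>M t *\<^sub>v v\<close>, which are constant in \<open>t\<close> by
  \<open>poly_shift_eigen\<close>; strictly triangular rows force their coordinates to
  vanish.\<close>

lemma eigenspace_dim_le:
  fixes A C :: "'a :: field_char_0 mat"
  assumes A: "A \<in> carrier_mat n n" and C: "C \<in> carrier_mat n n"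
    and M: "\<And>t. M t \<in> carrier_mat n n" "\<And>t. M' t \<in> carrier_mat n n" "\<And>t. M t * M' t = 1\<^sub>m n"
    and eq: "\<And>t :: 'a. M (t + 1) * C = A * M t"
    and poly: "\<And>i j. i < n \<Longrightarrow> j < n \<Longrightarrow> \<exists>q. \<forall>t. M t $$ (i,j) = poly q t"
    and A_diag: "\<And>i j. i < k \<Longrightarrow> i < n \<Longrightarrow> j < n \<Longrightarrow> A $$ (i,j) = (if j = i then a i else 0)"
    and A_strict: "\<And>i j. k \<le> i \<Longrightarrow> i < n \<Longrightarrow> j < n \<Longrightarrow> A $$ (i,j) \<noteq> 0 \<Longrightarrow> i < j"
    and e: "e \<noteq> 0"
  shows "kernel_dim (char_matrix C e) \<le> kernel_dim (char_matrix A e)"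
proof (rule kernel_dim_le[OF _ _ M(1)[of 0] M(2)[of 0] M(3)])
  fix v :: "'a vec" assume v: "v \<in> carrier_vec n" "char_matrix C e *\<^sub>v v = 0\<^sub>v n"
  have Cv: "C *\<^sub>v v = e \<cdot>\<^sub>v v" using v char_matrix_kernel[OF C v(1)] by simp
  define w where "w t = M t *\<^sub>v v" for t
  have w: "w t \<in> carrier_vec n" for t unfolding w_def by (rule mult_mat_vec_carrier[OF M(1) v(1)])
  have Aw: "A *\<^sub>v w t = e \<cdot>\<^sub>v w (t + 1)" for t
  proof -
    have "A *\<^sub>v w t = M (t + 1) *\<^sub>v (C *\<^sub>v v)"
      using assoc_mult_mat_vec[OF A M(1)[of t] v(1)] assoc_mult_mat_vec[OF M(1)[of "t + 1"] C v(1)] eq[of t]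
      by (simp add: w_def)
    then show ?thesis unfolding Cv using mult_mat_vec[OF M(1) v(1)] by (simp add: w_def)
  qed
  have row: "e * w (t + 1) $ i = (\<Sum>j = 0..<n. A $$ (i,j) * w t $ j)" if "i < n" for i t
    using arg_cong[OF Aw[of t], of "\<lambda>u :: 'a vec. u $ i"] that A w[of t] w[of "t + 1"]
    by (simp add: scalar_prod_def)
  \<comment> \<open>From the last row upwards: row \<open>i\<close> at time \<open>t - 1\<close>
    expresses \<open>e\<close> times coordinate \<open>i\<close> at time \<open>t\<close> through
    later coordinates, which already vanish at all times.\<close>
  have zero: "w t $ i = 0" if "k \<le> i" "i < n" for i t
    using that
  proof (induction "n - i" arbitrary: i t rule: less_induct)
    case less
    have "A $$ (i,j) * w (t - 1) $ j = 0" if "j < n" for j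
    proof (cases "A $$ (i,j) = 0")
      case False
      then have "i < j" using A_strict less.prems that by blast
      then show ?thesis using less.hyps[of j "t - 1"] less.prems that by simp
    qed simp
    then have "(\<Sum>j = 0..<n. A $$ (i,j) * w (t - 1) $ j) = 0" by (intro sum.neutral) auto
    then show ?case using row[OF less.prems(2), of "t - 1"] e by simp
  qed
  have "w (0 + 1) $ i = w 0 $ i" if i: "i < n" for i
  proof (cases "i < k")
    case True
    have "\<exists>q. \<forall>t. w t $ i = poly q t"
    proof -
      obtain q where q: "\<And>j. j < n \<Longrightarrow> \<forall>t. M t $$ (i,j) = poly (q j) t"
        using poly[OF i] by metis
      have "w t $ i = poly (\<Sum>j = 0..<n. Polynomial.smult (v $ j) (q j)) t" for t
        using i q v(1) M(1)[of t]
        by (auto simp: w_def scalar_prod_def poly_sum mult.commute intro!: sum.cong)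
      then show ?thesis by blast
    qed
    then obtain q where q: "\<And>t. w t $ i = poly q t" by blast
    have "(\<Sum>j = 0..<n. A $$ (i,j) * w t $ j) = (\<Sum>j = 0..<n. if j = i then a i * w t $ i else 0)" for t
      using A_diag[OF True i] by (intro sum.cong) auto
    then have "e * poly q (t + 1) = a i * poly q t" for t
      using row[OF i, of t] i q by simp
    from poly_shift_eigen[OF this e, of 0] show ?thesis by (simp only: q)
  next
    case False
    then show ?thesis using zero i by simp
  qed
  then have "w (0 + 1) = w 0" using w[of 0] w[of "0 + 1"] by (intro eq_vecI) auto
  then show "char_matrix A e *\<^sub>v (M 0 *\<^sub>v v) = 0\<^sub>v n"
    using char_matrix_kernel[OF A w[of 0], of e] Aw[of 0] by (simp add: w_def)
qed (use A C in auto)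

text \<open>The blocks of the linear part of a canonical operator: size 1 for each nonzero
  eigenvalue, including the leading 1 contributed by the shifted coordinate.\<close>

definition shift_blocks :: "'a :: one list \<Rightarrow> (nat \<times> 'a) list \<Rightarrow> (nat \<times> 'a) list" where
  "shift_blocks \<alpha>s n_as = map (Pair 1) (1 # \<alpha>s) @ n_as"

lemma sum_fst_Pair_1 [simp]: "sum_list (map (fst \<circ> Pair (Suc 0)) as) = length as"
  by (induction as) auto

lemma jordan_matrix_diagonal:
  "i < length as \<Longrightarrow> j < length as \<Longrightarrow>
    jordan_matrix (map (Pair (Suc 0)) as) $$ (i,j) = (if j = i then as ! i else 0)"
proof (induction as arbitrary: i j)
  case (Cons a as)
  then show ?case
    unfolding list.map jordan_matrix_Cons
    by (cases i; cases j) auto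
qed simp

lemma shift_blocks_index:
  assumes i: "i < length (1 # \<alpha>s)" and j: "j < length (1 # \<alpha>s) + sum_list (map fst n_as)"
  shows "jordan_matrix (shift_blocks \<alpha>s n_as) $$ (i,j) = (if j = i then (1 # \<alpha>s) ! i else 0)"
  using jordan_matrix_diagonal[of i "1 # \<alpha>s" j] i j
  unfolding shift_blocks_def jordan_matrix_append_four_block by (auto simp del: list.map)

lemma shift_blocks_index':
  assumes "length (1 # \<alpha>s) \<le> i" "i < length (1 # \<alpha>s) + sum_list (map fst n_as)"
    "j < length (1 # \<alpha>s) + sum_list (map fst n_as)"
  shows "jordan_matrix (shift_blocks \<alpha>s n_as) $$ (i,j) =
    (if j < length (1 # \<alpha>s) then 0
     else jordan_matrix n_as $$ (i - length (1 # \<alpha>s), j - length (1 # \<alpha>s)))"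
  using assms
  unfolding shift_blocks_def jordan_matrix_append_four_block by (auto simp del: list.map)

lemma shift_blocks_dim [simp]:
  "sum_list (map fst (shift_blocks \<alpha>s n_as)) = length (1 # \<alpha>s) + sum_list (map fst n_as)"
  unfolding shift_blocks_def map_append sum_list_append by (simp del: list.map)

lemma shift_canonical_op_affine:
  fixes \<alpha>s :: "'a :: field list"
  assumes n: "n = length (1 # \<alpha>s) + sum_list (map fst n_as)" and x: "x \<in> carrier_vec n"
  shows "shift_canonical_op \<alpha>s (jordan_matrix n_as) x =
    affine_op (jordan_matrix (shift_blocks \<alpha>s n_as)) (unit_vec n 0) x"
proof (rule eq_vecI)
  let ?A = "jordan_matrix (shift_blocks \<alpha>s n_as)" and ?m = "sum_list (map fst n_as)"
    and ?k = "length (1 # \<alpha>s)"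
  have A: "?A \<in> carrier_mat n n" using jordan_matrix_carrier[of "shift_blocks \<alpha>s n_as"]
    by (simp only: shift_blocks_dim n)
  fix i assume "i < dim_vec (affine_op ?A (unit_vec n 0) x)"
  then have i: "i < n" by (simp add: affine_op_def)
  have n0: "0 < n" using n by simp
  have rhs: "affine_op ?A (unit_vec n 0) x $ i = (\<Sum>j = 0..<n. ?A $$ (i,j) * x $ j) + (if i = 0 then 1 else 0)"
    using i n0 mult_mat_vec_sum[OF A x i] A by (simp add: affine_op_def del: index_mult_mat_vec)
  have x': "x \<in> carrier_vec (Suc (length \<alpha>s) + ?m)" using x n by simp
  note lhs = shift_canonical_op_index[OF x' jordan_matrix_carrier, of i]
  show "shift_canonical_op \<alpha>s (jordan_matrix n_as) x $ i = affine_op ?A (unit_vec n 0) x $ i"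
  proof (cases "i < ?k")
    case True
    have "(\<Sum>j = 0..<n. ?A $$ (i,j) * x $ j) = (\<Sum>j = 0..<n. if j = i then (1 # \<alpha>s) ! i * x $ i else 0)"
      by (rule sum.cong[OF refl]) (use shift_blocks_index[OF True, of _ n_as] n in auto)
    also have "\<dots> = (1 # \<alpha>s) ! i * x $ i" using i by simp
    finally show ?thesis using lhs rhs True i n by (cases i) auto
  next
    case False
    have "(\<Sum>j = 0..<n. ?A $$ (i,j) * x $ j) = (\<Sum>j = ?k..<?k + ?m. ?A $$ (i,j) * x $ j)"
      using shift_blocks_index'[of \<alpha>s i n_as] False i n
      by (intro sum.mono_neutral_right) auto
    also have "\<dots> = (\<Sum>j = 0..<?m. ?A $$ (i, ?k + j) * x $ (?k + j))"
      using sum.shift_bounds_nat_ivl[of "\<lambda>j. ?A $$ (i,j) * x $ j" 0 ?k ?m] by (simp add: add.commute)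
    also have "\<dots> = (\<Sum>j = 0..<?m. jordan_matrix n_as $$ (i - ?k, j) * x $ (?k + j))"
      using shift_blocks_index'[of \<alpha>s i n_as] False i n
      by (intro sum.cong[OF refl]) simp
    finally show ?thesis using lhs rhs False i n by simp
  qed
qed (use n in \<open>simp add: shift_canonical_op_def affine_op_def\<close>)

lemma is_shift_canonicalD:
  assumes "is_shift_canonical n \<alpha>s n_as"
  shows "n = length (1 # \<alpha>s) + sum_list (map fst n_as)" "\<forall>na\<in>set n_as. snd na = (0 :: 'a :: field)"
    "0 \<notin> set \<alpha>s" "jordan_nf (jordan_matrix (shift_blocks \<alpha>s n_as)) (shift_blocks \<alpha>s n_as)"
proof -
  show "n = length (1 # \<alpha>s) + sum_list (map fst n_as)" "0 \<notin> set \<alpha>s"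
    using assms by (simp_all add: is_shift_canonical_def)
  have z: "0 \<notin> fst ` set n_as" using assms by (simp add: is_shift_canonical_def)
  show "\<forall>na\<in>set n_as. snd na = (0 :: 'a :: field)"
    using assms nilpotent_jordan_matrix_iff[OF z] by (simp add: is_shift_canonical_def)
  show "jordan_nf (jordan_matrix (shift_blocks \<alpha>s n_as)) (shift_blocks \<alpha>s n_as)"
    by (rule jordan_matrix_nf) (use z in \<open>auto simp: shift_blocks_def\<close>)
qed

text \<open>All blocks with nonzero eigenvalue have size 1, so higher powers enlarge nothing and
  comparing ordinary eigenspaces suffices.\<close>

lemma dim_gen_eigenspace_shift_blocks:
  fixes e :: "'a :: field"
  assumes "\<forall>na\<in>set n_as. snd na = 0" "e \<noteq> 0" "k \<noteq> 0"
  shows "dim_gen_eigenspace (jordan_matrix (shift_blocks \<alpha>s n_as)) e k =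
    dim_gen_eigenspace (jordan_matrix (shift_blocks \<alpha>s n_as)) e 1"
proof -
  have "map (min k) (map fst [(n, e')\<leftarrow>shift_blocks \<alpha>s n_as. e' = e]) =
      map (min 1) (map fst [(n, e')\<leftarrow>shift_blocks \<alpha>s n_as. e' = e])"
    using assms by (auto simp: shift_blocks_def)
  then show ?thesis by (simp only: dim_gen_eigenspace_jordan_matrix)
qed

text \<open>For \<open>e = 0\<close> the generalised eigenspaces are kernels of powers, covered by
  \<open>kernel_dim_pow_le\<close>; for \<open>e \<noteq> 0\<close> the first power decides, covered
  by \<open>eigenspace_dim_le\<close>. The opposite inequality comes from the inverse
  conjugacy.\<close>

lemma dim_gen_eigenspace_shift_le:
  fixes \<alpha>s \<beta>s :: "'a :: field_char_0 list"
  assumes \<alpha>: "is_shift_canonical n \<alpha>s n_as" and \<beta>: "is_shift_canonical n \<beta>s m_as"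
    and conj: "biregularly_conjugate n (shift_canonical_op \<alpha>s (jordan_matrix n_as))
      (shift_canonical_op \<beta>s (jordan_matrix m_as))"
  shows "dim_gen_eigenspace (jordan_matrix (shift_blocks \<beta>s m_as)) e k \<le>
    dim_gen_eigenspace (jordan_matrix (shift_blocks \<alpha>s n_as)) e k"
proof -
  let ?A = "jordan_matrix (shift_blocks \<alpha>s n_as)" and ?C = "jordan_matrix (shift_blocks \<beta>s m_as)"
  note A1 = is_shift_canonicalD[OF \<alpha>] and C1 = is_shift_canonicalD[OF \<beta>]
  have A: "?A \<in> carrier_mat n n"
    using jordan_matrix_carrier[of "shift_blocks \<alpha>s n_as"] by (simp only: shift_blocks_dim A1(1)[symmetric])
  have C: "?C \<in> carrier_mat n n"
    using jordan_matrix_carrier[of "shift_blocks \<beta>s m_as"] by (simp only: shift_blocks_dim C1(1)[symmetric])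
  have n: "0 < n" using A1(1) by simp
  have Ce: "?C *\<^sub>v unit_vec n 0 = unit_vec n 0"
  proof (rule eq_vecI)
    fix i assume "i < dim_vec (unit_vec n 0 :: 'a vec)"
    then have i: "i < n" by simp
    then show "(?C *\<^sub>v unit_vec n 0) $ i = unit_vec n 0 $ i"
      using shift_blocks_index[of i \<beta>s 0 m_as] shift_blocks_index'[of \<beta>s i m_as 0] C1(1) n
      by (cases "i < length (1 # \<beta>s)") auto
  qed (use C1(1) in simp)
  have cA: "affine_op ?A (unit_vec n 0) x = shift_canonical_op \<alpha>s (jordan_matrix n_as) x"
    if "x \<in> carrier_vec n" for x using shift_canonical_op_affine[OF A1(1) that] by simp
  have cC: "affine_op ?C (unit_vec n 0) x = shift_canonical_op \<beta>s (jordan_matrix m_as) x"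
    if "x \<in> carrier_vec n" for x using shift_canonical_op_affine[OF C1(1) that] by simp
  \<comment> \<open>Both maps are exchanged for functions that agree with them on
    \<open>carrier_vec n\<close>, so the same conjugating pair works.\<close>
  have conj': "biregularly_conjugate n (affine_op ?A (unit_vec n 0)) (affine_op ?C (unit_vec n 0))"
  proof -
    obtain h k where hk: "polynomial_map n h" "polynomial_map n k"
      "\<And>x. x \<in> carrier_vec n \<Longrightarrow> k (h x) = x"
      "\<And>x. x \<in> carrier_vec n \<Longrightarrow> h (k x) = x"
      "\<And>x. x \<in> carrier_vec n \<Longrightarrow> shift_canonical_op \<beta>s (jordan_matrix m_as) x =
        k (shift_canonical_op \<alpha>s (jordan_matrix n_as) (h x))"
      using biregularly_conjugateE[OF conj] by metis
    show ?thesis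
      by (rule biregularly_conjugateI[OF hk(1,2,3,4) affine_op_carrier[OF A unit_vec_carrier]])
        (use hk(5) cA cC polynomial_map_carrier[OF hk(1)] in auto)
  qed
  obtain M M' where M: "\<And>t. M t \<in> carrier_mat n n" "\<And>t. M' t \<in> carrier_mat n n"
    "\<And>t. M t * M' t = 1\<^sub>m n" "\<And>t. M (t + 1) * ?C = ?A * M t"
    "\<And>i j. i < n \<Longrightarrow> j < n \<Longrightarrow> \<exists>q. \<forall>t. M t $$ (i,j) = poly q t"
    using jacobian_along_orbit[OF A unit_vec_carrier C n Ce conj'] by metis
  show ?thesis
  proof (cases "e = 0")
    case True
    then show ?thesis using kernel_dim_pow_le[where M = M and M' = M', OF A C M(1,2,3,4)]
      by (simp add: dim_gen_eigenspace_def char_matrix_zero[OF A] char_matrix_zero[OF C])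
  next
    case e: False
    show ?thesis
    proof (cases "k = 0")
      case True
      then show ?thesis
        using carrier_matD(1)[OF char_matrix_closed[OF A, of e]] carrier_matD(1)[OF char_matrix_closed[OF C, of e]]
        by (simp add: dim_gen_eigenspace_def)
    next
      case False
      have "kernel_dim (char_matrix ?C e) \<le> kernel_dim (char_matrix ?A e)"
      proof (rule eigenspace_dim_le[where M = M and M' = M' and k = "length (1 # \<alpha>s)"
            and a = "\<lambda>i. (1 # \<alpha>s) ! i", OF A C M])
        show "?A $$ (i,j) = (if j = i then (1 # \<alpha>s) ! i else 0)"
          if "i < length (1 # \<alpha>s)" "j < n" for i j
          using shift_blocks_index[OF that(1)] that(2) A1(1) by blast
        show "i < j" if "length (1 # \<alpha>s) \<le> i" "i < n" "j < n" "?A $$ (i,j) \<noteq> 0" for i j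
        proof -
          let ?k = "length (1 # \<alpha>s)"
          have nz: "\<not> j < ?k" "jordan_matrix n_as $$ (i - ?k, j - ?k) \<noteq> 0"
            using shift_blocks_index'[OF that(1), of n_as j] that A1(1) by (auto split: if_splits)
          have lt: "i - ?k < sum_list (map fst n_as)" "j - ?k < sum_list (map fst n_as)"
            using that nz A1(1) by auto
          have "block_eigenvalues n_as ! (i - ?k) \<in> set (block_eigenvalues n_as)"
            using lt by (simp add: length_block_eigenvalues)
          also have "\<dots> \<subseteq> snd ` set n_as" by (force simp: block_eigenvalues_def)
          finally have "block_eigenvalues n_as ! (i - ?k) = 0" using A1(2) by auto
          then have "i - ?k \<noteq> j - ?k" using nz jordan_matrix_diag[OF lt(1)] by auto
          moreover have "i - ?k \<le> j - ?k" by (rule jordan_matrix_offdiag(1)[OF lt nz(2)])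
          ultimately show "i < j" using that nz by simp
        qed
      qed (use e in auto)
      then have "dim_gen_eigenspace ?C e 1 \<le> dim_gen_eigenspace ?A e 1"
        using A C by (simp add: dim_gen_eigenspace_def)
      then show ?thesis
        using dim_gen_eigenspace_shift_blocks[OF A1(2) e False] dim_gen_eigenspace_shift_blocks[OF C1(2) e False]
        by simp
    qed
  qed
qed

lemma shift_canonical_unique:
  fixes \<alpha>s \<beta>s :: "'a :: field_char_0 list"
  assumes \<alpha>: "is_shift_canonical n \<alpha>s n_as" and \<beta>: "is_shift_canonical n \<beta>s m_as"
    and conj: "biregularly_conjugate n (shift_canonical_op \<alpha>s (jordan_matrix n_as))
      (shift_canonical_op \<beta>s (jordan_matrix m_as))"
  shows "mset \<alpha>s = mset \<beta>s" "mset n_as = mset m_as"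
proof -
  note A1 = is_shift_canonicalD[OF \<alpha>] and C1 = is_shift_canonicalD[OF \<beta>]
  have "biregularly_conjugate n (shift_canonical_op \<beta>s (jordan_matrix m_as))
      (shift_canonical_op \<alpha>s (jordan_matrix n_as))"
    by (rule biregularly_conjugate_sym[OF conj])
      (rule shift_canonical_op_carrier, rule jordan_matrix_carrier, use A1(1) in simp)
  note le = dim_gen_eigenspace_shift_le[OF \<beta> \<alpha> this] and ge = dim_gen_eigenspace_shift_le[OF \<alpha> \<beta> conj]
  have eq: "mset (shift_blocks \<alpha>s n_as) = mset (shift_blocks \<beta>s m_as)"
    by (rule jordan_nf_mset_eq[OF A1(4) C1(4)]) (rule antisym[OF le ge])
  \<comment> \<open>Whether the eigenvalue is 0 tells the two portions of the block list apart, so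
    filtering recovers each portion from the common multiset.\<close>
  have f1: "filter (\<lambda>na. snd na \<noteq> 0) (shift_blocks as ms) = map (Pair 1) (1 # as)"
      "filter (\<lambda>na. snd na = 0) (shift_blocks as ms) = ms"
    if "0 \<notin> set as" "\<forall>na\<in>set ms. snd na = 0" for as :: "'a list" and ms
    using that by (auto simp: shift_blocks_def filter_id_conv filter_empty_conv)
  have "mset (filter P (shift_blocks \<alpha>s n_as)) = mset (filter P (shift_blocks \<beta>s m_as))" for P
    using eq by (simp only: mset_filter)
  from this[of "\<lambda>na. snd na \<noteq> 0"] this[of "\<lambda>na. snd na = 0"]
  have 1: "mset (map (Pair (1::nat)) (1 # \<alpha>s)) = mset (map (Pair 1) (1 # \<beta>s))" and "mset n_as = mset m_as"
    by (simp_all only: f1[OF A1(3,2)] f1[OF C1(3,2)])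
  then show "mset n_as = mset m_as" by simp
  from arg_cong[OF 1, of "image_mset snd"]
  have "mset (map snd (map (Pair (1::nat)) (1 # \<alpha>s))) = mset (map snd (map (Pair (1::nat)) (1 # \<beta>s)))"
    by (simp only: mset_map)
  then show "mset \<alpha>s = mset \<beta>s" by (simp add: comp_def)
qed

text \<open>Otherwise \<open>A - 1\<close> is invertible, and solving \<open>(A - 1) x = - b\<close>
  yields a fixed point. This is the origin of the leading 1 in the canonical eigenvalue
  list.\<close>

lemma eigenvalue_one_if_no_fixed_point:
  fixes A :: "'a :: field mat"
  assumes A: "A \<in> carrier_mat n n" and b: "b \<in> carrier_vec n"
    and nofp: "\<not> has_fixed_point n (affine_op A b)"
  shows "eigenvalue A 1"
proof (rule ccontr)
  assume "\<not> eigenvalue A 1"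
  then have det: "det (char_matrix A 1) \<noteq> 0" using eigenvalue_det[OF A] by simp
  have X: "char_matrix A 1 \<in> carrier_mat n n" using A by simp
  from det_non_zero_imp_unit[OF X det, unfolded Units_def, of "()"]
  obtain Q where Q: "Q \<in> carrier_mat n n" "char_matrix A 1 * Q = 1\<^sub>m n"
    by (auto simp: ring_mat_def)
  define x where "x = Q *\<^sub>v (- b)"
  have x: "x \<in> carrier_vec n" using Q b by (simp add: x_def)
  have "char_matrix A 1 *\<^sub>v x = - b"
    unfolding x_def using assoc_mult_mat_vec[OF X Q(1), of "- b"] Q(2) b by simp
  moreover have "char_matrix A 1 *\<^sub>v x = A *\<^sub>v x - x"
    unfolding char_matrix_def using A x
    by (subst add_mult_distrib_mat_vec[of _ n n]) (auto intro!: eq_vecI simp: scalar_prod_uminus_left)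
  ultimately have eq: "A *\<^sub>v x - x = - b" by simp
  have "affine_op A b x = x"
  proof (rule eq_vecI)
    fix i assume "i < dim_vec x"
    then have i: "i < n" using x by simp
    from arg_cong[OF eq, of "\<lambda>v :: 'a vec. v $ i"] i A b x
    show "affine_op A b x $ i = x $ i"
      by (simp add: affine_op_def algebra_simps del: index_mult_mat_vec)
  qed (use A b x in \<open>simp add: affine_op_def\<close>)
  with x nofp show False by (auto simp: has_fixed_point_def)
qed

section \<open>Canonical data of an operator without fixed points\<close>

lemma parts_carrier:
  assumes "nonsingular_nilpotent_parts A As Ao"
  shows "As \<in> carrier_mat (dim_row As) (dim_row As)" "Ao \<in> carrier_mat (dim_row Ao) (dim_row Ao)"
  using assms by (auto simp: nonsingular_nilpotent_parts_def invertible_mat_def nilpotent_mat_def)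

text \<open>The eigenvalue 1 of \<open>A\<close> cannot come from the nilpotent part, whose only
  possible eigenvalue is 0, so it belongs to \<open>As\<close>.\<close>

lemma eigenvalue_list_exists:
  fixes A :: "'a :: alg_closed_field mat"
  assumes A: "A \<in> carrier_mat n n" and b: "b \<in> carrier_vec n"
    and nofp: "\<not> has_fixed_point n (affine_op A b)"
    and parts: "nonsingular_nilpotent_parts A As Ao"
  shows "\<exists>\<alpha>s. eigenvalue_list As (1 # \<alpha>s)"
proof -
  obtain m_as where m: "jordan_nf As m_as"
    using jordan_nf_exists_alg_closed[OF parts_carrier(1)[OF parts]] by auto
  obtain n_as where o: "jordan_nf Ao n_as"
    using jordan_nf_exists_alg_closed[OF parts_carrier(2)[OF parts]] by auto
  note jn = nonsingular_nilpotent_parts_jordan[OF parts m o]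
  have "1 \<in> snd ` set (m_as @ n_as)"
    using eigenvalue_one_if_no_fixed_point[OF A b nofp] jordan_nf_eigenvalue_iff[OF jn(1)] by simp
  then have "1 \<in> snd ` set m_as" using jn(3) by force
  then have "alg_mult As 1 \<noteq> 0"
    using jordan_nf_eigenvalue_iff[OF m] eigenvalue_iff_alg_mult[OF jordan_nf_carrier[OF m]] by simp
  then have "1 \<in> set (block_eigenvalues m_as)"
    by (simp add: jordan_nf_alg_mult[OF m] count_list_0_iff)
  then have "mset (1 # remove1 1 (block_eigenvalues m_as)) = mset (block_eigenvalues m_as)"
    by simp
  then show ?thesis using eigenvalue_list_iff[OF m] by blast
qed

text \<open>Holds for every choice of parts and every ordering of the eigenvalues. This freedom lets
  two operators with equal invariants be sent to literally the same canonical operator.\<close>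

lemma canonical_form_without_fixed_point:
  fixes A :: "'a :: {alg_closed_field, field_char_0} mat"
  assumes A: "A \<in> carrier_mat n n" and b: "b \<in> carrier_vec n"
    and nofp: "\<not> has_fixed_point n (affine_op A b)"
    and parts: "nonsingular_nilpotent_parts A As Ao"
    and es: "eigenvalue_list As (1 # \<alpha>s)" and o: "jordan_nf Ao n_as"
  shows "biregularly_conjugate n (affine_op A b) (shift_canonical_op \<alpha>s (jordan_matrix n_as))"
    "is_shift_canonical n \<alpha>s n_as"
proof -
  obtain m_as where m: "jordan_nf As m_as"
    using jordan_nf_exists_alg_closed[OF parts_carrier(1)[OF parts]] by auto
  note jn = nonsingular_nilpotent_parts_jordan[OF parts m o]
  let ?J = "jordan_matrix (m_as @ n_as)"
  have n: "n = sum_list (map fst (m_as @ n_as))"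
    using jordan_nf_carrier[OF jn(1)] A by (metis carrier_matD(1))
  have J: "?J \<in> carrier_mat n n" unfolding n by (rule jordan_matrix_carrier)
  have ms: "mset (1 # \<alpha>s) = mset (block_eigenvalues m_as)"
    using eigenvalue_list_iff[OF m] es by simp
  have "similar_mat A ?J" using jn(1) by (simp add: jordan_nf_def)
  then obtain d where d: "d \<in> carrier_vec n" "biregularly_conjugate n (affine_op A b) (affine_op ?J d)"
    using biregularly_conjugate_similar[OF A b] by metis
  have "\<not> has_fixed_point n (affine_op ?J d)"
    using has_fixed_point_conjugate[OF d(2)] nofp affine_op_carrier[OF A b] by blast
  then have "biregularly_conjugate n (affine_op ?J d) (shift_canonical_op \<alpha>s (jordan_matrix n_as))"
    using conjugate_to_shift_canonical[OF jn(2,3) _ _ ms] d(1) unfolding n by blast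
  then show "biregularly_conjugate n (affine_op A b) (shift_canonical_op \<alpha>s (jordan_matrix n_as))"
    using biregularly_conjugate_trans[OF d(2)] affine_op_carrier[OF A b] by blast
  have "set \<alpha>s \<subseteq> set (block_eigenvalues m_as)" using mset_eq_setD[OF ms] by auto
  also have "\<dots> \<subseteq> snd ` set m_as" by (force simp: block_eigenvalues_def)
  finally have "0 \<notin> set \<alpha>s" using jn(2) by blast
  moreover have "Suc (length \<alpha>s) = sum_list (map fst m_as)"
    using mset_eq_length[OF ms] by (simp add: length_block_eigenvalues)
  moreover have z: "0 \<notin> fst ` set n_as" using o by (simp add: jordan_nf_def)
  moreover have "nilpotent_mat (jordan_matrix n_as)"
    using jn(3) nilpotent_jordan_matrix_iff[OF z] by simp
  ultimately show "is_shift_canonical n \<alpha>s n_as"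
    using n by (simp add: is_shift_canonical_def)
qed

lemma same_eigenvalues_iff:
  fixes A B :: "'a :: field mat"
  assumes A: "jordan_nf A n_as" and B: "jordan_nf B m_as"
  shows "same_eigenvalues_with_mult A B \<longleftrightarrow>
    mset (block_eigenvalues n_as) = mset (block_eigenvalues m_as)"
proof -
  have "same_eigenvalues_with_mult A B \<longleftrightarrow> (\<forall>a. alg_mult A a = alg_mult B a)"
    unfolding same_eigenvalues_with_mult_def
      eigenvalue_iff_alg_mult[OF jordan_nf_carrier[OF A]] eigenvalue_iff_alg_mult[OF jordan_nf_carrier[OF B]]
    by metis
  then show ?thesis
    by (simp add: jordan_nf_alg_mult[OF A] jordan_nf_alg_mult[OF B] multiset_eq_iff count_mset)
qed

lemma conjugate_iff_without_fixed_points: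
  fixes A C :: "'a :: {alg_closed_field, field_char_0} mat"
  assumes A: "A \<in> carrier_mat n n" and b: "b \<in> carrier_vec n"
    and C: "C \<in> carrier_mat n n" and d: "d \<in> carrier_vec n"
    and nofA: "\<not> has_fixed_point n (affine_op A b)" and nofC: "\<not> has_fixed_point n (affine_op C d)"
    and pA: "nonsingular_nilpotent_parts A As Ao" and pC: "nonsingular_nilpotent_parts C Cs Co"
  shows "biregularly_conjugate n (affine_op A b) (affine_op C d) \<longleftrightarrow>
    same_eigenvalues_with_mult As Cs \<and> similar_mat Ao Co"
proof -
  obtain as os cs co where j: "jordan_nf As as" "jordan_nf Ao os" "jordan_nf Cs cs" "jordan_nf Co co"
    using jordan_nf_exists_alg_closed[OF parts_carrier(1)[OF pA]]
      jordan_nf_exists_alg_closed[OF parts_carrier(2)[OF pA]]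
      jordan_nf_exists_alg_closed[OF parts_carrier(1)[OF pC]]
      jordan_nf_exists_alg_closed[OF parts_carrier(2)[OF pC]] by auto
  obtain \<alpha>s where \<alpha>: "eigenvalue_list As (1 # \<alpha>s)" using eigenvalue_list_exists[OF A b nofA pA] by auto
  obtain \<beta>s where \<beta>: "eigenvalue_list Cs (1 # \<beta>s)" using eigenvalue_list_exists[OF C d nofC pC] by auto
  note cA = canonical_form_without_fixed_point[OF A b nofA pA \<alpha> j(2)]
  note cC = canonical_form_without_fixed_point[OF C d nofC pC \<beta> j(4)]
  note fA = affine_op_carrier[OF A b] and fC = affine_op_carrier[OF C d]
  show ?thesis
  proof
    assume conj: "biregularly_conjugate n (affine_op A b) (affine_op C d)"
    have "biregularly_conjugate n (shift_canonical_op \<alpha>s (jordan_matrix os)) (affine_op A b)"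
      by (rule biregularly_conjugate_sym[OF cA(1) fA])
    moreover have "biregularly_conjugate n (affine_op A b) (shift_canonical_op \<beta>s (jordan_matrix co))"
      by (rule biregularly_conjugate_trans[OF conj cC(1) fA])
    moreover have "shift_canonical_op \<alpha>s (jordan_matrix os) x \<in> carrier_vec n" for x
      by (rule shift_canonical_op_carrier[OF jordan_matrix_carrier])
        (use cA(2) in \<open>simp add: is_shift_canonical_def\<close>)
    ultimately have "biregularly_conjugate n (shift_canonical_op \<alpha>s (jordan_matrix os))
        (shift_canonical_op \<beta>s (jordan_matrix co))"
      by (rule biregularly_conjugate_trans)
    note eq = shift_canonical_unique[OF cA(2) cC(2) this]
    have "mset (block_eigenvalues as) = mset (block_eigenvalues cs)"
      using eq(1) \<alpha> \<beta> eigenvalue_list_iff[OF j(1)] eigenvalue_list_iff[OF j(3)] by (metis mset.simps(2))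
    moreover have "similar_mat Ao Co"
      using j(2,4) similar_jordan_matrix_mset[OF eq(2)] similar_mat_sym similar_mat_trans
      unfolding jordan_nf_def by metis
    ultimately show "same_eigenvalues_with_mult As Cs \<and> similar_mat Ao Co"
      using same_eigenvalues_iff[OF j(1,3)] by simp
  next
    assume same: "same_eigenvalues_with_mult As Cs \<and> similar_mat Ao Co"
    \<comment> \<open>The canonical data chosen for \<open>A\<close> are equally valid for
      \<open>C\<close>, so both operators meet in one canonical operator.\<close>
    then have "eigenvalue_list Cs (1 # \<alpha>s)"
      using \<alpha> eigenvalue_list_iff[OF j(1)] eigenvalue_list_iff[OF j(3)] same_eigenvalues_iff[OF j(1,3)]
      by simp
    moreover have "jordan_nf Co os"
      using same j(2) similar_mat_sym similar_mat_trans unfolding jordan_nf_def by metis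
    ultimately have "biregularly_conjugate n (affine_op C d) (shift_canonical_op \<alpha>s (jordan_matrix os))"
      by (rule canonical_form_without_fixed_point(1)[OF C d nofC pC])
    from biregularly_conjugate_sym[OF this fC]
    show "biregularly_conjugate n (affine_op A b) (affine_op C d)"
      by (rule biregularly_conjugate_trans[OF cA(1) _ fA])
  qed
qed

section \<open>Linear canonical forms and the full classification\<close>

lemma linear_op_affine:
  assumes "J \<in> carrier_mat n n" "x \<in> carrier_vec n"
  shows "affine_op J (0\<^sub>v n) x = J *\<^sub>v (x :: 'a :: comm_ring_1 vec)"
  using assms by (simp add: affine_op_def)

lemma conjugate_to_linear_iff:
  fixes A :: "'a :: {idom, ring_char_0} mat"
  assumes A: "A \<in> carrier_mat n n" and b: "b \<in> carrier_vec n" and J: "J \<in> carrier_mat n n"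
    and fp: "has_fixed_point n (affine_op A b)"
  shows "biregularly_conjugate n (affine_op A b) (\<lambda>x. J *\<^sub>v x) \<longleftrightarrow> similar_mat A J"
proof -
  have "affine_op J (0\<^sub>v n) (0\<^sub>v n) = 0\<^sub>v n"
    using J by (auto simp: affine_op_def)
  then have fpJ: "has_fixed_point n (affine_op J (0\<^sub>v n))"
    unfolding has_fixed_point_def by (intro bexI[of _ "0\<^sub>v n"]) auto
  have "biregularly_conjugate n (affine_op A b) (\<lambda>x. J *\<^sub>v x) \<longleftrightarrow>
      biregularly_conjugate n (affine_op A b) (affine_op J (0\<^sub>v n))"
    using linear_op_affine[OF J] by (auto elim!: biregularly_conjugate_cong)
  then show ?thesis
    using biregularly_conjugate_iff_similar[OF A b J zero_carrier_vec fp fpJ] by simp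
qed

text \<open>The parts, eigenvalue lists and Jordan lists are quantified universally where they are
  used; the separate existence clauses ensure that these universal claims are not vacuous.\<close>

theorem theorem2:
  fixes n :: nat
  assumes "n \<ge> 1"
  shows
    "(\<forall>A :: 'a :: {alg_closed_field, field_char_0} mat \<in> carrier_mat n n. \<forall>C\<in>carrier_mat n n.
      \<forall>b\<in>carrier_vec n. \<forall>d\<in>carrier_vec n.
        (has_fixed_point n (affine_op A b) \<and> has_fixed_point n (affine_op C d) \<longrightarrow>
          (biregularly_conjugate n (affine_op A b) (affine_op C d) \<longleftrightarrow> similar_mat A C)) \<and>
        (\<not> has_fixed_point n (affine_op A b) \<and> \<not> has_fixed_point n (affine_op C d) \<longrightarrow>
          (\<forall>As Ao Cs Co.
             nonsingular_nilpotent_parts A As Ao \<and> nonsingular_nilpotent_parts C Cs Co \<longrightarrow>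
             (biregularly_conjugate n (affine_op A b) (affine_op C d) \<longleftrightarrow>
                same_eigenvalues_with_mult As Cs \<and> similar_mat Ao Co))))
     \<and>
     (\<forall>A :: 'a mat \<in> carrier_mat n n. \<forall>b\<in>carrier_vec n.
        (has_fixed_point n (affine_op A b) \<longrightarrow>
          (\<exists>n_as. jordan_nf A n_as) \<and>
          (\<forall>n_as. jordan_nf A n_as \<longrightarrow>
             biregularly_conjugate n (affine_op A b) (\<lambda>x. jordan_matrix n_as *\<^sub>v x) \<and>
             (\<forall>n_as'. 0 \<notin> fst ` set n_as' \<and> dim_row (jordan_matrix n_as') = n \<and>
                biregularly_conjugate n (affine_op A b) (\<lambda>x. jordan_matrix n_as' *\<^sub>v x) \<longrightarrow>
                mset n_as' = mset n_as))) \<and>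
        (\<not> has_fixed_point n (affine_op A b) \<longrightarrow>
          (\<exists>As Ao \<alpha>s n_as. nonsingular_nilpotent_parts A As Ao \<and>
             eigenvalue_list As (1 # \<alpha>s) \<and> jordan_nf Ao n_as) \<and>
          (\<forall>As Ao \<alpha>s n_as. nonsingular_nilpotent_parts A As Ao \<and>
             eigenvalue_list As (1 # \<alpha>s) \<and> jordan_nf Ao n_as \<longrightarrow>
             biregularly_conjugate n (affine_op A b)
               (shift_canonical_op \<alpha>s (jordan_matrix n_as))) \<and>
          (\<forall>\<alpha>s n_as \<beta>s m_as.
             is_shift_canonical n \<alpha>s n_as \<and> is_shift_canonical n \<beta>s m_as \<and>
             biregularly_conjugate n (affine_op A b)
               (shift_canonical_op \<alpha>s (jordan_matrix n_as)) \<and>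
             biregularly_conjugate n (affine_op A b)
               (shift_canonical_op \<beta>s (jordan_matrix m_as)) \<longrightarrow>
             length \<alpha>s = length \<beta>s \<and> mset \<alpha>s = mset \<beta>s \<and> mset n_as = mset m_as)))"
proof (intro conjI ballI impI allI)
  fix A C :: "'a mat" and b d
  assume "A \<in> carrier_mat n n" "C \<in> carrier_mat n n" "b \<in> carrier_vec n" "d \<in> carrier_vec n"
    "has_fixed_point n (affine_op A b) \<and> has_fixed_point n (affine_op C d)"
  then show "biregularly_conjugate n (affine_op A b) (affine_op C d) \<longleftrightarrow> similar_mat A C"
    by (intro biregularly_conjugate_iff_similar) auto
next
  fix A C :: "'a mat" and b d As Ao Cs Co
  assume "A \<in> carrier_mat n n" "C \<in> carrier_mat n n" "b \<in> carrier_vec n" "d \<in> carrier_vec n"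
    "\<not> has_fixed_point n (affine_op A b) \<and> \<not> has_fixed_point n (affine_op C d)"
    "nonsingular_nilpotent_parts A As Ao \<and> nonsingular_nilpotent_parts C Cs Co"
  then show "biregularly_conjugate n (affine_op A b) (affine_op C d) \<longleftrightarrow>
      same_eigenvalues_with_mult As Cs \<and> similar_mat Ao Co"
    by (intro conjugate_iff_without_fixed_points) auto
next
  fix A :: "'a mat" and b :: "'a vec"
  assume A: "A \<in> carrier_mat n n" and b: "b \<in> carrier_vec n"
  show "\<exists>n_as. jordan_nf A n_as" by (rule jordan_nf_exists_alg_closed[OF A])
  assume fp: "has_fixed_point n (affine_op A b)"
  fix n_as :: "(nat \<times> 'a) list" assume jnf: "jordan_nf A n_as"
  have "similar_mat A (jordan_matrix n_as)" using jnf by (simp add: jordan_nf_def)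
  then show "biregularly_conjugate n (affine_op A b) (\<lambda>x. jordan_matrix n_as *\<^sub>v x)"
    using conjugate_to_linear_iff[OF A b similar_mat_carrier[OF _ A] fp] by blast
  fix n_as' :: "(nat \<times> 'a) list"
  assume *: "0 \<notin> fst ` set n_as' \<and> dim_row (jordan_matrix n_as') = n \<and>
    biregularly_conjugate n (affine_op A b) (\<lambda>x. jordan_matrix n_as' *\<^sub>v x)"
  then have "jordan_matrix n_as' \<in> carrier_mat n n" using jordan_matrix_carrier[of n_as'] by simp
  from conjugate_to_linear_iff[OF A b this fp] * have "jordan_nf A n_as'" by (simp add: jordan_nf_def)
  then show "mset n_as' = mset n_as" using jordan_nf_unique_mset jnf by blast
next
  fix A :: "'a mat" and b :: "'a vec"
  assume A: "A \<in> carrier_mat n n" and b: "b \<in> carrier_vec n"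
    and nofp: "\<not> has_fixed_point n (affine_op A b)"
  obtain n_as where "jordan_nf A n_as" using jordan_nf_exists_alg_closed[OF A] by auto
  note parts = nonsingular_nilpotent_parts_exist[OF this]
  from eigenvalue_list_exists[OF A b nofp parts(1)] parts(1,3)
  show "\<exists>As Ao \<alpha>s n_as. nonsingular_nilpotent_parts A As Ao \<and>
      eigenvalue_list As (1 # \<alpha>s) \<and> jordan_nf Ao n_as" by blast
next
  fix A :: "'a mat" and b As Ao \<alpha>s n_as
  assume "A \<in> carrier_mat n n" "b \<in> carrier_vec n" "\<not> has_fixed_point n (affine_op A b)"
    "nonsingular_nilpotent_parts A As Ao \<and> eigenvalue_list As (1 # \<alpha>s) \<and> jordan_nf Ao n_as"
  then show "biregularly_conjugate n (affine_op A b) (shift_canonical_op \<alpha>s (jordan_matrix n_as))"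
    using canonical_form_without_fixed_point(1) by blast
next
  fix A :: "'a mat" and b :: "'a vec" and \<alpha>s \<beta>s :: "'a list" and n_as m_as :: "(nat \<times> 'a) list"
  assume A: "A \<in> carrier_mat n n" and b: "b \<in> carrier_vec n"
    and *: "is_shift_canonical n \<alpha>s n_as \<and> is_shift_canonical n \<beta>s m_as \<and>
      biregularly_conjugate n (affine_op A b) (shift_canonical_op \<alpha>s (jordan_matrix n_as)) \<and>
      biregularly_conjugate n (affine_op A b) (shift_canonical_op \<beta>s (jordan_matrix m_as))"
  have "biregularly_conjugate n (shift_canonical_op \<alpha>s (jordan_matrix n_as)) (affine_op A b)"
    by (rule biregularly_conjugate_sym) (use * affine_op_carrier[OF A b] in auto)
  moreover have "shift_canonical_op \<alpha>s (jordan_matrix n_as) x \<in> carrier_vec n" for x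
    by (rule shift_canonical_op_carrier[OF jordan_matrix_carrier])
      (use * in \<open>simp add: is_shift_canonical_def\<close>)
  ultimately have "biregularly_conjugate n (shift_canonical_op \<alpha>s (jordan_matrix n_as))
      (shift_canonical_op \<beta>s (jordan_matrix m_as))"
    using biregularly_conjugate_trans * by blast
  from shift_canonical_unique[OF _ _ this] *
  show ms: "mset \<alpha>s = mset \<beta>s" and "mset n_as = mset m_as" by blast+
  from mset_eq_length[OF ms] show "length \<alpha>s = length \<beta>s" .
qed

end
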